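(* Let $G$ be a strongly connected digraph of order $p\geq 3$ such that $d(x)+d(y)\geq 2p-2$ for every pair of non-adjacent vertices $x,y$ of $G$. Then $G$ contains a Hamiltonian bypass, unless $G$ is isomorphic to a digraph of type $D_0$, or $G$ is isomorphic to $D_{p-k,k}$ for some $k\in[1,p-2]$, or $G$ is isomorphic to $T_5$ or to $C_3$.
   Context: Digraphs are finite, without loops and without multiple arcs (a pair of opposite arcs $xy,yx$ is allowed). For a vertex $x$, $d(x)=od(x)+id(x)$ is the sum of its out-degree and in-degree. Two distinct vertices are adjacent if at least one of the arcs $xy$, $yx$ is present. A Hamiltonian bypass in a digraph $G$ of order $p$ is a subdigraph consisting of a Hamiltonian path $v_1v_2\ldots v_p$ of $G$ together with the arc $v_1v_p$ (i.e., a Hamiltonian path whose initial vertex dominates its terminal vertex). $K^*_n$ denotes the complete symmetric digraph on $n$ vertices (every ordered pair of distinct vertices is an arc). For $k\in[1,p-2]$, $D_{p-k,k}$ is the digraph of order $p$ obtained from $K^*_{p-k}$ and $K^*_{k+1}$ by identifying a vertex of the first with a vertex of the second. A digraph of type $D_0$ is any digraph of odd order $p\geq 3$ whose vertex set is a disjoint union $A\cup B$ where $A$ is an independent set of $(p+1)/2$ vertices, $B$ is a set of $(p-1)/2$ vertices inducing an arbitrary subdigraph, and all arcs $ab$ and $ba$ with $a\in A$, $b\in B$ are present. $T_5$ is the tournament with vertex set $\{z_1,z_2,z_3,z_4,y\}$ and arc set $\{z_1z_2,z_2z_3,z_3z_4,z_4z_1,z_1y,z_3y,yz_2,yz_4,z_1z_3,z_2z_4\}$.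 $C_3$ is the directed cycle of length three. *)

theory Defs
  imports Graph_Theory.Graph_Theory
begin

definition adjacent :: "('a, 'b) pre_digraph \<Rightarrow> 'a \<Rightarrow> 'a \<Rightarrow> bool" where
  "adjacent G x y \<longleftrightarrow> x \<noteq> y \<and> (x \<rightarrow>\<^bsub>G\<^esub> y \<or> y \<rightarrow>\<^bsub>G\<^esub> x)"

definition total_degree :: "('a, 'b) pre_digraph \<Rightarrow> 'a \<Rightarrow> nat" where
  "total_degree G x = out_degree G x + in_degree G x"

definition hamiltonian_path :: "'a list \<Rightarrow> ('a, 'b) pre_digraph \<Rightarrow> bool" where
  "hamiltonian_path vs G \<longleftrightarrow> vpath vs G \<and> set vs = verts G"

text \<open>
  In a digraph without multiple arcs the arc set of a subdigraph is determined by its set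
  \<^term>\<open>arcs_ends H\<close> of end pairs, and \<^term>\<open>vwalk_arcs vs\<close> lists the pairs of consecutive
  entries of \<^term>\<open>vs\<close>.
\<close>

definition hamiltonian_bypass :: "('a, 'b) pre_digraph \<Rightarrow> ('a, 'b) pre_digraph \<Rightarrow> bool" where
  "hamiltonian_bypass H G \<longleftrightarrow> subgraph H G \<and>
     (\<exists>vs. hamiltonian_path vs G \<and> verts H = set vs \<and>
           arcs_ends H = insert (hd vs, last vs) (set (vwalk_arcs vs)))"

definition complete_symmetric_on :: "'a set \<Rightarrow> 'a pair_pre_digraph" where
  "complete_symmetric_on A = \<lparr> pverts = A, parcs = {(u, v). u \<in> A \<and> v \<in> A \<and> u \<noteq> v} \<rparr>"

text \<open>
  For \<open>m \<ge> 1\<close>, the two complete symmetric digraphs, of orders \<open>m\<close> and \<open>k + 1\<close>, share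
  exactly the vertex \<open>m - 1\<close>; this is the vertex obtained by the identification.
\<close>

definition D_graph :: "nat \<Rightarrow> nat \<Rightarrow> (nat, nat \<times> nat) pre_digraph" where
  "D_graph m k =
     Digraph_Component.union (with_proj (complete_symmetric_on {0..<m}))
                             (with_proj (complete_symmetric_on {m - 1..<m + k}))"

definition type_D0 :: "('a, 'b) pre_digraph \<Rightarrow> bool" where
  "type_D0 H \<longleftrightarrow> digraph H \<and> odd (card (verts H)) \<and> card (verts H) \<ge> 3 \<and>
     (\<exists>A B. verts H = A \<union> B \<and> A \<inter> B = {} \<and>
        card A = (card (verts H) + 1) div 2 \<and> card B = (card (verts H) - 1) div 2 \<and>
        (\<forall>a\<in>A. \<forall>a'\<in>A. \<not> adjacent H a a') \<and>
        (\<forall>a\<in>A. \<forall>b\<in>B. a \<rightarrow>\<^bsub>H\<^esub> b \<and> b \<rightarrow>\<^bsub>H\<^esub> a))"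

datatype T5_vertex = Z1 | Z2 | Z3 | Z4 | Y

definition T5 :: "T5_vertex pair_pre_digraph" where
  "T5 = \<lparr> pverts = {Z1, Z2, Z3, Z4, Y},
          parcs = {(Z1, Z2), (Z2, Z3), (Z3, Z4), (Z4, Z1), (Z1, Y), (Z3, Y),
                   (Y, Z2), (Y, Z4), (Z1, Z3), (Z2, Z4)} \<rparr>"

definition C3 :: "nat pair_pre_digraph" where
  "C3 = \<lparr> pverts = {0, 1, 2}, parcs = {(0, 1), (1, 2), (2, 0)} \<rparr>"

end

theory Submission
  imports Defs
begin

text \<open>
  Suppose there is no Hamiltonian bypass. Then no arc of a Hamiltonian cycle has its reverse in
  \<open>G\<close>, and a vertex missed by a cycle of length \<open>p - 1\<close> neither dominates nor is
  dominated by two consecutive vertices of that cycle.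

  Let \<open>S\<close> be the vertex set of a longest non-Hamiltonian cycle and \<open>R\<close> its complement.
  As in the Bondy--Thomassen proof of Meyniel's theorem, take a path through \<open>R\<close> whose ends on
  the cycle enclose a shortest gap, and insert the vertices of the gap one by one into the rest of the
  cycle. Some vertex \<open>u\<close> of the gap cannot be inserted, and for a vertex \<open>r\<close> of the path
  this yields \<open>d(u) + d(r) \<le> 2p - 2\<close>, so that all estimates are equalities.

  If all connections of some \<open>r\<close> to the cycle use one vertex, equality gives \<open>D_{p-k,k}\<close>.
  Otherwise, if \<open>card R \<ge> 2\<close>, either \<open>R\<close> is semicomplete and its Hamiltonian path
  extends to a bypass, or \<open>R\<close> bridges two consecutive vertices of the cycle; then every vertex of
  \<open>R\<close> has degree at most \<open>p - 1\<close>, and shortest gaps give contradictions.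

  If \<open>R = {y}\<close> and \<open>y\<close> has a non-neighbour, the gaps containing non-neighbours of
  \<open>y\<close> lead to \<open>D_0\<close> or \<open>D_{p-1,1}\<close>. If \<open>y\<close> is adjacent to all vertices,
  in- and out-neighbours of \<open>y\<close> alternate on the cycle. The same holds for every cycle of length
  \<open>p - 1\<close>, and this forces \<open>p = 5\<close> and \<open>T_5\<close>. When there is no shorter
  cycle at all, \<open>G\<close> is \<open>C_3\<close>.
\<close>

section \<open>Paths, cycles and insertion of vertices\<close>

text \<open>The degree condition has no slack, so the long-cycle argument ends in equality
  everywhere. Let \<open>L\<close> be the retained stretch of the cycle and \<open>W\<close> the
  gap. An outside vertex \<open>r\<close> has at most |L| + 1 arcs to \<open>L\<close>, an
  uninserted \<open>u\<close> in \<open>W\<close> at most m + |W| - 1 arcs to the cycle, and every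
  further outside vertex carries at most two arcs to \<open>r\<close> and \<open>u\<close> together;
  this adds up to exactly 2p - 2.

  Two obstacles shape the case distinction. A cycle longer than \<open>m\<close> is contradictory
  only if it is not Hamiltonian, and Hamiltonian cycles may well exist; hence outside sets of one
  vertex, of two, and of three or more need different arguments. And a bridge between consecutive
  vertices leaves an empty gap, so there is no \<open>u\<close> to compare with and another gap has
  to be found.

  Reversing all arcs preserves the hypotheses, which settles dual claims at once. Cycles are lists
  cut open at one arc; claims about an arbitrary arc are proved for the pair \<open>last\<close>,
  \<open>hd\<close> and transported by rotation.\<close>

definition narcs :: "('a \<Rightarrow> 'a \<Rightarrow> bool) \<Rightarrow> 'a \<Rightarrow> 'a \<Rightarrow> nat" where
  "narcs E x y = of_bool (E x y) + of_bool (E y x)"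

definition deg :: "('a \<Rightarrow> 'a \<Rightarrow> bool) \<Rightarrow> 'a \<Rightarrow> 'a set \<Rightarrow> nat" where
  "deg E x A = (\<Sum>a\<in>A. narcs E x a)"

definition path :: "('a \<Rightarrow> 'a \<Rightarrow> bool) \<Rightarrow> 'a list \<Rightarrow> bool" where
  "path E xs \<longleftrightarrow> xs \<noteq> [] \<and> distinct xs \<and> successively E xs"

definition cyc :: "('a \<Rightarrow> 'a \<Rightarrow> bool) \<Rightarrow> 'a list \<Rightarrow> bool" where
  "cyc E xs \<longleftrightarrow> path E xs \<and> E (last xs) (hd xs)"

definition no_insert :: "('a \<Rightarrow> 'a \<Rightarrow> bool) \<Rightarrow> 'a \<Rightarrow> 'a list \<Rightarrow> bool" where
  "no_insert E v xs \<longleftrightarrow> successively (\<lambda>a b. \<not> (E a v \<and> E v b)) xs"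

definition restr :: "('a \<Rightarrow> 'a \<Rightarrow> bool) \<Rightarrow> 'a set \<Rightarrow> 'a \<Rightarrow> 'a \<Rightarrow> bool" where
  "restr E R x y \<longleftrightarrow> x \<in> R \<and> y \<in> R \<and> E x y"

text \<open>These are the vertices from which \<open>r\<close> can be entered through
  \<open>R\<close>. They take the place of in-neighbours of \<open>r\<close>, so that a gap may be
  bridged by a whole path through \<open>R\<close> and not only by \<open>r\<close> itself.\<close>

definition inreach :: "('a \<Rightarrow> 'a \<Rightarrow> bool) \<Rightarrow> 'a set \<Rightarrow> 'a \<Rightarrow> 'a set" where
  "inreach E R r = {s. \<exists>x\<in>R. E s x \<and> (restr E R)\<^sup>*\<^sup>* x r}"

definition outreach :: "('a \<Rightarrow> 'a \<Rightarrow> bool) \<Rightarrow> 'a set \<Rightarrow> 'a \<Rightarrow> 'a set" where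
  "outreach E R r = {s. \<exists>x\<in>R. E x s \<and> (restr E R)\<^sup>*\<^sup>* r x}"

lemma narcs_sym: "narcs E x y = narcs E y x"
  by (simp add: narcs_def)

lemma narcs_le_2: "narcs E x y \<le> 2"
  by (simp add: narcs_def)

lemma narcs_0_iff: "narcs E x y = 0 \<longleftrightarrow> \<not> E x y \<and> \<not> E y x"
  by (simp add: narcs_def)

lemma narcs_2_iff: "narcs E x y = 2 \<longleftrightarrow> E x y \<and> E y x"
  by (auto simp: narcs_def)

lemma narcs_conv [simp]: "narcs E\<inverse>\<inverse> = narcs E"
  by (auto simp: narcs_def fun_eq_iff)

lemma deg_conv [simp]: "deg E\<inverse>\<inverse> = deg E"
  by (auto simp: deg_def fun_eq_iff)

lemma deg_empty [simp]: "deg E x {} = 0"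
  by (simp add: deg_def)

lemma deg_insert: "finite A \<Longrightarrow> a \<notin> A \<Longrightarrow> deg E x (insert a A) = narcs E x a + deg E x A"
  by (simp add: deg_def)

lemma deg_Un: "finite A \<Longrightarrow> finite B \<Longrightarrow> A \<inter> B = {} \<Longrightarrow> deg E x (A \<union> B) = deg E x A + deg E x B"
  by (simp add: deg_def sum.union_disjoint)

lemma deg_remove: "finite A \<Longrightarrow> a \<in> A \<Longrightarrow> deg E x A = narcs E x a + deg E x (A - {a})"
  by (simp add: deg_def sum.remove)

lemma deg_le: "finite A \<Longrightarrow> deg E x A \<le> 2 * card A"
  unfolding deg_def using sum_bounded_above[of A "narcs E x" 2] by (simp add: narcs_le_2 mult.commute)

lemma deg_eq_0: "(\<And>a. a \<in> A \<Longrightarrow> narcs E x a = 0) \<Longrightarrow> deg E x A = 0"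
  by (simp add: deg_def)

lemma deg_list: "distinct xs \<Longrightarrow> deg E x (set xs) = sum_list (map (narcs E x) xs)"
  by (simp add: deg_def sum_list_distinct_conv_sum_set)

lemma deg_complete:
  assumes "finite A" "2 * card A \<le> deg E x A" "a \<in> A"
  shows "narcs E x a = 2"
proof (rule ccontr)
  assume "narcs E x a \<noteq> 2"
  then have "narcs E x a \<le> 1" using narcs_le_2[of E x a] by simp
  moreover have "deg E x (A - {a}) \<le> 2 * (card A - 1)"
    using deg_le[of "A - {a}" E x] assms by simp
  moreover have "card A \<ge> 1" using assms by (simp add: Suc_le_eq card_gt_0_iff) blast
  ultimately show False using assms deg_remove[of A a E x] by simp
qed

lemma deg_sum_le:
  assumes "finite A" "\<And>v. v \<in> A \<Longrightarrow> narcs E x v + narcs E y v \<le> 2"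
  shows "deg E x A + deg E y A \<le> 2 * card A"
  unfolding deg_def sum.distrib[symmetric]
  using sum_bounded_above[of A "\<lambda>v. narcs E x v + narcs E y v" 2] assms by (simp add: mult.commute)

lemma deg_sum_eq:
  assumes "finite A" "\<And>v. v \<in> A \<Longrightarrow> narcs E x v + narcs E y v \<le> 2"
    and "2 * card A \<le> deg E x A + deg E y A" "a \<in> A"
  shows "narcs E x a + narcs E y a = 2"
proof (rule ccontr)
  assume "narcs E x a + narcs E y a \<noteq> 2"
  then have "narcs E x a + narcs E y a \<le> 1" using assms(2)[of a] assms(4) by simp
  moreover have "deg E x (A - {a}) + deg E y (A - {a}) \<le> 2 * (card A - 1)"
    using deg_sum_le[of "A - {a}" E x y] assms by simp
  moreover have "card A \<ge> 1" using assms by (simp add: Suc_le_eq card_gt_0_iff) blast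
  ultimately show False using assms deg_remove[of A a E x] deg_remove[of A a E y] by simp
qed

section \<open>Paths and cycles as vertex lists: cutting, rotating, gaps\<close>

lemma path_Nil [simp]: "\<not> path E []" by (simp add: path_def)

lemma path_Cons: "path E (x # xs) \<longleftrightarrow> xs = [] \<or> x \<notin> set xs \<and> E x (hd xs) \<and> path E xs"
  by (auto simp: path_def successively_Cons)

lemma path_append:
  "path E (xs @ ys) \<longleftrightarrow>
     (if xs = [] then path E ys else if ys = [] then path E xs
      else path E xs \<and> path E ys \<and> set xs \<inter> set ys = {} \<and> E (last xs) (hd ys))"
  by (auto simp: path_def successively_append_iff)

lemma path_rev [simp]: "path E (rev xs) \<longleftrightarrow> path E\<inverse>\<inverse> xs"
  by (simp add: path_def conversep_iff[abs_def])

lemma cyc_rev [simp]: "cyc E (rev xs) \<longleftrightarrow> cyc E\<inverse>\<inverse> xs"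
  by (auto simp: cyc_def hd_rev last_rev)

lemma cyc_append:
  "xs \<noteq> [] \<Longrightarrow> ys \<noteq> [] \<Longrightarrow> cyc E (xs @ ys) \<longleftrightarrow>
     path E xs \<and> path E ys \<and> set xs \<inter> set ys = {} \<and> E (last xs) (hd ys) \<and> E (last ys) (hd xs)"
  by (auto simp: cyc_def path_append)

lemma cyc_swap: "cyc E (xs @ ys) \<Longrightarrow> cyc E (ys @ xs)"
  by (cases "xs = []"; cases "ys = []") (auto simp: cyc_append)

lemma cyc_hd_at:
  assumes "cyc E xs" "x \<in> set xs"
  obtains ys where "cyc E (x # ys)" "set (x # ys) = set xs" "length (x # ys) = length xs"
proof -
  obtain A B where "xs = A @ x # B" using assms(2) by (meson split_list)
  then show thesis using cyc_swap[of E A "x # B"] assms(1) that[of "B @ A"] by auto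
qed

lemma cyc_last_at:
  assumes "cyc E xs" "x \<in> set xs"
  obtains ys where "cyc E (ys @ [x])" "set (ys @ [x]) = set xs" "length (ys @ [x]) = length xs"
proof -
  obtain A B where "xs = A @ x # B" using assms(2) by (meson split_list)
  then show thesis using cyc_swap[of E "A @ [x]" B] assms(1) that[of "B @ A"] by auto
qed

text \<open>Convention for gaps: \<open>W\<close> is the possibly empty stretch strictly between
  \<open>a\<close> and \<open>b\<close> along the cycle, and \<open>L\<close> runs from
  \<open>b\<close> round to \<open>a\<close>. An outside path from \<open>a\<close> to
  \<open>b\<close> closes \<open>L\<close> to a cycle and bypasses \<open>W\<close>.\<close>

lemma cyc_gap:
  assumes "cyc E xs" "a \<in> set xs" "b \<in> set xs"
  obtains L W where "cyc E (L @ W)" "set (L @ W) = set xs" "length (L @ W) = length xs"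
    "L \<noteq> []" "hd L = b" "last L = a"
proof -
  obtain ys where ys: "cyc E (ys @ [a])" "set (ys @ [a]) = set xs" "length (ys @ [a]) = length xs"
    using cyc_last_at[OF assms(1,2)] by blast
  obtain A B where AB: "ys @ [a] = A @ b # B" using assms(3) ys(2) split_list[of b "ys @ [a]"] by auto
  have 1: "cyc E ((b # B) @ A)" using cyc_swap[of E A "b # B"] ys(1) AB by simp
  have 2: "set ((b # B) @ A) = set xs" using ys(2) unfolding AB by auto
  have 3: "length ((b # B) @ A) = length xs" using ys(3) unfolding AB by auto
  have 4: "last (b # B) = a" using arg_cong[OF AB, of last] by simp
  show thesis by (rule that[OF 1 2 3 _ _ 4]) auto
qed

lemma complete_path:
  assumes "distinct xs" "xs \<noteq> []" "\<And>a b. a \<in> set xs \<Longrightarrow> b \<in> set xs \<Longrightarrow> a \<noteq> b \<Longrightarrow> E a b"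
  shows "path E xs"
  using assms unfolding path_def successively_conv_nth
  by (metis Suc_lessD n_not_Suc_n nth_eq_iff_index_eq nth_mem)

lemma path_sub: "path E (xs @ ys) \<Longrightarrow> xs \<noteq> [] \<Longrightarrow> path E xs" "path E (xs @ ys) \<Longrightarrow> ys \<noteq> [] \<Longrightarrow> path E ys"
  by (auto simp: path_append split: if_splits)

lemma cyc_gap_last:
  assumes "cyc E xs" "c \<in> set xs" "c \<noteq> last xs"
  obtains L W where "cyc E (L @ W)" "set (L @ W) = set xs" "L \<noteq> []" "W \<noteq> []" "hd L = hd xs" "last L = c"
proof -
  obtain A B where AB: "xs = A @ c # B" using split_list[OF assms(2)] by blast
  show thesis
    by (rule that[of "A @ [c]" B]) (use assms AB in \<open>auto simp: hd_append\<close>)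
qed

lemma cyc_gap_hd:
  assumes "cyc E xs" "c \<in> set xs" "c \<noteq> hd xs"
  obtains L W where "cyc E (L @ W)" "set (L @ W) = set xs" "L \<noteq> []" "W \<noteq> []" "hd L = c" "last L = last xs"
proof -
  obtain A B where AB: "xs = A @ c # B" using split_list[OF assms(2)] by blast
  show thesis
    by (rule that[of "c # B" A]) (use assms AB cyc_swap[of E A "c # B"] in auto)
qed

lemma path_distinct: "path E xs \<Longrightarrow> distinct xs"
  by (simp add: path_def)

lemma cyc_distinct: "cyc E xs \<Longrightarrow> distinct xs"
  by (simp add: path_def cyc_def)

lemma path_length: "path E xs \<Longrightarrow> length xs = card (set xs)"
  by (simp add: path_def distinct_card)

lemma cyc_length: "cyc E xs \<Longrightarrow> length xs = card (set xs)"
  by (simp add: cyc_distinct distinct_card)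

section \<open>Degree of a vertex that cannot be inserted into a path\<close>

lemma no_insert_Cons: "no_insert E v (x # xs) \<longleftrightarrow> xs = [] \<or> \<not> (E x v \<and> E v (hd xs)) \<and> no_insert E v xs"
  by (auto simp: no_insert_def successively_Cons)

lemma no_insert_append: "no_insert E v (xs @ ys) \<longleftrightarrow>
    no_insert E v xs \<and> no_insert E v ys \<and> (xs \<noteq> [] \<and> ys \<noteq> [] \<longrightarrow> \<not> (E (last xs) v \<and> E v (hd ys)))"
  by (auto simp: no_insert_def successively_append_iff)

lemma no_insert_Nil [simp]: "no_insert E v []" by (simp add: no_insert_def)

lemma no_insert_rev [simp]: "no_insert E v (rev xs) \<longleftrightarrow> no_insert E\<inverse>\<inverse> v xs"
  by (simp add: no_insert_def conj_commute)

lemma not_no_insertD: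
  assumes "\<not> no_insert E v xs"
  obtains A B where "xs = A @ B" "A \<noteq> []" "B \<noteq> []" "E (last A) v" "E v (hd B)"
  using assms
proof (induction xs arbitrary: thesis)
  case (Cons x xs)
  show ?case
  proof (cases "no_insert E v xs")
    case True
    then show ?thesis using Cons.prems(1)[of "[x]" xs] Cons.prems(2) by (auto simp: no_insert_Cons)
  next
    case False
    then obtain A B where "xs = A @ B" "A \<noteq> []" "B \<noteq> []" "E (last A) v" "E v (hd B)"
      using Cons.IH by metis
    then show ?thesis using Cons.prems(1)[of "x # A" B] by auto
  qed
qed simp

text \<open>For consecutive entries x, x' the arcs from x to \<open>v\<close> and from
  \<open>v\<close> to x' exclude each other. Regrouping the arcs by consecutive pairs gives at most
  one per pair, so length - 1 in all; what remains are the arc from \<open>v\<close> to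
  \<open>hd xs\<close> and the arc from \<open>last xs\<close> to \<open>v\<close>.\<close>

lemma no_insert_sum_list:
  assumes "no_insert E v xs" "xs \<noteq> []"
  shows "sum_list (map (narcs E v) xs) + 1 \<le> length xs + of_bool (E v (hd xs)) + of_bool (E (last xs) v)"
  using assms
proof (induction xs)
  case (Cons x xs)
  show ?case
  proof (cases "xs = []")
    case False
    have "\<not> (E x v \<and> E v (hd xs))" using Cons.prems False by (simp add: no_insert_Cons)
    then have "of_bool (E x v) + of_bool (E v (hd xs)) \<le> (1::nat)" by auto
    moreover have "sum_list (map (narcs E v) xs) + 1 \<le> length xs + of_bool (E v (hd xs)) + of_bool (E (last xs) v)"
      using Cons False by (simp add: no_insert_Cons)
    moreover have "sum_list (map (narcs E v) (x # xs)) = of_bool (E v x) + of_bool (E x v) + sum_list (map (narcs E v) xs)"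
      by (simp only: list.map sum_list.Cons narcs_def)
    moreover have last: "last (x # xs) = last xs" using False by simp
    ultimately show ?thesis unfolding last list.sel(1) list.size(4) by linarith
  qed (simp add: narcs_def)
qed simp

lemma no_insert_deg:
  assumes "no_insert E v xs" "path E xs"
  shows "deg E v (set xs) + 1 \<le> length xs + of_bool (E v (hd xs)) + of_bool (E (last xs) v)"
  using no_insert_sum_list[of E v xs] assms by (simp add: deg_list path_def)

lemma no_insert_deg_Suc:
  assumes "no_insert E v xs" "path E xs"
  shows "deg E v (set xs) \<le> length xs + 1"
  using no_insert_deg[OF assms] by (auto simp: of_bool_def split: if_splits)

text \<open>The parts \<open>A\<close> and \<open>B\<close> are bounded separately. Each lacks its
  end arc at the cut and so contributes at most its length; a consecutive pair with neither arc
  costs one against the general bound \<open>length xs + 1\<close>.\<close>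

lemma no_insert_deg_split:
  assumes "no_insert E v (A @ B)" "path E (A @ B)" "A \<noteq> []" "B \<noteq> []" "\<not> E (last A) v" "\<not> E v (hd B)"
  shows "deg E v (set (A @ B)) \<le> length (A @ B)"
proof -
  have "deg E v (set A) + 1 \<le> length A + of_bool (E v (hd A)) + of_bool (E (last A) v)"
    "deg E v (set B) + 1 \<le> length B + of_bool (E v (hd B)) + of_bool (E (last B) v)"
    using no_insert_deg[of E v A] no_insert_deg[of E v B] assms by (simp_all only: no_insert_append path_append if_False)
  moreover have "set A \<inter> set B = {}" using assms by (simp add: path_append)
  moreover have "of_bool (E v (hd A)) \<le> (1::nat)" "of_bool (E (last B) v) \<le> (1::nat)" by auto
  moreover have "of_bool (E (last A) v) = (0::nat)" "of_bool (E v (hd B)) = (0::nat)" using assms(5,6) by auto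
  moreover have "deg E v (set (A @ B)) = deg E v (set A) + deg E v (set B)" "length (A @ B) = length A + length B"
    using \<open>set A \<inter> set B = {}\<close> by (simp_all add: deg_Un)
  ultimately show ?thesis by linarith
qed

lemma no_insert_deg_eqD:
  assumes "no_insert E v xs" "path E xs" "length xs + 1 \<le> deg E v (set xs)"
  shows "E v (hd xs)" "E (last xs) v"
    "\<And>A B. xs = A @ B \<Longrightarrow> A \<noteq> [] \<Longrightarrow> B \<noteq> [] \<Longrightarrow> E (last A) v \<or> E v (hd B)"
proof -
  show "E v (hd xs)" "E (last xs) v"
    using no_insert_deg[OF assms(1,2)] assms(3) by (auto simp: of_bool_def split: if_splits)
  show "E (last A) v \<or> E v (hd B)" if "xs = A @ B" "A \<noteq> []" "B \<noteq> []" for A B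
    using no_insert_deg_split[of E v A B] assms that by force
qed

section \<open>Connections that run through a set \<open>R\<close>\<close>

lemma restr_conv: "restr E\<inverse>\<inverse> R = (restr E R)\<inverse>\<inverse>"
  by (auto simp: restr_def fun_eq_iff)

lemma inreach_conv [simp]: "inreach E\<inverse>\<inverse> R r = outreach E R r"
  by (auto simp: inreach_def outreach_def restr_conv rtranclp_conversep)

lemma outreach_conv [simp]: "outreach E\<inverse>\<inverse> R r = inreach E R r"
  by (auto simp: inreach_def outreach_def restr_conv rtranclp_conversep)

lemma inreachI: "E s x \<Longrightarrow> x \<in> R \<Longrightarrow> (restr E R)\<^sup>*\<^sup>* x r \<Longrightarrow> s \<in> inreach E R r"
  by (auto simp: inreach_def)

lemma outreachI: "E x s \<Longrightarrow> x \<in> R \<Longrightarrow> (restr E R)\<^sup>*\<^sup>* r x \<Longrightarrow> s \<in> outreach E R r"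
  by (auto simp: outreach_def)

text \<open>Closed parts of the walk are cut off as they arise. The last clause serves to keep a
  given vertex off the path: on the path it would be reachable from \<open>x\<close>, which may be
  known to fail.\<close>

lemma restr_path:
  assumes "(restr E R)\<^sup>*\<^sup>* x y" "x \<in> R"
  obtains P where "path E P" "set P \<subseteq> R" "hd P = x" "last P = y"
    "\<And>p. p \<in> set P \<Longrightarrow> (restr E R)\<^sup>*\<^sup>* x p \<and> (restr E R)\<^sup>*\<^sup>* p y"
proof -
  have "\<exists>P. path E P \<and> set P \<subseteq> R \<and> hd P = x \<and> last P = y \<and>
      (\<forall>p\<in>set P. (restr E R)\<^sup>*\<^sup>* x p \<and> (restr E R)\<^sup>*\<^sup>* p y)"
    using assms(1)
  proof (induction rule: rtranclp_induct)
    case base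
    show ?case by (rule exI[of _ "[x]"]) (auto simp: path_Cons assms)
  next
    case (step y z)
    then obtain P where P: "path E P" "set P \<subseteq> R" "hd P = x" "last P = y"
      "\<forall>p\<in>set P. (restr E R)\<^sup>*\<^sup>* x p \<and> (restr E R)\<^sup>*\<^sup>* p y" by blast
    have P0: "P \<noteq> []" using P(1) by auto
    have xz: "(restr E R)\<^sup>*\<^sup>* x z" using step by auto
    show ?case
    proof (cases "z \<in> set P")
      case True
      then obtain A B where AB: "P = A @ z # B" by (meson split_list)
      have 1: "path E (A @ [z])" using P(1) AB path_sub(1)[of E "A @ [z]" B] by auto
      have 2: "hd (A @ [z]) = x" using P(3) AB by (cases A) auto
      have 3: "(restr E R)\<^sup>*\<^sup>* p z" if "p \<in> set (A @ [z])" for p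
      proof -
        have "p \<in> set P" using that AB by auto
        then have "(restr E R)\<^sup>*\<^sup>* p y" using P(5) by blast
        then show ?thesis using step(2) by (rule rtranclp.rtrancl_into_rtrancl)
      qed
      show ?thesis
        by (rule exI[of _ "A @ [z]"]) (use 1 2 3 P AB in auto)
    next
      case False
      have "path E (P @ [z])" using P(1,4) False step(2) P0 by (auto simp: path_append path_Cons restr_def)
      moreover have "z \<in> R" using step(2) by (simp add: restr_def)
      moreover have "(restr E R)\<^sup>*\<^sup>* p z" if "p \<in> set P" for p
        using that P(5) step(2) by (meson rtranclp.rtrancl_into_rtrancl)
      ultimately show ?thesis
        by (intro exI[of _ "P @ [z]"]) (use P xz P0 in auto)
    qed
  qed
  then show thesis using that by blast
qed

text \<open>\<open>P\<close> is a longest path with the ends of \<open>L\<close> that contains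
  \<open>L\<close> and leaves out something of \<open>Z\<close>. Insisting on a remainder guarantees
  a vertex that cannot be inserted; the price is the second alternative, where the only remaining
  vertex could be inserted as well.\<close>

lemma insertion:
  assumes L: "path E L" "finite Z" "Z \<noteq> {}" "set L \<inter> Z = {}"
  obtains P where "path E P" "hd P = hd L" "last P = last L" "set L \<subseteq> set P" "set P \<subset> set L \<union> Z"
    "set P = set L \<Longrightarrow> P = L"
    "(\<forall>u\<in>Z - set P. no_insert E u P) \<or>
     (\<exists>z P'. Z - set P = {z} \<and> path E P' \<and> hd P' = hd L \<and> last P' = last L \<and> set P' = set L \<union> Z)"
proof -
  define Q where "Q P \<longleftrightarrow> path E P \<and> hd P = hd L \<and> last P = last L \<and> set L \<subseteq> set P \<and> set P \<subset> set L \<union> Z" for P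
  have QL: "Q L" using assms by (auto simp: Q_def)
  have bd: "length P \<le> card (set L \<union> Z)" if "Q P" for P
    using that path_length[of E P] card_mono[of "set L \<union> Z" "set P"] assms(2) by (auto simp: Q_def)
  obtain P0 where P0: "Q P0" "\<And>P. Q P \<Longrightarrow> length P \<le> length P0"
    using ex_has_greatest_nat[of Q L length "card (set L \<union> Z) + 1"] QL bd by (metis less_add_one order_le_less_trans)
  \<comment> \<open>A longest path on exactly \<open>set L\<close> may traverse it in another order.
    It is then replaced by \<open>L\<close>, so that failure of insertion refers to \<open>L\<close>
    itself.\<close>
  define P where "P = (if length P0 = length L then L else P0)"
  have P: "Q P" "\<And>P'. Q P' \<Longrightarrow> length P' \<le> length P" using P0 QL by (auto simp: P_def)
  have eq: "P = L" if "set P = set L"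
    using that P(1) path_length[of E P] path_length[of E L] L(1) by (auto simp: P_def Q_def split: if_splits)
  have PQ: "path E P" "hd P = hd L" "last P = last L" "set L \<subseteq> set P" "set P \<subset> set L \<union> Z"
    using P(1) by (auto simp: Q_def)
  have "(\<exists>z P'. Z - set P = {z} \<and> path E P' \<and> hd P' = hd L \<and> last P' = last L \<and> set P' = set L \<union> Z)"
    if u: "u \<in> Z - set P" "\<not> no_insert E u P" for u
  proof -
    obtain A B where AB: "P = A @ B" "A \<noteq> []" "B \<noteq> []" "E (last A) u" "E u (hd B)"
      using not_no_insertD[OF u(2)] by metis
    define P' where "P' = A @ u # B"
    have P': "path E P'" using PQ(1) AB u by (auto simp: P'_def path_append path_Cons)
    have ends: "hd P' = hd L" "last P' = last L" using PQ(2,3) AB by (auto simp: P'_def)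
    have setP': "set P' = insert u (set P)" using AB by (auto simp: P'_def)
    have "\<not> Q P'" using P(2)[of P'] AB by (auto simp: P'_def)
    then have "set P' = set L \<union> Z" using P' ends setP' PQ u by (auto simp: Q_def)
    moreover from this have "Z - set P = {u}" using setP' u L(4) PQ(4) by auto
    ultimately show ?thesis using P' ends by blast
  qed
  then show thesis using that[OF PQ eq] by blast
qed

section \<open>Longest non-Hamiltonian cycles\<close>

text \<open>The absence of a bypass is an assumption, so everything inside describes a digraph
  without one. The degree condition is written additively to avoid subtraction of natural
  numbers.\<close>

locale ore_graph =
  fixes V :: "'a set" and E :: "'a \<Rightarrow> 'a \<Rightarrow> bool"
  assumes finV: "finite V"
    and arc: "E u v \<Longrightarrow> u \<in> V \<and> v \<in> V \<and> u \<noteq> v"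
    and card3: "3 \<le> card V"
    and strong: "u \<in> V \<Longrightarrow> v \<in> V \<Longrightarrow> E\<^sup>*\<^sup>* u v"
    and ore: "u \<in> V \<Longrightarrow> v \<in> V \<Longrightarrow> u \<noteq> v \<Longrightarrow> narcs E u v = 0 \<Longrightarrow>
      2 * card V \<le> deg E u V + deg E v V + 2"
    and no_bypass: "path E xs \<Longrightarrow> set xs = V \<Longrightarrow> \<not> E (hd xs) (last xs)"
begin

text \<open>The reversal of a bypass is a bypass: the reversed path starts at the old terminal
  vertex, and the extra arc turns round with it. Statements about in-arcs follow from those about
  out-arcs.\<close>

lemma conv: "ore_graph V E\<inverse>\<inverse>"
proof
  show "\<not> E\<inverse>\<inverse> (hd xs) (last xs)" if "path E\<inverse>\<inverse> xs" "set xs = V" for xs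
    using no_bypass[of "rev xs"] that by (cases "xs = []") (auto simp: hd_rev last_rev)
qed (use finV arc card3 strong ore in \<open>auto simp: rtranclp_conversep\<close>)

lemma irrefl [simp]: "\<not> E v v"
  using arc by blast

lemma narcs_self [simp]: "narcs E v v = 0"
  by (simp add: narcs_def)

lemma cyc_subset: "cyc E xs \<Longrightarrow> set xs \<subseteq> V"
proof
  fix x assume "cyc E xs" "x \<in> set xs"
  then obtain ys where "cyc E (x # ys)" using cyc_hd_at by metis
  then show "x \<in> V" using arc by (auto simp: cyc_def)
qed

lemma cyc_length_ge: "cyc E xs \<Longrightarrow> 2 \<le> length xs"
  by (cases xs; cases "tl xs") (auto simp: cyc_def)

lemma finite_sub [simp]: "A \<subseteq> V \<Longrightarrow> finite A"
  using finV finite_subset by blast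

lemma deg_V: "A \<subseteq> V \<Longrightarrow> deg E v V = deg E v A + deg E v (V - A)"
  using deg_Un[of A "V - A" E v] finV by (simp add: Un_absorb1 finite_sub)

lemma deg_in_le: "finite A \<Longrightarrow> u \<in> A \<Longrightarrow> deg E u A + 2 \<le> 2 * card A"
  using deg_remove[of A u E u] deg_le[of "A - {u}" E u] card_gt_0_iff[of A]
  by (auto simp: card_Diff_singleton_if)

text \<open>Cut open at the arc from \<open>last A\<close> to \<open>hd B\<close>, the cycle is a
  Hamiltonian path from \<open>hd B\<close> to \<open>last A\<close>; the reverse arc would complete
  a bypass.\<close>

lemma ham_not_rev: "cyc E (A @ B) \<Longrightarrow> set (A @ B) = V \<Longrightarrow> A \<noteq> [] \<Longrightarrow> B \<noteq> [] \<Longrightarrow> \<not> E (hd B) (last A)"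
  using no_bypass[of "B @ A"] cyc_swap[of E A B] by (auto simp: cyc_def)

end

text \<open>Only cycle lengths strictly between \<open>m\<close> and \<open>card V\<close> are
  excluded. Besides the length of a longest non-Hamiltonian cycle, the value
  \<open>card V - 1\<close> is therefore admissible.\<close>

locale longest_cycle = ore_graph +
  fixes m :: nat
  assumes m_less: "m < card V"
    and no_long: "cyc E xs \<Longrightarrow> length xs \<le> m \<or> length xs = card V"
begin

lemma conv_l: "longest_cycle V E\<inverse>\<inverse> m"
proof -
  interpret c: ore_graph V "E\<inverse>\<inverse>" by (rule conv)
  show ?thesis using m_less no_long[of "rev _"] by unfold_locales (metis cyc_rev length_rev)+
qed

lemma no_long': "cyc E xs \<Longrightarrow> m < length xs \<Longrightarrow> length xs < card V \<Longrightarrow> False"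
  using no_long by fastforce

text \<open>If all of \<open>W\<close> could be absorbed by a path \<open>P'\<close>, the cycle
  \<open>P' @ Q\<close> would be longer than \<open>m\<close>, hence Hamiltonian. The path
  \<open>P\<close> lacks just one vertex of it, so \<open>P @ Q\<close> has length
  \<open>card V - 1\<close>, and this exceeds \<open>m\<close> because of
  \<open>m + 2 \<le> card V\<close>.\<close>

lemma gap:
  assumes cyc: "cyc E (L @ W)" "length (L @ W) = m" "L \<noteq> []" "W \<noteq> []"
    and Q: "path E Q" "set Q \<inter> set (L @ W) = {}" "E (last L) (hd Q)" "E (last Q) (hd L)"
    and m2: "m + 2 \<le> card V"
  obtains P where "path E P" "hd P = hd L" "last P = last L" "set L \<subseteq> set P" "set P \<subset> set (L @ W)"
    "set P = set L \<Longrightarrow> P = L" "\<And>u. u \<in> set W - set P \<Longrightarrow> no_insert E u P"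
proof -
  have LW: "path E L" "path E W" "set L \<inter> set W = {}" using cyc by (auto simp: cyc_append)
  obtain P where P: "path E P" "hd P = hd L" "last P = last L" "set L \<subseteq> set P" "set P \<subset> set L \<union> set W"
    "set P = set L \<Longrightarrow> P = L"
    "(\<forall>u\<in>set W - set P. no_insert E u P) \<or>
     (\<exists>z P'. set W - set P = {z} \<and> path E P' \<and> hd P' = hd L \<and> last P' = last L \<and> set P' = set L \<union> set W)"
    using insertion[of E L "set W"] LW cyc(4) by auto
  have False if "set W - set P = {z}" "path E P'" "hd P' = hd L" "last P' = last L" "set P' = set L \<union> set W" for z P'
  proof -
    have Q0: "Q \<noteq> []" using Q(1) by auto
    have P0: "P \<noteq> []" "P' \<noteq> []" using P(1) that(2) by auto
    have "cyc E (P' @ Q)" using that Q P0 Q0 by (auto simp: cyc_append)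
    moreover have "length P' = m" using path_length[OF that(2)] that(5) cyc_length[OF cyc(1)] cyc(2) by simp
    ultimately have n: "m + length Q = card V" using no_long[of "P' @ Q"] Q0 by auto
    have "cyc E (P @ Q)" using P Q P0 Q0 by (auto simp: cyc_append)
    moreover have "length P + 1 = m"
    proof -
      have "set L \<union> set W = insert z (set P)" "z \<notin> set P" using that(1) P(4,5) by auto
      then have "card (set L \<union> set W) = card (set P) + 1" by simp
      then show ?thesis using path_length[OF P(1)] cyc_length[OF cyc(1)] cyc(2) by simp
    qed
    ultimately show False using no_long'[of "P @ Q"] n m2 by auto
  qed
  then show thesis using that[OF P(1-4) _ P(6)] P(5,7) by auto
qed

text \<open>If W' is the uninserted part of \<open>W\<close>, a vertex of W' has at most |P| + 1
  arcs to \<open>P\<close> and 2(|W'| - 1) to W', where |P| + |W'| = m. The bound m + |W'| - 1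
  improves as soon as one vertex is inserted; otherwise \<open>P = L\<close>.\<close>

lemma gap_deg:
  assumes cyc: "cyc E (L @ W)" "length (L @ W) = m" "L \<noteq> []" "W \<noteq> []"
    and Q: "path E Q" "set Q \<inter> set (L @ W) = {}" "E (last L) (hd Q)" "E (last Q) (hd L)"
    and m2: "m + 2 \<le> card V"
  shows "(\<exists>u\<in>set W. deg E u (set (L @ W)) + 2 \<le> m + length W) \<or>
    (\<forall>u\<in>set W. no_insert E u L \<and> deg E u (set (L @ W)) + 1 \<le> m + length W)"
proof -
  obtain P where P: "path E P" "hd P = hd L" "last P = last L" "set L \<subseteq> set P" "set P \<subset> set (L @ W)"
    "set P = set L \<Longrightarrow> P = L" "\<And>u. u \<in> set W - set P \<Longrightarrow> no_insert E u P"
    using gap[OF assms] by metis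
  define W' where "W' = set W - set P"
  have WP: "set (L @ W) = set P \<union> W'" "set P \<inter> W' = {}" using P(4,5) by (auto simp: W'_def)
  have dist: "set L \<inter> set W = {}" "distinct W" using cyc by (auto simp: cyc_append path_def)
  have cardm: "card (set P) + card W' = m"
    using cyc_length[OF cyc(1)] cyc(2) WP card_Un_disjoint[of "set P" W'] by (simp add: W'_def)
  have d: "deg E u (set (L @ W)) + 1 \<le> m + card W'" if "u \<in> W'" for u
  proof -
    have "deg E u (set P) \<le> card (set P) + 1"
      using no_insert_deg_Suc[OF P(7) P(1)] path_length[OF P(1)] that by (simp add: W'_def)
    moreover have "deg E u W' + 2 \<le> 2 * card W'" using deg_in_le[of W' u] that by (simp add: W'_def)
    ultimately show ?thesis using cardm WP deg_Un[of "set P" W' E u] by (simp add: W'_def)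
  qed
  have ne: "W' \<noteq> {}" using P(5) WP by auto
  show ?thesis
  proof (cases "W' = set W")
    case True
    then have "set P = set L" using P(4) WP dist by auto
    then show ?thesis using P(6,7) d True by (auto simp: W'_def dist distinct_card)
  next
    case False
    then have "card W' < length W"
      using dist(2) by (metis Diff_subset W'_def distinct_card List.finite_set psubsetI psubset_card_mono)
    then show ?thesis using d ne by (fastforce simp: W'_def)
  qed
qed

end

text \<open>Only the vertex set of the cycle is fixed, since the arguments pass freely between
  different cycles on \<open>S\<close>.\<close>

locale max_cyc = longest_cycle +
  fixes S
  assumes S_cyc: "\<exists>xs. cyc E xs \<and> set xs = S"
    and card_S: "card S = m"
begin

abbreviation "R \<equiv> V - S"
abbreviation "Rin \<equiv> inreach E R"
abbreviation "Rout \<equiv> outreach E R"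
abbreviation "Rreach \<equiv> (restr E R)\<^sup>*\<^sup>*"

lemma conv_m: "max_cyc V E\<inverse>\<inverse> m S"
proof -
  interpret c: longest_cycle V "E\<inverse>\<inverse>" m by (rule conv_l)
  obtain xs where "cyc E xs" "set xs = S" using S_cyc by blast
  then have "\<exists>xs. cyc E\<inverse>\<inverse> xs \<and> set xs = S" by (intro exI[of _ "rev xs"]) simp
  then show ?thesis using card_S by unfold_locales
qed

lemma S_sub: "S \<subseteq> V"
  using S_cyc cyc_subset by blast

lemma fin_S [simp]: "finite S" "finite R"
  using S_sub finV finite_subset by auto

lemma card_R: "card R + m = card V"
  using card_S S_sub card_Diff_subset[of S V] card_mono[of V S] finV by simp

lemma m_ge_2: "2 \<le> m"
  using S_cyc card_S cyc_length cyc_length_ge by metis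

lemma S_other: "\<exists>z\<in>S. z \<noteq> x"
proof (rule ccontr)
  assume "\<not> ?thesis"
  then have "card S \<le> card {x}" by (intro card_mono) auto
  then show False using m_ge_2 card_S by simp
qed

lemma deg_SR: "deg E v V = deg E v S + deg E v R"
  using deg_V[OF S_sub] .

lemma Rout_nonempty:
  assumes "r \<in> R"
  obtains s where "s \<in> S" "s \<in> Rout r"
proof -
  have "Rreach r v \<and> v \<in> R \<or> (\<exists>s\<in>S. s \<in> Rout r)" if "E\<^sup>*\<^sup>* r v" for v
    using that
  proof (induction rule: rtranclp_induct)
    case (step y z)
    show ?case
    proof (cases "(\<exists>s\<in>S. s \<in> Rout r)")
      case False
      then have y: "Rreach r y" "y \<in> R" using step by auto
      have "z \<notin> S" using False y outreachI[of E y z R r] step(2) by blast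
      then have "restr E R y z" using y step(2) arc by (auto simp: restr_def)
      then show ?thesis using y by (meson rtranclp.rtrancl_into_rtrancl restr_def)
    qed simp
  qed (use assms in simp)
  moreover obtain s where "s \<in> S" using card_S m_ge_2 by fastforce
  ultimately show thesis using that strong[of r s] assms S_sub by blast
qed

lemma Rin_nonempty:
  assumes "r \<in> R"
  obtains s where "s \<in> S" "s \<in> Rin r"
proof -
  interpret c: max_cyc V "E\<inverse>\<inverse>" m S by (rule conv_m)
  show thesis using c.Rout_nonempty[OF assms] that by auto
qed

lemma Rout_arc: "r \<in> R \<Longrightarrow> E r s \<Longrightarrow> s \<in> Rout r"
  by (auto intro: outreachI)

lemma Rin_arc: "r \<in> R \<Longrightarrow> E s r \<Longrightarrow> s \<in> Rin r"
  by (auto intro: inreachI)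

lemma Rout_step: "r \<in> R \<Longrightarrow> v \<in> R \<Longrightarrow> E r v \<Longrightarrow> s \<in> Rout v \<Longrightarrow> s \<in> Rout r"
  unfolding outreach_def using converse_rtranclp_into_rtranclp[of "restr E R" r v] by (auto simp: restr_def)

lemma Rin_step: "r \<in> R \<Longrightarrow> v \<in> R \<Longrightarrow> E v r \<Longrightarrow> s \<in> Rin v \<Longrightarrow> s \<in> Rin r"
  unfolding inreach_def using rtranclp.rtrancl_into_rtrancl[of "restr E R" _ v r] by (auto simp: restr_def)

lemma arc_Rout: "r \<in> R \<Longrightarrow> v \<in> R \<Longrightarrow> E r v \<Longrightarrow> E v s \<Longrightarrow> s \<in> Rout r"
  by (auto intro: Rout_step Rout_arc)

lemma arc_Rin: "r \<in> R \<Longrightarrow> v \<in> R \<Longrightarrow> E v r \<Longrightarrow> E s v \<Longrightarrow> s \<in> Rin r"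
  by (auto intro: Rin_step Rin_arc)

lemma narcs_not_reach: "r \<in> R \<Longrightarrow> s \<notin> Rin r \<Longrightarrow> s \<notin> Rout r \<Longrightarrow> narcs E r s = 0"
  using Rout_arc Rin_arc by (auto simp: narcs_0_iff)

text \<open>A path from \<open>r\<close> over \<open>v\<close> to \<open>z\<close> would make
  \<open>z\<close> an exit of \<open>r\<close>, and one from \<open>z\<close> over \<open>v\<close>
  to \<open>r\<close> an entry. Each of these two pairs of arcs is therefore present at most by
  half.\<close>

lemma narcs_pair_le:
  assumes "r \<in> R" "v \<in> R" "z \<notin> Rin r" "z \<notin> Rout r"
  shows "narcs E r v + narcs E z v \<le> 2"
proof -
  have "\<not> (E r v \<and> E v z)" "\<not> (E z v \<and> E v r)"
    using assms arc_Rout[of r v z] arc_Rin[of r v z] by auto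
  then show ?thesis by (auto simp: narcs_def)
qed

lemma reach_path:
  assumes "r \<in> R" "s \<in> Rin r" "s' \<in> Rout r"
  obtains P where "path E P" "set P \<subseteq> R" "E s (hd P)" "E (last P) s'"
    "\<And>p. p \<in> set P \<Longrightarrow> s \<in> Rin p \<and> s' \<in> Rout p"
proof -
  obtain x where x: "x \<in> R" "E s x" "Rreach x r" using assms by (auto simp: inreach_def)
  obtain y where y: "y \<in> R" "E y s'" "Rreach r y" using assms by (auto simp: outreach_def)
  obtain P where P: "path E P" "set P \<subseteq> R" "hd P = x" "last P = y"
    "\<And>p. p \<in> set P \<Longrightarrow> Rreach x p \<and> Rreach p y"
    using restr_path[OF rtranclp_trans[OF x(3) y(3)] x(1)] by blast
  show thesis
  proof (rule that[OF P(1,2)])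
    show "E s (hd P)" "E (last P) s'" using P x y by auto
    show "s \<in> Rin p \<and> s' \<in> Rout p" if "p \<in> set P" for p
      using P(5)[OF that] x y by (auto intro: inreachI outreachI)
  qed
qed

text \<open>Count for the non-adjacent \<open>r\<close> and \<open>z\<close>: at most 2 arcs from
  \<open>r\<close> to \<open>S\<close>, all at \<open>x\<close>; at most 2(m - 1) from
  \<open>z\<close> to \<open>S\<close>; at most 2 from \<open>r\<close> and \<open>z\<close>
  together to each further vertex of \<open>R\<close>. The sum is 2 * card V - 2, so all three
  estimates are attained.\<close>

lemma cut_vertex_step:
  assumes r: "r \<in> R" and x: "x \<in> S" "S \<inter> (Rin r \<union> Rout r) \<subseteq> {x}"
    and z: "z \<in> S" "z \<noteq> x"
  shows "narcs E r x = 2" "\<And>u. u \<in> S \<Longrightarrow> u \<noteq> z \<Longrightarrow> narcs E z u = 2"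
    "\<And>v. v \<in> R \<Longrightarrow> v \<noteq> r \<Longrightarrow> narcs E r v + narcs E z v = 2"
proof -
  have nz: "z \<notin> Rin r" "z \<notin> Rout r" using x z by auto
  have rS: "narcs E r s = 0" if "s \<in> S - {x}" for s
    using that x(2) by (intro narcs_not_reach[OF r]) auto
  have dr: "deg E r S = narcs E r x" using deg_remove[of S x E r] deg_eq_0[of "S - {x}" E r] rS x by simp
  have le: "narcs E r v + narcs E z v \<le> 2" if "v \<in> R - {r}" for v
    using narcs_pair_le[OF r _ nz] that by auto
  have zr: "narcs E z r = 0" using rS[of z] z by (simp add: narcs_sym)
  have dR: "deg E r R = deg E r (R - {r})" "deg E z R = deg E z (R - {r})"
    using deg_remove[of R r E r] deg_remove[of R r E z] r zr by auto
  have sumR: "deg E r (R - {r}) + deg E z (R - {r}) \<le> 2 * card (R - {r})"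
    using deg_sum_le[of "R - {r}" E r z] le by auto
  have cR: "card (R - {r}) + 1 = card R" using r card_Diff_singleton[of r R] card_gt_0_iff[of R] by auto
  have zS: "deg E z S + 2 \<le> 2 * m" using deg_in_le[of S z] z card_S by simp
  have o: "2 * card V \<le> deg E r V + deg E z V + 2"
    using ore[of r z] rS[of z] r z S_sub by auto
  have "narcs E r x \<le> 2" by (rule narcs_le_2)
  then have *: "narcs E r x = 2" "2 * m \<le> deg E z S + 2" "2 * card (R - {r}) \<le> deg E r (R - {r}) + deg E z (R - {r})"
    using o sumR cR zS dr dR card_R unfolding deg_SR[of r] deg_SR[of z] by linarith+
  then show "narcs E r x = 2" by simp
  show "narcs E z u = 2" if "u \<in> S" "u \<noteq> z" for u
  proof (rule deg_complete[of "S - {z}"])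
    have "deg E z S = deg E z (S - {z})" using deg_remove[of S z E z] z by simp
    then show "2 * card (S - {z}) \<le> deg E z (S - {z})" using *(2) card_S z m_ge_2 by (simp add: card_Diff_singleton)
  qed (use that in auto)
  show "narcs E r v + narcs E z v = 2" if "v \<in> R" "v \<noteq> r" for v
    using deg_sum_eq[of "R - {r}" E r z v] le *(3) that by auto
qed

text \<open>Every exit of \<open>v\<close> is an exit of \<open>r\<close>, so the way back from
  \<open>v\<close> to \<open>S\<close> ends at \<open>x\<close>. \<open>S\<close> is already known
  to be complete symmetric; a Hamiltonian path of \<open>S\<close> from \<open>x\<close> to
  \<open>z\<close> closes this way to a cycle that is longer than \<open>m\<close> and misses
  \<open>r\<close>.\<close>

lemma cut_vertex_no_out:
  assumes r: "r \<in> R" and x: "x \<in> S" "S \<inter> (Rin r \<union> Rout r) \<subseteq> {x}"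
    and z: "z \<in> S" "z \<noteq> x" and v: "v \<in> R" "v \<noteq> r"
  shows "\<not> (E r v \<and> E z v)"
proof
  assume rv: "E r v \<and> E z v"
  have nz: "z \<notin> Rin r" "z \<notin> Rout r" using x z by auto
  obtain s where s: "s \<in> S" "s \<in> Rout v" using Rout_nonempty v by blast
  then have "s = x" using x(2) Rout_step[of r v s] r v rv by blast
  then obtain y where y: "y \<in> R" "E y x" "Rreach v y" using s by (auto simp: outreach_def)
  obtain P where P: "path E P" "set P \<subseteq> R" "hd P = v" "last P = y" "\<And>p. p \<in> set P \<Longrightarrow> Rreach v p"
    using restr_path[OF y(3) v(1)] by metis
  \<comment> \<open>If \<open>v\<close> reached \<open>r\<close>, then \<open>z\<close>, which
    dominates \<open>v\<close>, would be an entry of \<open>r\<close>.\<close>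
  have "r \<notin> set P" using P(5)[of r] nz(1) rv v by (auto intro: inreachI)
  obtain xs where xs: "set xs = S - {x, z}" "distinct xs" using finite_distinct_list[of "S - {x, z}"] by auto
  have complete: "E a b" if "a \<in> S" "b \<in> S" "a \<noteq> b" for a b
  proof (cases "a = x")
    case True
    then show ?thesis using cut_vertex_step(2)[OF r x, of b a] that by (auto simp: narcs_2_iff)
  next
    case False
    then show ?thesis using cut_vertex_step(2)[OF r x, of a b] that by (auto simp: narcs_2_iff)
  qed
  define L where "L = x # xs @ [z]"
  have "distinct L" "set L = S" using xs x(1) z by (auto simp: L_def)
  then have L: "path E L" "set L = S" using complete complete_path[of L E] by (auto simp: L_def)
  have "P \<noteq> []" using P(1) by auto
  have "cyc E (L @ P)"
    using L P rv y \<open>P \<noteq> []\<close> by (subst cyc_append) (auto simp: L_def)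
  moreover have "length L = m" using path_length[OF L(1)] L(2) card_S by simp
  moreover have "length P < card R"
    using path_length[OF P(1)] P(2) \<open>r \<notin> set P\<close> r psubset_card_mono[of R "set P"] by auto
  ultimately show False using no_long'[of "L @ P"] card_R \<open>P \<noteq> []\<close> by auto
qed

text \<open>The forbidden patterns leave two possibilities: \<open>v\<close> is joined both ways to
  \<open>r\<close> and not at all to \<open>z\<close>, or conversely. In the second case
  \<open>v\<close> is joined both ways to all of \<open>S\<close> except \<open>x\<close>, and not
  to \<open>x\<close>, since the cycle cannot absorb \<open>v\<close>. Then the non-adjacent
  \<open>r\<close> and \<open>v\<close> have degree sum at most 2 * card V - 4.\<close>

lemma cut_vertex_comp:
  assumes r: "r \<in> R" and x: "x \<in> S" "S \<inter> (Rin r \<union> Rout r) \<subseteq> {x}"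
    and v: "v \<in> R" "v \<noteq> r"
  shows "narcs E r v = 2" "S \<inter> (Rin v \<union> Rout v) \<subseteq> {x}"
proof -
  interpret c: max_cyc V "E\<inverse>\<inverse>" m S by (rule conv_m)
  obtain z where z: "z \<in> S" "z \<noteq> x" using S_other by blast
  have no1: "\<not> (E r v \<and> E z v)" using cut_vertex_no_out[OF r x z v] .
  have no2: "\<not> (E v r \<and> E v z)" using c.cut_vertex_no_out[OF r x(1) _ z v] x(2) by (simp add: Un_commute)
  have nz: "z' \<notin> Rin r" "z' \<notin> Rout r" if "z' \<in> S" "z' \<noteq> x" for z' using x(2) that by auto
  have no3: "\<not> (E r v \<and> E v z)" "\<not> (E z v \<and> E v r)"
    using nz[OF z] arc_Rout[of r v z] arc_Rin[of r v z] r v by auto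
  have sum2: "narcs E r v + narcs E z' v = 2" if "z' \<in> S" "z' \<noteq> x" for z'
    using cut_vertex_step(3)[OF r x that v] .
  show rv: "narcs E r v = 2"
  proof (rule ccontr)
    assume ne: "narcs E r v \<noteq> 2"
    then have "narcs E z v \<noteq> 0" using sum2[OF z] by auto
    then have rv0: "\<not> E r v" "\<not> E v r" using no1 no2 no3 by (auto simp: narcs_0_iff)
    then have rv0': "narcs E r v = 0" by (simp add: narcs_0_iff)
    then have zv2: "narcs E z' v = 2" if "z' \<in> S" "z' \<noteq> x" for z' using sum2[OF that] by simp
    obtain L where L: "path E (x # L)" "set (x # L) = S" "E (last (x # L)) x" "length (x # L) = m" "L \<noteq> []"
    proof -
      obtain xs where "cyc E xs" "set xs = S" using S_cyc by blast
      then obtain ys where ys: "cyc E (x # ys)" "set (x # ys) = S" "length (x # ys) = length xs"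
        using cyc_hd_at[of E xs x] x(1) by metis
      show thesis
        by (rule that[of ys]) (use ys cyc_length[OF ys(1)] card_S m_ge_2 in \<open>auto simp: cyc_def\<close>)
    qed
    have ends: "E (last L) v" "E v (hd L)" "last L \<in> S" "last L \<noteq> x" "hd L \<in> S" "hd L \<noteq> x"
    proof -
      show "last L \<in> S" "hd L \<in> S" using L(2,5) by (metis last_in_set list.set_intros(2)) (metis L(2,5) list.set_sel(1) list.set_intros(2))
      show "last L \<noteq> x" "hd L \<noteq> x" using L(1,5) by (auto simp: path_Cons)
      then show "E (last L) v" "E v (hd L)"
        using zv2[of "last L"] zv2[of "hd L"] \<open>last L \<in> S\<close> \<open>hd L \<in> S\<close> by (auto simp: narcs_2_iff)
    qed
    have card1: "m + 1 < card V"
    proof -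
      have "2 \<le> card R" using r v card_le_Suc0_iff_eq[of R] by fastforce
      then show ?thesis using card_R by simp
    qed
    have vL: "v \<notin> set (x # L)" using L(2) v by auto
    have nvx: "\<not> E v x" using no_long'[of "x # L @ [v]"] L ends vL card1
      by (auto simp: cyc_def path_Cons path_append)
    have nxv: "\<not> E x v" using no_long'[of "v # L @ [x]"] L ends vL card1
      by (auto simp: cyc_def path_Cons path_append)
    have dv: "deg E v S \<le> 2 * (m - 1)"
      using deg_remove[of S x E v] x(1) deg_le[of "S - {x}" E v] nvx nxv card_S
      by (simp add: narcs_def)
    have dr: "deg E r S \<le> 2"
      using deg_remove[of S x E r] x(1) deg_eq_0[of "S - {x}" E r] narcs_not_reach[OF r] nz narcs_le_2[of E r x] by auto
    have le: "narcs E r y + narcs E v y \<le> 2" if y: "y \<in> R" for y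
    proof -
      have zin: "z \<in> Rin v" "z \<in> Rout v" using zv2[OF z] v by (auto simp: narcs_2_iff intro: Rin_arc Rout_arc)
      have "\<not> (E r y \<and> E y v)" "\<not> (E v y \<and> E y r)"
        using Rout_step[of r y z] Rout_step[of y v z] Rin_step[of r y z] Rin_step[of y v z] nz[OF z] zin r y v by blast+
      then show ?thesis by (auto simp: narcs_def)
    qed
    have "R - {r} - {v} = R - {r, v}" by auto
    then have "deg E r R = deg E r (R - {r, v})" "deg E v R = deg E v (R - {r, v})"
      using deg_remove[of R r E r] deg_remove[of R r E v] deg_remove[of "R - {r}" v E r]
        deg_remove[of "R - {r}" v E v] r v rv0' by (auto simp: narcs_sym[of E v r])
    then have dR: "deg E r R + deg E v R \<le> 2 * card (R - {r, v})"
      using deg_sum_le[of "R - {r, v}" E r v] le by simp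
    have c: "card (R - {r, v}) + 2 = card R"
      using card_Diff_subset[of "{r,v}" R] r v card_mono[of R "{r, v}"] by simp
    have "2 * card V \<le> deg E r V + deg E v V + 2" using ore[of r v] rv0' r v by auto
    then show False using dv dr dR c card_R m_ge_2 unfolding deg_SR[of r] deg_SR[of v] by linarith
  qed
  then have E: "E r v" "E v r" by (auto simp: narcs_2_iff)
  show "S \<inter> (Rin v \<union> Rout v) \<subseteq> {x}"
    using x(2) Rin_step[of r v] Rout_step[of r v] E r v by blast
qed

text \<open>Being attached through \<open>x\<close> alone spreads from \<open>r\<close> to all of
  \<open>R\<close>, so the equality analysis applies to every outside vertex and determines all
  arcs.\<close>

lemma cut_vertex:
  assumes r: "r \<in> R" and x: "x \<in> S" "S \<inter> (Rin r \<union> Rout r) \<subseteq> {x}"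
  shows "u \<in> V \<Longrightarrow> v \<in> V \<Longrightarrow>
    E u v \<longleftrightarrow> u \<noteq> v \<and> (u \<in> S \<and> v \<in> S \<or> u \<in> insert x R \<and> v \<in> insert x R)"
proof -
  obtain z where z: "z \<in> S" "z \<noteq> x" using S_other by blast
  have all: "S \<inter> (Rin v \<union> Rout v) \<subseteq> {x}" if "v \<in> R" for v
    using cut_vertex_comp(2)[OF r x that] x(2) by (cases "v = r") simp_all
  have SS: "E a b" if "a \<in> S" "b \<in> S" "a \<noteq> b" for a b
  proof (cases "a = x")
    case True
    then show ?thesis using cut_vertex_step(2)[OF r x, of b a] that by (auto simp: narcs_2_iff)
  next
    case False
    then show ?thesis using cut_vertex_step(2)[OF r x, of a b] that by (auto simp: narcs_2_iff)
  qed
  have xR: "E x v" "E v x" if "v \<in> R" for v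
    using cut_vertex_step(1)[OF that x(1) all[OF that] z] by (auto simp: narcs_2_iff)
  have RR: "E a b" if "a \<in> R" "b \<in> R" "a \<noteq> b" for a b
    using cut_vertex_comp(1)[OF that(1) x(1) all[OF that(1)], of b] that by (auto simp: narcs_2_iff)
  have SR: "\<not> E a b" "\<not> E b a" if "a \<in> S" "a \<noteq> x" "b \<in> R" for a b
    using all[OF that(3)] that Rin_arc[OF that(3)] Rout_arc[OF that(3)] by blast+
  show "u \<in> V \<Longrightarrow> v \<in> V \<Longrightarrow> E u v \<longleftrightarrow> u \<noteq> v \<and> (u \<in> S \<and> v \<in> S \<or> u \<in> insert x R \<and> v \<in> insert x R)"
    using SS[of u v] xR[of u] xR[of v] RR[of u v] SR[of u v] SR[of v u] x(1) irrefl by blast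
qed

end

section \<open>Tight gaps\<close>

text \<open>The new vertex is pushed along the path to the first place where it dominates the next
  vertex, or else to the end.\<close>

lemma semicomplete_path_insert:
  assumes "path E P" "a \<notin> set P" "\<And>p. p \<in> set P \<Longrightarrow> E p a \<or> E a p" "E (hd P) a"
  shows "\<exists>P'. path E P' \<and> hd P' = hd P \<and> set P' = insert a (set P)"
  using assms
proof (induction P)
  case (Cons p P)
  show ?case
  proof (cases "P = []")
    case True
    then show ?thesis using Cons.prems by (intro exI[of _ "[p, a]"]) (auto simp: path_Cons)
  next
    case False
    show ?thesis
    proof (cases "E a (hd P)")
      case True
      then show ?thesis using Cons.prems False by (intro exI[of _ "p # a # P"]) (auto simp: path_Cons)
    next
      case nE: False
      then have "E (hd P) a" using Cons.prems(3)[of "hd P"] False by auto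
      then obtain P' where P': "path E P'" "hd P' = hd P" "set P' = insert a (set P)"
        using Cons.IH Cons.prems False by (auto simp: path_Cons)
      then show ?thesis using Cons.prems False by (intro exI[of _ "p # P'"]) (auto simp: path_Cons)
    qed
  qed
qed simp

text \<open>Redei's theorem, for semicomplete digraphs instead of tournaments.\<close>

lemma semicomplete_path:
  assumes "finite A" "A \<noteq> {}" "\<And>a b. a \<in> A \<Longrightarrow> b \<in> A \<Longrightarrow> a \<noteq> b \<Longrightarrow> E a b \<or> E b a"
  shows "\<exists>P. path E P \<and> set P = A"
  using assms
proof (induction rule: finite_ne_induct)
  case (singleton a)
  show ?case by (intro exI[of _ "[a]"]) (auto simp: path_Cons)
next
  case (insert a A)
  then obtain P where P: "path E P" "set P = A" by auto
  then have "hd P \<in> A" by (cases P) auto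
  show ?case
  proof (cases "E (hd P) a")
    case True
    then show ?thesis using semicomplete_path_insert[OF P(1), of a] insert.prems insert.hyps P by blast
  next
    case False
    then have "E a (hd P)" using insert.prems[of a "hd P"] insert.hyps \<open>hd P \<in> A\<close> by auto
    then show ?thesis using P insert.hyps by (intro exI[of _ "a # P"]) (auto simp: path_Cons)
  qed
qed

lemma path_reach:
  assumes "path E P" "set P \<subseteq> A" "p \<in> set P"
  shows "(restr E A)\<^sup>*\<^sup>* (hd P) p"
  using assms
proof (induction P)
  case (Cons q P)
  show ?case
  proof (cases "p = q")
    case False
    then have P: "path E P" "P \<noteq> []" "E q (hd P)" "p \<in> set P" using Cons.prems by (auto simp: path_Cons)
    then have "(restr E A)\<^sup>*\<^sup>* (hd P) p" using Cons by auto
    moreover have "restr E A q (hd P)" using P Cons.prems by (auto simp: restr_def)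
    ultimately show ?thesis by (simp add: converse_rtranclp_into_rtranclp)
  qed simp
qed simp

lemma path_reach_last:
  assumes "path E P" "set P \<subseteq> A" "p \<in> set P"
  shows "(restr E A)\<^sup>*\<^sup>* p (last P)"
  using path_reach[of "E\<inverse>\<inverse>" "rev P" A p] assms
  by (simp add: restr_conv rtranclp_conversep hd_rev)

context max_cyc
begin

lemma R_no_insert_ends:
  assumes "m + 2 \<le> card V" "r \<in> R" "cyc E xs" "set xs = S"
  shows "\<not> (E (last xs) r \<and> E r (hd xs))"
proof
  assume "E (last xs) r \<and> E r (hd xs)"
  then have "cyc E (xs @ [r])" using assms by (cases xs) (auto simp: cyc_def path_append path_Cons)
  then show False using no_long'[of "xs @ [r]"] cyc_length[OF assms(3)] assms card_S by simp
qed

lemma R_no_insert: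
  assumes "m + 2 \<le> card V" "r \<in> R" "cyc E (L @ W)" "set (L @ W) = S"
  shows "no_insert E r L"
proof (rule ccontr)
  assume "\<not> ?thesis"
  then obtain A B where AB: "L = A @ B" "A \<noteq> []" "B \<noteq> []" "E (last A) r" "E r (hd B)"
    using not_no_insertD by metis
  then show False
    using R_no_insert_ends[OF assms(1,2), of "(B @ W) @ A"] cyc_swap[of E A "B @ W"] assms(3,4) by auto
qed

text \<open>Here the outside path replaces a single arc of a cycle on \<open>S\<close>. The gap is
  empty, so the degree estimate has no gap vertex to work with.\<close>

definition bridged :: bool where
  "bridged \<longleftrightarrow> (\<exists>xs P. cyc E xs \<and> set xs = S \<and> path E P \<and> set P \<subseteq> R \<and>
     E (last xs) (hd P) \<and> E (last P) (hd xs))"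

lemma bridgedI: "cyc E xs \<Longrightarrow> set xs = S \<Longrightarrow> path E P \<Longrightarrow> set P \<subseteq> R \<Longrightarrow>
    E (last xs) (hd P) \<Longrightarrow> E (last P) (hd xs) \<Longrightarrow> bridged"
  unfolding bridged_def by blast

lemma Rin_trans: "Rreach r q \<Longrightarrow> s \<in> Rin r \<Longrightarrow> s \<in> Rin q"
  unfolding inreach_def by (blast intro: rtranclp_trans)

lemma Rout_trans: "Rreach q r \<Longrightarrow> s \<in> Rout r \<Longrightarrow> s \<in> Rout q"
  unfolding outreach_def by (blast intro: rtranclp_trans)

text \<open>The proof bounds the degree sum of \<open>r\<close> and a vertex of a shortest gap \<open>W\<close> by
  \<open>2 * card V - 2\<close>; what is listed here are the equality cases.\<close>

lemma tight_gap:
  assumes m2: "m + 2 \<le> card V"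
    and not_bridged: "\<not> bridged"
    and nocut: "\<forall>r\<in>R. \<forall>x\<in>S. \<not> S \<inter> (Rin r \<union> Rout r) \<subseteq> {x}"
    and r: "r \<in> R"
  obtains L W where "cyc E (L @ W)" "set (L @ W) = S" "L \<noteq> []" "W \<noteq> []" "hd L \<noteq> last L"
    "set W \<inter> (Rin r \<union> Rout r) = {}" "E (last L) r"
    "\<And>x u. x \<in> R \<Longrightarrow> x \<noteq> r \<Longrightarrow> u \<in> set W \<Longrightarrow> narcs E r x + narcs E u x = 2"
    "\<And>u. u \<in> set W \<Longrightarrow> deg E u S + 1 \<le> m + length W"
proof -
  \<comment> \<open>The two ends can be chosen different, since otherwise \<open>r\<close> would be
    attached to \<open>S\<close> through one vertex only. This also gives \<open>L\<close> at least
    two vertices.\<close>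
  define good where "good LW \<longleftrightarrow> cyc E (fst LW @ snd LW) \<and> set (fst LW @ snd LW) = S \<and> fst LW \<noteq> [] \<and>
    last (fst LW) \<in> Rin r \<and> hd (fst LW) \<in> Rout r \<and> hd (fst LW) \<noteq> last (fst LW)" for LW
  have "\<exists>s s'. s \<in> S \<and> s' \<in> S \<and> s \<in> Rin r \<and> s' \<in> Rout r \<and> s \<noteq> s'"
  proof -
    obtain s where s: "s \<in> S" "s \<in> Rin r" using Rin_nonempty[OF r] .
    obtain s' where s': "s' \<in> S" "s' \<in> Rout r" using Rout_nonempty[OF r] .
    show ?thesis
    proof (cases "s = s'")
      case True
      obtain t where "t \<in> S" "t \<in> Rin r \<or> t \<in> Rout r" "t \<noteq> s" using nocut r s(1) by blast
      then show ?thesis using s s' True by auto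
    qed (use s s' in auto)
  qed
  then obtain s s' where s: "s \<in> S" "s' \<in> S" "s \<in> Rin r" "s' \<in> Rout r" "s \<noteq> s'" by blast
  obtain xs where "cyc E xs" "set xs = S" using S_cyc by blast
  then obtain L0 W0 where "cyc E (L0 @ W0)" "set (L0 @ W0) = S" "L0 \<noteq> []" "hd L0 = s'" "last L0 = s"
    using cyc_gap[of E xs s s'] s by metis
  then have "good (L0, W0)" using s by (simp add: good_def)
  then obtain LW where LW: "good LW" "\<And>LW'. good LW' \<Longrightarrow> length (snd LW) \<le> length (snd LW')"
    using ex_has_least_nat[of good "(L0, W0)" "length \<circ> snd"] by auto
  obtain L W where LWeq: "LW = (L, W)" by fastforce
  have C: "cyc E (L @ W)" "set (L @ W) = S" "L \<noteq> []" "last L \<in> Rin r" "hd L \<in> Rout r" "hd L \<noteq> last L"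
    using LW(1) by (auto simp: good_def LWeq)
  have min: "length W \<le> length W'"
    if "cyc E (L' @ W')" "set (L' @ W') = S" "L' \<noteq> []" "last L' \<in> Rin r" "hd L' \<in> Rout r" "hd L' \<noteq> last L'" for L' W'
    using LW(2)[of "(L', W')"] that by (simp add: good_def LWeq)
  have dist: "distinct (L @ W)" using cyc_distinct[OF C(1)] .
  obtain P where P: "path E P" "set P \<subseteq> R" "E (last L) (hd P)" "E (last P) (hd L)"
    using reach_path[OF r C(4,5)] by metis
  have W0: "W \<noteq> []" using bridgedI[of L P] not_bridged C P by auto
  \<comment> \<open>A connection between \<open>r\<close> and an inner vertex of the gap would
    shorten the gap from one of its sides.\<close>
  have nin: "u \<notin> Rin r" "u \<notin> Rout r" if uW: "u \<in> set W" for u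
  proof -
    obtain W1 W2 where W: "W = W1 @ u # W2" using split_list[OF uW] by blast
    have un: "u \<notin> set L" using uW dist by auto
    have "u \<noteq> last L" "u \<noteq> hd L" using un C(3) by auto
    show "u \<notin> Rin r"
      using min[of "L @ W1 @ [u]" W2] C W \<open>u \<noteq> hd L\<close> by auto
    have "cyc E ((u # W2 @ L) @ W1)" using cyc_swap[of E "L @ W1" "u # W2"] C(1) W by simp
    then show "u \<notin> Rout r"
      using min[of "u # W2 @ L" W1] C W \<open>u \<noteq> last L\<close> by auto
  qed
  have rW: "narcs E r u = 0" if "u \<in> set W" for u
    using narcs_not_reach[OF r nin[OF that]] .
  have lenm: "length L + length W = m" using cyc_length[OF C(1)] C(2) card_S by simp
  have finLW: "set L \<inter> set W = {}" using dist by auto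
  have no_insert_L: "no_insert E r L" by (rule R_no_insert[OF m2 r C(1,2)])
  have pL: "path E L" using C W0 by (auto simp: cyc_append)
  have degr: "deg E r S = deg E r (set L)"
    using deg_Un[of "set L" "set W" E r] finLW C(2) deg_eq_0[of "set W" E r] rW by simp
  have rle: "deg E r (set L) \<le> length L + 1" by (rule no_insert_deg_Suc[OF no_insert_L pL])
  have PS: "set P \<inter> set (L @ W) = {}" using P(2) C(2) by auto
  have gd: "(\<exists>u\<in>set W. deg E u S + 2 \<le> m + length W) \<or>
    (\<forall>u\<in>set W. no_insert E u L \<and> deg E u S + 1 \<le> m + length W)"
    using gap_deg[OF C(1) _ C(3) W0 P(1) PS P(3,4) m2] lenm C(2) by simp
  have cR: "card (R - {r}) + 1 = card R" using r card_Diff_singleton[of r R] card_gt_0_iff[of R] by auto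
  have le: "narcs E r x + narcs E u x \<le> 2" if "u \<in> set W" "x \<in> R - {r}" for x u
    using narcs_pair_le[OF r _ nin[OF that(1)]] that(2) by auto
  have key: "2 * m + 2 * card (R - {r}) \<le> deg E u S + deg E r (set L) + (deg E r (R - {r}) + deg E u (R - {r}))"
    "deg E r (R - {r}) + deg E u (R - {r}) \<le> 2 * card (R - {r})" if u: "u \<in> set W" for u
  proof -
    have dR: "deg E r R = deg E r (R - {r})" "deg E u R = deg E u (R - {r})"
      using deg_remove[of R r E r] deg_remove[of R r E u] r rW[OF u] by (auto simp: narcs_sym[of E u r])
    have uS: "u \<in> S" using u C(2) by auto
    have "2 * card V \<le> deg E r V + deg E u V + 2"
      using ore[of r u] rW[OF u] uS r S_sub by auto
    then show "2 * m + 2 * card (R - {r}) \<le> deg E u S + deg E r (set L) + (deg E r (R - {r}) + deg E u (R - {r}))"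
      using dR degr cR card_R deg_SR[of r] deg_SR[of u] by linarith
    show "deg E r (R - {r}) + deg E u (R - {r}) \<le> 2 * card (R - {r})"
      using deg_sum_le[of "R - {r}" E r u] le[OF u] by auto
  qed
  have "\<not> (\<exists>u\<in>set W. deg E u S + 2 \<le> m + length W)"
    using key rle lenm by fastforce
  then have tight: "deg E u S + 1 \<le> m + length W" if "u \<in> set W" for u
    using gd that by blast
  have "2 * card (R - {r}) \<le> deg E r (R - {r}) + deg E u (R - {r})" if "u \<in> set W" for u
    using key(1)[OF that] rle lenm tight[OF that] by linarith
  then have sum2: "narcs E r x + narcs E u x = 2" if "x \<in> R" "x \<noteq> r" "u \<in> set W" for x u
    using deg_sum_eq[of "R - {r}" E r u x] le[OF that(3)] that by auto
  have "hd W \<in> set W" using W0 by simp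
  have "length L + 1 \<le> deg E r (set L)"
    using key[OF \<open>hd W \<in> set W\<close>] lenm tight[OF \<open>hd W \<in> set W\<close>] by linarith
  then have "E (last L) r" using no_insert_deg_eqD[OF no_insert_L pL] by blast
  then show thesis using that[OF C(1,2,3) W0 C(6)] nin sum2 tight by blast
qed

lemma no_separated_cycle:
  assumes m2: "m + 2 \<le> card V"
    and not_bridged: "\<not> bridged"
    and nocut: "\<forall>r\<in>R. \<forall>x\<in>S. \<not> S \<inter> (Rin r \<union> Rout r) \<subseteq> {x}"
  shows False
proof -
  note no_insert_L = R_no_insert[OF m2]
  \<comment> \<open>If \<open>r\<close> and \<open>x\<close> were non-adjacent, equality in the gap
    of \<open>r\<close> would join \<open>x\<close> both ways to all of \<open>W\<close>. Then
    \<open>x\<close> cannot dominate \<open>hd L\<close> or be dominated by \<open>last L\<close>,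
    for either would give a cycle of length m + 1. The bound for \<open>x\<close> on
    \<open>L\<close> drops by two, and the degree condition fails.\<close>
  have adj: "E r x \<or> E x r" if r: "r \<in> R" and x: "x \<in> R" and ne: "r \<noteq> x" for r x
  proof (rule ccontr)
    assume "\<not> ?thesis"
    then have rx: "narcs E r x = 0" by (simp add: narcs_0_iff)
    obtain L W where LW: "cyc E (L @ W)" "set (L @ W) = S" "L \<noteq> []" "W \<noteq> []" "hd L \<noteq> last L"
      "set W \<inter> (Rin r \<union> Rout r) = {}" "E (last L) r"
      "\<And>x u. x \<in> R \<Longrightarrow> x \<noteq> r \<Longrightarrow> u \<in> set W \<Longrightarrow> narcs E r x + narcs E u x = 2"
      "\<And>u. u \<in> set W \<Longrightarrow> deg E u S + 1 \<le> m + length W"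
      using tight_gap[OF m2 not_bridged nocut r] by blast
    have lenm: "length L + length W = m" using cyc_length[OF LW(1)] LW(2) card_S by simp
    have pL: "path E L" "path E W" "set L \<inter> set W = {}" "E (last L) (hd W)" "E (last W) (hd L)"
      using LW by (auto simp: cyc_append)
    have Wx: "E u x" "E x u" if "u \<in> set W" for u
      using LW(8)[OF x _ that] ne rx by (auto simp: narcs_2_iff)
    have xS: "x \<notin> set L" "x \<notin> set W" using x LW(2) by auto
    have "\<not> E x (hd L)"
      using no_long'[of "(L @ W) @ [x]"] pL LW(3,4) Wx xS m2 lenm by (auto simp: cyc_append path_append path_Cons)
    moreover have "\<not> E (last L) x"
      using no_long'[of "L @ x # W"] pL LW(3,4) Wx xS m2 lenm by (auto simp: cyc_append path_append path_Cons)
    ultimately have "deg E x (set L) + 1 \<le> length L"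
      using no_insert_deg[OF no_insert_L[OF x LW(1,2)] pL(1)] by simp
    moreover have "deg E x S = deg E x (set L) + deg E x (set W)"
      using deg_Un[of "set L" "set W" E x] pL(3) LW(2) by simp
    moreover have "deg E x (set W) \<le> 2 * length W"
      using deg_le[of "set W" E x] path_length[OF pL(2)] by simp
    moreover have "deg E r S \<le> length L + 1"
    proof -
      have "deg E r (set W) = 0" using LW(6) by (intro deg_eq_0 narcs_not_reach[OF r]) auto
      then show ?thesis
        using deg_Un[of "set L" "set W" E r] pL(3) LW(2) no_insert_deg_Suc[OF no_insert_L[OF r LW(1,2)] pL(1)] by simp
    qed
    moreover have "deg E r R + deg E x R \<le> 2 * card (R - {r, x})"
    proof -
      have "R - {r} - {x} = R - {r, x}" by auto
      then have "deg E r R = deg E r (R - {r, x})" "deg E x R = deg E x (R - {r, x})"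
        using deg_remove[of R r E r] deg_remove[of R r E x] deg_remove[of "R - {r}" x E r]
          deg_remove[of "R - {r}" x E x] r x ne rx by (auto simp: narcs_sym[of E x r])
      moreover have "narcs E r y + narcs E x y \<le> 2" if y: "y \<in> R" for y
      proof -
        obtain u where u: "u \<in> set W" using LW(4) by (cases W) auto
        have "u \<in> Rin x" "u \<in> Rout x" "u \<notin> Rin r" "u \<notin> Rout r"
          using Wx[OF u] LW(6) u x by (auto intro: Rin_arc Rout_arc)
        then have "\<not> (E r y \<and> E y x)" "\<not> (E x y \<and> E y r)"
          using Rout_step[of r y u] Rout_step[of y x u] Rin_step[of r y u] Rin_step[of y x u] r x y by blast+
        then show ?thesis by (auto simp: narcs_def)
      qed
      ultimately show ?thesis using deg_sum_le[of "R - {r, x}" E r x] by simp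
    qed
    moreover have "card (R - {r, x}) + 2 = card R"
      using card_Diff_subset[of "{r,x}" R] r x ne card_mono[of R "{r, x}"] by simp
    moreover have "2 * card V \<le> deg E r V + deg E x V + 2" using ore[of r x] rx r x ne by auto
    ultimately show False using lenm card_R deg_SR[of r] deg_SR[of x] by linarith
  qed
  have "R \<noteq> {}" using card_R m2 by (metis card.empty add_0 add_le_same_cancel1 not_numeral_le_zero)
  then obtain P where P: "path E P" "set P = R"
    using semicomplete_path[of R E] adj by auto
  have lenP: "length P + m = card V" using path_length[OF P(1)] P(2) card_R by simp
  define a where "a = hd P"
  define b where "b = last P"
  have P0: "P \<noteq> []" using P(1) by auto
  have ab: "a \<in> R" "b \<in> R" "a \<noteq> b"
  proof -
    show "a \<in> R" "b \<in> R" using P0 P(2) hd_in_set[of P] last_in_set[of P] by (auto simp: a_def b_def)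
    show "a \<noteq> b" using path_distinct[OF P(1)] lenP m2 by (cases P) (auto simp: a_def b_def)
  qed
  obtain L W where LW: "cyc E (L @ W)" "set (L @ W) = S" "L \<noteq> []" "W \<noteq> []" "hd L \<noteq> last L"
    "set W \<inter> (Rin a \<union> Rout a) = {}" "E (last L) a"
    "\<And>x u. x \<in> R \<Longrightarrow> x \<noteq> a \<Longrightarrow> u \<in> set W \<Longrightarrow> narcs E a x + narcs E u x = 2"
    "\<And>u. u \<in> set W \<Longrightarrow> deg E u S + 1 \<le> m + length W"
    using tight_gap[OF m2 not_bridged nocut ab(1)] by blast
  have lenm: "length L + length W = m" using cyc_length[OF LW(1)] LW(2) card_S by simp
  have pL: "path E L" "path E W" "set L \<inter> set W = {}" "E (last L) (hd W)" "E (last W) (hd L)"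
    using LW by (auto simp: cyc_append)
  have VV: "S \<union> R = V" using S_sub by auto
  have reach_ab: "Rreach a p" "Rreach p b" if "p \<in> R" for p
    using path_reach[OF P(1), of R p] path_reach_last[OF P(1), of R p] P(2) that by (auto simp: a_def b_def)
  have "hd W \<in> set W" using LW(4) by simp
  \<comment> \<open>\<open>hd W\<close> and \<open>b\<close> turn out to be non-adjacent. Equality
    at \<open>b\<close> for the pair \<open>a\<close>, \<open>hd W\<close> then puts both arcs
    between \<open>a\<close> and \<open>b\<close>, and any two vertices of \<open>R\<close> reach
    each other inside \<open>R\<close>.\<close>
  have "\<not> E b (hd W)"
  proof
    assume "E b (hd W)"
    then have "hd W \<in> Rout a" using reach_ab(1)[OF ab(2)] ab(2) by (auto intro: outreachI)
    then show False using LW(6) \<open>hd W \<in> set W\<close> by auto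
  qed
  moreover have "\<not> E (hd W) b"
  proof
    assume "E (hd W) b"
    moreover have "path E (W @ L @ P)" using pL P LW(2,3,4,7) P0 by (auto simp: path_append a_def)
    moreover have "set (W @ L @ P) = V" using LW(2) P(2) VV by auto
    ultimately show False using no_bypass[of "W @ L @ P"] LW(4) P0 by (auto simp: b_def)
  qed
  ultimately have "E b a" using LW(8)[OF ab(2) _ \<open>hd W \<in> set W\<close>] ab(3) by (auto simp: narcs_def of_bool_def split: if_splits)
  then have "Rreach b a" using ab by (intro r_into_rtranclp) (simp add: restr_def)
  then have reach: "Rreach p q" if "p \<in> R" "q \<in> R" for p q
    using reach_ab(2)[OF that(1)] reach_ab(1)[OF that(2)] by (meson rtranclp_trans)
  have rW: "narcs E r u = 0" if "r \<in> R" "u \<in> set W" for r u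
  proof (rule narcs_not_reach[OF that(1)])
    show "u \<notin> Rin r" "u \<notin> Rout r"
      using LW(6) that(2) Rin_trans[OF reach[OF that(1) ab(1)], of u] Rout_trans[OF reach[OF ab(1) that(1)], of u]
      by blast+
  qed
  \<comment> \<open>No arc joins \<open>R\<close> and \<open>W\<close> any more, so comparison with
    \<open>hd W\<close> is tight for every \<open>r\<close> in \<open>R\<close>: it attains |L| + 1
    on \<open>L\<close> and is joined both ways to the rest of \<open>R\<close>.\<close>
  have tightr: "length L + 1 \<le> deg E r (set L)" "2 * (card R - 1) \<le> deg E r R" if r: "r \<in> R" for r
  proof -
    define u where "u = hd W"
    have u: "u \<in> set W" using LW(4) by (simp add: u_def)
    have "deg E r (set W) = 0" "deg E u R = 0"
      using rW r u by (auto intro!: deg_eq_0 simp: narcs_sym[of E u])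
    moreover have "deg E r S = deg E r (set L) + deg E r (set W)"
      using deg_Un[of "set L" "set W" E r] pL(3) LW(2) by simp
    moreover have "2 * card V \<le> deg E r V + deg E u V + 2"
      using ore[of r u] rW[OF r u] r u LW(2) S_sub by auto
    moreover have "deg E u S + 1 \<le> m + length W" using LW(9)[OF u] .
    moreover have "deg E r R + 2 \<le> 2 * card R" using deg_in_le[OF _ r] by simp
    moreover have "deg E r (set L) \<le> length L + 1" using no_insert_deg_Suc[OF no_insert_L[OF r LW(1,2)] pL(1)] .
    ultimately show "length L + 1 \<le> deg E r (set L)" "2 * (card R - 1) \<le> deg E r R"
      using lenm card_R deg_SR[of r] deg_SR[of u] by linarith+
  qed
  have RR: "E r x" if "r \<in> R" "x \<in> R" "r \<noteq> x" for r x
  proof -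
    have "card (R - {r}) = card R - 1" using that by simp
    moreover have "deg E r R = deg E r (R - {r})" using deg_remove[of R r E r] that by simp
    ultimately have "narcs E r x = 2" using deg_complete[of "R - {r}" E r x] tightr(2)[OF that(1)] that by auto
    then show ?thesis by (simp add: narcs_2_iff)
  qed
  \<comment> \<open>The first two vertices of \<open>L\<close> decide. Every vertex of
    \<open>R\<close> dominates \<open>p\<close>, and it is dominated by \<open>p\<close> or
    dominates \<open>q\<close>. Each distribution of these arcs yields a bypass, a bridge, or a
    cycle that misses only \<open>q\<close>.\<close>
  obtain p q L' where L: "L = p # q # L'"
    using LW(3,5) by (cases L; cases "tl L") auto
  have split: "E (last L) r" "E r (hd L)"
    "\<And>A B. L = A @ B \<Longrightarrow> A \<noteq> [] \<Longrightarrow> B \<noteq> [] \<Longrightarrow> E (last A) r \<or> E r (hd B)" if "r \<in> R" for r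
    using no_insert_deg_eqD[OF no_insert_L[OF that LW(1,2)] pL(1) tightr(1)[OF that]] by blast+
  have cyc_q: "cyc E ((q # L' @ W) @ [p])" using cyc_swap[of E "[p]" "q # L' @ W"] LW(1) L by simp
  have RS: "set P \<inter> S = {}" using P(2) by auto
  have set_q: "set (q # L' @ W @ [p]) = S" using LW(2) L by auto
  show False
  proof (cases "\<exists>r\<in>R. E p r")
    case False
    then have Rq: "E r q" if "r \<in> R" for r using split(3)[OF that, of "[p]" "q # L'"] that L by auto
    have "path E (P @ q # L' @ W @ [p])"
      using P P0 RS set_q Rq[OF ab(2)] cyc_q by (auto simp: path_append cyc_def b_def)
    moreover have "set (P @ q # L' @ W @ [p]) = V" using P(2) set_q VV by auto
    ultimately show False using no_bypass[of "P @ q # L' @ W @ [p]"] split(2)[OF ab(1)] L P0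
      by (simp add: a_def)
  next
    case True
    then obtain r where r: "r \<in> R" "E p r" by blast
    have all: "E p x" if x: "x \<in> R" for x
    proof (rule ccontr)
      assume nE: "\<not> E p x"
      then have "E x q" using split(3)[OF x, of "[p]" "q # L'"] L by auto
      moreover have "r \<noteq> x" using nE r by auto
      ultimately show False using not_bridged bridgedI[OF cyc_q, of "[r, x]"] set_q r x RR[of r x] by (auto simp: path_Cons)
    qed
    show False
    proof (cases "\<exists>r\<in>R. E q r")
      case True
      then obtain r where r: "r \<in> R" "E q r" by blast
      obtain xs where xs: "set xs = R - {r}" "distinct xs" using finite_distinct_list[of "R - {r}"] by auto
      define P' where "P' = xs @ [r]"
      have P': "path E P'" "set P' = R" "last P' = r"
      proof -
        show s: "set P' = R" "last P' = r" using xs r by (auto simp: P'_def)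
        show "path E P'" by (rule complete_path) (use s RR xs r in \<open>auto simp: P'_def\<close>)
      qed
      have "P' \<noteq> []" by (simp add: P'_def)
      then have "hd P' \<in> R" using P'(2) hd_in_set by metis
      have "path E ((q # L' @ W @ [p]) @ P')"
        unfolding path_append
        using P' cyc_q set_q all[OF \<open>hd P' \<in> R\<close>] \<open>P' \<noteq> []\<close> by (auto simp: cyc_def)
      moreover have "set ((q # L' @ W @ [p]) @ P') = V" using P'(2) set_q VV by auto
      ultimately show False using no_bypass[of "(q # L' @ W @ [p]) @ P'"] r P' \<open>P' \<noteq> []\<close> by simp
    next
      case False
      have L'0: "L' \<noteq> []" using split(1)[OF r(1)] False r L by auto
      have "E b (hd L')" using split(3)[OF ab(2), of "[p, q]" L'] False ab L L'0 by auto
      moreover have "path E (L' @ W @ [p])" using cyc_q L'0 by (auto simp: cyc_def path_Cons)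
      ultimately have "cyc E ((L' @ W @ [p]) @ P)"
        using P P0 L'0 RS set_q all[OF ab(1)] by (subst cyc_append) (auto simp: a_def b_def)
      then show False using no_long' L lenm lenP m2 by fastforce
    qed
  qed
qed

end

lemma deg_card:
  assumes "finite A"
  shows "deg E x A = card {a \<in> A. E x a} + card {a \<in> A. E a x}"
  using assms by (simp add: deg_def narcs_def sum.distrib Int_def)

lemma deg_le_card:
  assumes "finite A" "\<And>a. a \<in> A \<Longrightarrow> narcs E x a \<le> 1"
  shows "deg E x A \<le> card A"
  unfolding deg_def using sum_bounded_above[of A "narcs E x" 1] assms by simp

lemma card_le_1: "(\<And>a b. a \<in> A \<Longrightarrow> b \<in> A \<Longrightarrow> a = b) \<Longrightarrow> card A \<le> 1"
  by (metis One_nat_def card.infinite card_le_Suc0_iff_eq le0)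

section \<open>Paths outside that bridge an arc of the cycle\<close>

lemma least_length_snd:
  assumes "Q L W"
  shows "\<exists>L W. Q L W \<and> (\<forall>L' W'. Q L' W' \<longrightarrow> length W \<le> length W')"
  using ex_has_least_nat[of "case_prod Q" "(L, W)" "\<lambda>p. length (snd p)"] assms by auto

context max_cyc
begin

text \<open>The cycle cut open gives m - 1 plus the two end arcs, and the closing pair forbids
  having both end arcs.\<close>

lemma R_deg_S:
  assumes "m + 2 \<le> card V" "r \<in> R"
  shows "deg E r S \<le> m"
proof -
  obtain xs where xs: "cyc E xs" "set xs = S" using S_cyc by blast
  have "no_insert E r xs" using R_no_insert[OF assms, of xs "[]"] xs by simp
  then have "deg E r S + 1 \<le> length xs + of_bool (E r (hd xs)) + of_bool (E (last xs) r)"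
    using no_insert_deg[of E r xs] xs by (auto simp: cyc_def)
  moreover have "length xs = m" using cyc_length[OF xs(1)] xs(2) card_S by simp
  moreover have "of_bool (E r (hd xs)) + of_bool (E (last xs) r) \<le> (1 :: nat)"
    using R_no_insert_ends[OF assms xs] by auto
  ultimately show ?thesis by linarith
qed

text \<open>A cycle extended by its bridge is longer than \<open>m\<close>, hence Hamiltonian, so
  the bridge uses up all of \<open>R\<close>.\<close>

lemma bridged_path:
  assumes "m + 2 \<le> card V" bridged
  obtains xs P where "cyc E xs" "set xs = S" "path E P" "set P = R" "E (last xs) (hd P)" "E (last P) (hd xs)"
    "cyc E (xs @ P)"
proof -
  obtain xs P where *: "cyc E xs" "set xs = S" "path E P" "set P \<subseteq> R" "E (last xs) (hd P)" "E (last P) (hd xs)"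
    using assms(2) unfolding bridged_def by blast
  have "xs \<noteq> []" "P \<noteq> []" using * by (auto simp: cyc_def)
  then have c: "cyc E (xs @ P)" using * by (subst cyc_append) (auto simp: cyc_def)
  then have "length P + m = card V"
    using no_long[OF c] cyc_length[OF *(1)] *(2) card_S \<open>P \<noteq> []\<close> by auto
  then have "set P = R" using path_length[OF *(3)] card_R *(4) card_subset_eq[of R "set P"] by simp
  then show thesis using that * c by blast
qed

text \<open>A forward arc that skips part of the bridge leaves a cycle still longer than
  \<open>m\<close> but no longer Hamiltonian. Between consecutive vertices the backward arc would
  reverse an arc of a Hamiltonian cycle.\<close>

lemma bridged_arcs:
  assumes m2: "m + 2 \<le> card V" and br: "cyc E xs" "set xs = S" "cyc E (xs @ A @ x # B @ y # C)" "set (A @ x # B @ y # C) = R"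
  shows "narcs E x y \<le> 1" "B \<noteq> [] \<Longrightarrow> \<not> E x y"
proof -
  let ?P = "A @ x # B @ y # C"
  have len: "length xs = m" using cyc_length[OF br(1)] br(2) card_S by simp
  have "set (xs @ ?P) = V" unfolding set_append[of xs ?P] br(2,4) using S_sub by auto
  then have lenV: "length (xs @ ?P) = card V" using cyc_length[OF br(3)] by (simp only:)
  show B: "\<not> E x y" if "B \<noteq> []"
  proof
    assume "E x y"
    then have "cyc E (xs @ A @ x # y # C)"
      using br(3) by (auto simp: cyc_def path_append path_Cons split: if_splits)
    moreover have "length (xs @ A @ x # y # C) < card V" using lenV that by (cases B) auto
    ultimately show False using no_long'[of "xs @ A @ x # y # C"] len by simp
  qed
  show "narcs E x y \<le> 1"
  proof (cases "B = []")
    case True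
    then have "\<not> E y x"
      using ham_not_rev[of "xs @ A @ [x]" "y # C"] br S_sub by auto
    then show ?thesis by (simp add: narcs_def)
  qed (use B in \<open>simp add: narcs_def\<close>)
qed

text \<open>\<open>R\<close> is a tournament. Since no pair carries two arcs, a non-adjacent pair
  would have at most |R| - 2 arcs each to \<open>R\<close> and at most \<open>m\<close> each to
  \<open>S\<close>, in total 2 * card V - 4.\<close>

lemma bridged_R:
  assumes m2: "m + 2 \<le> card V" and br: bridged and x: "x \<in> R" and y: "y \<in> R" and ne: "x \<noteq> y"
  shows "narcs E x y \<le> 1" "E x y \<or> E y x"
proof -
  obtain xs P where P: "cyc E xs" "set xs = S" "path E P" "set P = R" "cyc E (xs @ P)"
    using bridged_path[OF m2 br] by metis
  have le: "narcs E a b \<le> 1" if aR: "a \<in> R" and bR: "b \<in> R" and "a \<noteq> b" for a b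
  proof -
    obtain A B where AB: "P = A @ a # B" using split_list[of a P] P(4) aR by blast
    show ?thesis
    proof (cases "b \<in> set B")
      case True
      then obtain B1 B2 where "B = B1 @ b # B2" by (meson split_list)
      then show ?thesis using bridged_arcs(1)[OF m2 P(1,2), of A a B1 b B2] P AB by simp
    next
      case False
      then have "b \<in> set A" using AB P(4) aR bR \<open>a \<noteq> b\<close> by auto
      then obtain A1 A2 where "A = A1 @ b # A2" by (meson split_list)
      then show ?thesis using bridged_arcs(1)[OF m2 P(1,2), of A1 b A2 a B] P AB by (simp add: narcs_sym)
    qed
  qed
  show "narcs E x y \<le> 1" using le x y ne .
  show "E x y \<or> E y x"
  proof (rule ccontr)
    assume "\<not> ?thesis"
    then have xy: "narcs E x y = 0" by (simp add: narcs_0_iff)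
    have "deg E a R + 2 \<le> card R" if "a \<in> R" "b \<in> R" "a \<noteq> b" "narcs E a b = 0" for a b
    proof -
      have "deg E a R = deg E a (R - {a} - {b})"
        using deg_remove[of R a E a] deg_remove[of "R - {a}" b E a] that by auto
      also have "\<dots> \<le> card (R - {a} - {b})" using deg_le_card[of "R - {a} - {b}" E a] le that(1) by auto
      finally show ?thesis
        using card_Diff_singleton[of a R] card_Diff_singleton[of b "R - {a}"] that
          card_mono[of R "{a, b}"] by auto
    qed
    from this[OF x y ne xy] this[OF y x] have "deg E x R + 2 \<le> card R" "deg E y R + 2 \<le> card R"
      using ne xy by (auto simp: narcs_sym)
    moreover have "2 * card V \<le> deg E x V + deg E y V + 2" using ore[of x y] xy x y ne by auto
    ultimately show False
      using R_deg_S[OF m2 x] R_deg_S[OF m2 y] card_R deg_SR[of x] deg_SR[of y] by linarith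
  qed
qed

lemma bridged_deg_R:
  assumes m2: "m + 2 \<le> card V" and br: bridged and x: "x \<in> R"
  shows "deg E x R + 1 \<le> card R"
proof -
  have "deg E x R = deg E x (R - {x})" using deg_remove[of R x E x] x by simp
  also have "\<dots> \<le> card (R - {x})" using deg_le_card[of "R - {x}" E x] bridged_R(1)[OF m2 br x] by auto
  finally show ?thesis using card_Diff_singleton[of x R] x card_gt_0_iff[of R] by auto
qed

text \<open>With three or more outside vertices the arc from first to last would skip part of the
  bridge, so in the tournament \<open>R\<close> the arc runs from last to first.\<close>

lemma bridged_cyc:
  assumes m3: "m + 3 \<le> card V" and br: bridged
  obtains xs P where "cyc E xs" "set xs = S" "cyc E P" "set P = R" "E (last xs) (hd P)" "E (last P) (hd xs)"
proof -
  have m2: "m + 2 \<le> card V" using m3 by simp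
  obtain xs P where P: "cyc E xs" "set xs = S" "path E P" "set P = R" "E (last xs) (hd P)" "E (last P) (hd xs)"
    "cyc E (xs @ P)"
    using bridged_path[OF m2 br] .
  have len: "3 \<le> length P" using path_length[OF P(3)] P(4) card_R m3 by simp
  define a where "a = hd P" define b where "b = last P" define B where "B = butlast (tl P)"
  have "P = a # tl P" using P(3) by (cases P) (auto simp: a_def)
  moreover have "tl P = B @ [b]" using len by (cases P) (auto simp: B_def b_def)
  ultimately have PB: "P = a # B @ [b]" by metis
  have "B \<noteq> []" using len PB by auto
  then have "\<not> E a b" using bridged_arcs(2)[OF m2 P(1,2), of "[]" a B b "[]"] P PB by simp
  moreover have "a \<in> R" "b \<in> R" "a \<noteq> b" using PB P(4) path_distinct[OF P(3)] by auto
  ultimately have "E b a" using bridged_R(2)[OF m2 br] by blast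
  then have "cyc E P" using P(3) by (simp add: cyc_def a_def b_def)
  then show thesis using that P by blast
qed

text \<open>The vertices outside form a directed cycle. Along it any two of them are joined by a path,
  which is Hamiltonian on \<open>R\<close> only if it ends at the predecessor of its first vertex.\<close>

lemma not_bridged_ge3:
  assumes m3: "m + 3 \<le> card V"
  shows "\<not> bridged"
proof
  assume br: bridged
  have m2: "m + 2 \<le> card V" using m3 by simp
  obtain xs0 P where P: "cyc E xs0" "set xs0 = S" "cyc E P" "set P = R" "E (last xs0) (hd P)" "E (last P) (hd xs0)"
    using bridged_cyc[OF m3 br] .
  have lenS: "length xs = m" if "cyc E xs" "set xs = S" for xs
    using cyc_length[OF that(1)] that(2) card_S by simp
  have VV: "S \<union> R = V" using S_sub by auto
  have F0: "\<exists>Q. path E Q \<and> set Q \<subseteq> R \<and> hd Q = x \<and> last Q = y \<and> (set Q = R \<longrightarrow> y = last qs) \<and> (x \<noteq> y \<longrightarrow> 2 \<le> length Q)"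
    if qs: "cyc E qs" "set qs = R" "hd qs = x" and yR: "y \<in> R" for x y qs
  proof -
    obtain A B where AB: "qs = A @ y # B" using split_list[of y qs] qs(2) yR by blast
    have 1: "path E (A @ [y])" using qs(1) AB path_sub(1)[of E "A @ [y]" B] by (simp add: cyc_def)
    have 2: "hd (A @ [y]) = x" using qs(3) AB by (cases A) auto
    have "B = []" if "set (A @ [y]) = R"
      using that qs(2) AB cyc_distinct[OF qs(1)] by (cases B) auto
    then have 3: "set (A @ [y]) = R \<longrightarrow> y = last qs" using AB by auto
    have 4: "x \<noteq> y \<longrightarrow> 2 \<le> length (A @ [y])" using 2 by (cases A) auto
    show ?thesis
      by (rule exI[of _ "A @ [y]"]) (use 1 2 3 4 qs(2) AB in auto)
  qed
  \<comment> \<open>Stopping on \<open>qs\<close> before its last vertex leaves out part of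
    \<open>R\<close>, and together with \<open>xs\<close> this gives a cycle of length strictly
    between \<open>m\<close> and \<open>card V\<close>.\<close>
  have F1: "y = last qs" if xs: "cyc E xs" "set xs = S" and qs: "cyc E qs" "set qs = R"
    and "E (last xs) (hd qs)" and yR: "y \<in> R" and "E y (hd xs)" for xs qs y
  proof (rule ccontr)
    assume "y \<noteq> last qs"
    then obtain Q where Q: "path E Q" "set Q \<subseteq> R" "hd Q = hd qs" "last Q = y" "set Q \<noteq> R"
      using F0[OF qs refl, of y] yR \<open>y \<noteq> last qs\<close> by blast
    have ne: "Q \<noteq> []" "xs \<noteq> []" using Q(1) xs(1) by (auto simp: cyc_def)
    have "cyc E (xs @ Q)" using Q that ne by (subst cyc_append) (auto simp: cyc_def)
    moreover have "length Q < card R" using path_length[OF Q(1)] Q(2,5) psubset_card_mono[of R "set Q"] by auto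
    ultimately show False using no_long'[of "xs @ Q"] lenS[OF xs] card_R ne by auto
  qed
  have cycR: "\<exists>qs. cyc E qs \<and> set qs = R \<and> hd qs = x" "\<exists>qs. cyc E qs \<and> set qs = R \<and> last qs = x" if "x \<in> R" for x
    using cyc_hd_at[OF P(3), of x] cyc_last_at[OF P(3), of x] unfolding P(4) by (metis that list.sel(1), metis that last_snoc)
  have F1a: "y = z" "x \<noteq> y" "\<exists>Q. path E Q \<and> set Q = R \<and> hd Q = x \<and> last Q = y"
    if xs: "cyc E xs" "set xs = S" and x: "x \<in> R" "E (last xs) x" and y: "y \<in> R" "E y (hd xs)" "z \<in> R" "E z (hd xs)" for xs x y z
  proof -
    obtain qs where qs: "cyc E qs" "set qs = R" "hd qs = x" using cycR(1)[OF x(1)] by blast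
    have *: "y = last qs" "z = last qs" using F1[OF xs qs(1,2)] qs(3) x y by auto
    then show "y = z" by simp
    show "x \<noteq> y" using *(1) qs(1,3) irrefl by (auto simp: cyc_def)
    show "\<exists>Q. path E Q \<and> set Q = R \<and> hd Q = x \<and> last Q = y" using qs * by (auto simp: cyc_def)
  qed
  have F1b: "x = x'"
    if xs: "cyc E xs" "set xs = S" and x: "x \<in> R" "E (last xs) x" "x' \<in> R" "E (last xs) x'" and y: "y \<in> R" "E y (hd xs)" for xs x x' y
  proof -
    obtain qs where qs: "cyc E qs" "set qs = R" "last qs = y" using cycR(2)[OF y(1)] by blast
    have "v = hd qs" if v: "v \<in> R" "E (last xs) v" for v
    proof -
      obtain A B where AB: "qs = A @ v # B" using split_list[of v qs] qs(2) v(1) by blast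
      have "A = []"
      proof (rule ccontr)
        assume A: "A \<noteq> []"
        have "cyc E ((v # B) @ A)" using qs(1) AB cyc_swap[of E A "v # B"] by simp
        moreover have "set ((v # B) @ A) = R" using qs(2) AB by auto
        ultimately have "y = last A" using F1[OF xs, of "(v # B) @ A" y] v y A by simp
        then show False using qs(3) AB A cyc_distinct[OF qs(1)] by (cases B rule: rev_cases) auto
      qed
      then show ?thesis using AB by simp
    qed
    then show ?thesis using x by blast
  qed
  \<comment> \<open>Omitting \<open>p\<close> loses one vertex, while a path from \<open>x\<close>
    to a different \<open>y\<close> gains at least two and at most |R|; the length m - 1 + |Q| is
    again forbidden.\<close>
  have F2: "x = y" if xs: "cyc E (p # xs)" "set (p # xs) = S" and x: "x \<in> R" "E (last xs) x" and y: "y \<in> R" "E y (hd xs)"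
    for p xs x y
  proof (rule ccontr)
    assume "x \<noteq> y"
    obtain qs where qs: "cyc E qs" "set qs = R" "hd qs = x" using cycR(1)[OF x(1)] by blast
    obtain Q where Q: "path E Q" "set Q \<subseteq> R" "hd Q = x" "last Q = y" "2 \<le> length Q"
      using F0[OF qs y(1)] \<open>x \<noteq> y\<close> by blast
    have ne: "xs \<noteq> []" "Q \<noteq> []" using lenS[OF xs] m_ge_2 Q(1) by auto
    have "path E xs" using xs(1) ne by (auto simp: cyc_def path_Cons)
    then have "cyc E (xs @ Q)" using Q xs(2) x y ne by (subst cyc_append) auto
    moreover have "length Q \<le> card R" using path_length[OF Q(1)] Q(2) card_mono[of R "set Q"] by simp
    ultimately show False using no_long'[of "xs @ Q"] lenS[OF xs] Q(5) card_R by auto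
  qed
  define good where "good L W \<longleftrightarrow> cyc E (L @ W) \<and> set (L @ W) = S \<and> L \<noteq> [] \<and> W \<noteq> [] \<and>
    (\<exists>x\<in>R. E (last L) x) \<and> (\<exists>y\<in>R. E y (hd L))" for L W
  show False
  proof (cases "\<exists>L W. good L W")
    case False
    have ne: "P \<noteq> []" "xs0 \<noteq> []" using P(1,3) by (auto simp: cyc_def)
    then have hl: "hd P \<in> R" "last P \<in> R" "P \<noteq> []" "xs0 \<noteq> []"
      using hd_in_set[of P] last_in_set[of P] unfolding P(4) by blast+
    have I: "c = last xs0" if "c \<in> S" "x \<in> R" "E c x" for c x
    proof (rule ccontr)
      assume "c \<noteq> last xs0"
      then obtain L W where "cyc E (L @ W)" "set (L @ W) = S" "L \<noteq> []" "W \<noteq> []" "hd L = hd xs0" "last L = c"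
        using cyc_gap_last[of E xs0 c] P(1,2) \<open>c \<in> S\<close> by auto
      then have "good L W" unfolding good_def using P(6) hl(2) that(2,3) by auto
      then show False using False by blast
    qed
    have O: "c = hd xs0" if "c \<in> S" "x \<in> R" "E x c" for c x
    proof (rule ccontr)
      assume "c \<noteq> hd xs0"
      then obtain L W where "cyc E (L @ W)" "set (L @ W) = S" "L \<noteq> []" "W \<noteq> []" "hd L = c" "last L = last xs0"
        using cyc_gap_hd[of E xs0 c] P(1,2) \<open>c \<in> S\<close> by auto
      then have "good L W" unfolding good_def using P(5) hl(1) that(2,3) by auto
      then show False using False by blast
    qed
    \<comment> \<open>Among three outside vertices one is neither first nor last on the bridge, and
      it has no neighbour in \<open>S\<close>. Its degree is at most |R| - 1 and that of
      \<open>a\<close> at most 2m - 1, which is too little.\<close>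
    obtain r where r: "r \<in> R" "r \<noteq> hd P" "r \<noteq> last P"
    proof -
      have "\<not> R \<subseteq> {hd P, last P}"
      proof
        assume "R \<subseteq> {hd P, last P}"
        then have "card R \<le> card {hd P, last P}" by (intro card_mono) auto
        also have "\<dots> \<le> 2" by (simp add: card_insert_if)
        finally show False using card_R m3 by simp
      qed
      then show thesis using that by blast
    qed
    have rS: "narcs E r c = 0" if c: "c \<in> S" for c
    proof -
      have "\<not> E c r" using I[OF c r(1)] F1b[OF P(1,2) r(1) _ hl(1) P(5) hl(2) P(6)] r(2) by auto
      moreover have "\<not> E r c" using O[OF c r(1)] F1a(1)[OF P(1,2) hl(1) P(5) r(1) _ hl(2) P(6)] r(3) by auto
      ultimately show ?thesis by (simp add: narcs_0_iff)
    qed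
    define a where "a = last xs0"
    have a: "a \<in> S" "a \<noteq> hd xs0"
      using P(1,2) hl(4) lenS[OF P(1,2)] m_ge_2 cyc_distinct[OF P(1)] irrefl[of a]
      by (auto simp: a_def cyc_def)
    have "deg E a R \<le> 1"
    proof -
      have e: "{v \<in> R. E v a} = {}" using O a by blast
      have "card {v \<in> R. E v a} = 0" unfolding e by simp
      moreover have "card {v \<in> R. E a v} \<le> 1"
        using F1b[OF P(1,2) _ _ _ _ hl(2) P(6)] by (intro card_le_1) (auto simp: a_def)
      moreover have "deg E a R = card {v \<in> R. E a v} + card {v \<in> R. E v a}" by (rule deg_card) simp
      ultimately show ?thesis by linarith
    qed
    moreover have "deg E a S + 2 \<le> 2 * m" using deg_in_le[of S a] a(1) card_S by simp
    moreover have "deg E r S = 0" using rS by (rule deg_eq_0)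
    moreover have "deg E r R + 1 \<le> card R" using bridged_deg_R[OF m2 br r(1)] .
    moreover have "2 * card V \<le> deg E r V + deg E a V + 2" using ore[of r a] rS[OF a(1)] r a S_sub by auto
    ultimately show False using card_R deg_SR[of r] deg_SR[of a] m3 by linarith
  next
    case True
    then obtain L W where LW: "good L W" "\<And>L' W'. good L' W' \<Longrightarrow> length W \<le> length W'"
      using least_length_snd[of good] by blast
    have min: "length W \<le> length W'" if "good L' W'" for L' W' using LW(2) that .
    obtain x0 y0 where C: "cyc E (L @ W)" "set (L @ W) = S" "L \<noteq> []" "W \<noteq> []"
      and xy: "x0 \<in> R" "E (last L) x0" "y0 \<in> R" "E y0 (hd L)"
      using LW(1) by (auto simp: good_def)
    have swap: "cyc E (W @ L)" "set (W @ L) = S" using cyc_swap[OF C(1)] C(2) by auto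
    have lenm: "length L + length W = m" using lenS[OF C(1,2)] by simp
    have dist: "distinct (L @ W)" using cyc_distinct[OF C(1)] .
    have finLW: "set L \<inter> set W = {}" using dist by auto
    have pL: "path E L" "path E W" using C by (auto simp: cyc_append)
    have int: "x \<in> R \<Longrightarrow> E u x \<Longrightarrow> u = last W" "x \<in> R \<Longrightarrow> E x u \<Longrightarrow> u = hd W" if uW: "u \<in> set W" for u x
    proof -
      obtain W1 W2 where W: "W = W1 @ u # W2" using split_list[OF uW] by blast
      show "u = last W" if "x \<in> R" "E u x"
      proof (rule ccontr)
        assume "u \<noteq> last W"
        then have "W2 \<noteq> []" using W by auto
        then have "good (L @ W1 @ [u]) W2" using C W that xy by (auto simp: good_def)
        from min[OF this] show False using W by simp
      qed
      show "u = hd W" if "x \<in> R" "E x u"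
      proof (rule ccontr)
        assume "u \<noteq> hd W"
        then have "W1 \<noteq> []" using W by auto
        moreover have "cyc E ((u # W2 @ L) @ W1)" using cyc_swap[of E "L @ W1" "u # W2"] C(1) W by simp
        ultimately have "good (u # W2 @ L) W1" using C W that xy by (auto simp: good_def)
        from min[OF this] show False using W by simp
      qed
    qed
    obtain qs where qs: "cyc E qs" "set qs = R" "hd qs = x0" using cycR(1)[OF xy(1)] by blast
    obtain Q where Q: "path E Q" "set Q \<subseteq> R" "hd Q = x0" "last Q = y0" using F0[OF qs xy(3)] by blast
    have "set Q \<inter> set (L @ W) = {}" using Q(2) C(2) by auto
    then have "(\<exists>u\<in>set W. deg E u S + 2 \<le> m + length W) \<or> (\<forall>u\<in>set W. no_insert E u L \<and> deg E u S + 1 \<le> m + length W)"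
      using gap_deg[OF C(1) _ C(3,4) Q(1) _ _ _ m2] lenm C(2) Q(3,4) xy by simp
    moreover have "hd W \<in> set W" using C(4) by simp
    ultimately obtain u where u: "u \<in> set W" "deg E u S + 1 \<le> m + length W"
      by (cases "\<exists>u\<in>set W. deg E u S + 2 \<le> m + length W") (force, blast)
    have uS: "u \<in> S" using u(1) C(2) by auto
    have outW: "card {v \<in> R. E v u} \<le> 1"
      using F1a(1)[OF swap xy(1) _ ] C(3,4) xy(2) int(2)[OF u(1)] by (intro card_le_1) auto
    have inW: "card {v \<in> R. E u v} \<le> 1"
      using F1b[OF C(1,2) _ _ _ _ xy(3)] C(3,4) xy(4) int(1)[OF u(1)] by (intro card_le_1) auto
    have degu: "deg E u R = card {v \<in> R. E u v} + card {v \<in> R. E v u}" by (rule deg_card) simp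
    \<comment> \<open>With |R| - 1 for \<open>r\<close> on \<open>R\<close> and m + |W| - 1 for
      \<open>u\<close> on \<open>S\<close>, the remaining two terms must sum to at least |L| + |R|,
      that is, to more than |L| + 2.\<close>
    have ore_u: "False" if r: "r \<in> R" "narcs E r u = 0" "deg E r S + deg E u R \<le> length L + 2" for r
    proof -
      have "2 * card V \<le> deg E r V + deg E u V + 2" using ore[of r u] r uS S_sub by auto
      then show False using bridged_deg_R[OF m2 br r(1)] r(3) u(2) lenm card_R deg_SR[of r] deg_SR[of u] m3
        by linarith
    qed
    show False
    proof (cases "tl W = []")
      case True
      then have W: "W = [u]" using u(1) by (cases W) auto
      have x0y0: "x = y" if "x \<in> R" "E (last L) x" "y \<in> R" "E y (hd L)" for x y
        using F2[of u L] swap W that by simp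
      define v where "v = x0"
      have v: "v \<in> R" "E (last L) v" "E v (hd L)" using xy x0y0 by (auto simp: v_def)
      have nvu: "\<not> E v u" using F1a(2)[OF swap v(1) _ v(1)] W v C(3) by auto
      have nuv: "\<not> E u v" using F1a(2)[OF C(1,2) v(1) _ v(1)] W v C(3) by auto
      have degv: "deg E v S = deg E v (set L)"
        using deg_Un[of "set L" "set W" E v] finLW C(2) deg_insert[of "{}" u E v] nvu nuv W by (simp add: narcs_0_iff)
      have vL: "deg E v (set L) \<le> length L + 1"
        by (rule no_insert_deg_Suc[OF R_no_insert[OF m2 v(1) C(1,2)] pL(1)])
      show False
      proof (cases "{x \<in> R. E x u} = {}")
        case True
        have "card {x \<in> R. E x u} = 0" unfolding True by simp
        then have "deg E v S + deg E u R \<le> length L + 2" using inW degu degv vL by linarith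
        then show False using ore_u[OF v(1)] nvu nuv by (simp add: narcs_0_iff)
      next
        case False
        then obtain y where y: "y \<in> R" "E y u" by blast
        obtain Q where Q: "path E Q" "set Q = R" "hd Q = v" "last Q = y"
          using F1a(3)[OF swap v(1) _ y(1)] W v(2) y(2) C(3) y by auto
        have Q0: "Q \<noteq> []" using Q(1) by auto
        have vy: "v \<noteq> y" using nvu y by auto
        \<comment> \<open>Since \<open>u\<close> may now have two arcs to \<open>R\<close>, the
          count for \<open>v\<close> on \<open>L\<close> must drop to |L|. The loss occurs at the
          end of \<open>L\<close>: \<open>v\<close> does not dominate \<open>last L\<close>, and the
          vertex before it does not dominate \<open>v\<close>.\<close>
        have nvl: "\<not> E v (last L)"
        proof
          assume "E v (last L)"
          moreover have "path E (Q @ (W @ L))" using Q Q0 swap W y(2) by (subst path_append) (auto simp: cyc_def)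
          moreover have "set (Q @ (W @ L)) = V" using Q(2) swap(2) VV by auto
          ultimately show False using no_bypass[of "Q @ (W @ L)"] Q0 Q(3) C(3) by simp
        qed
        define c where "c = last L"
        define L0 where "L0 = butlast L"
        have L: "L = L0 @ [c]" using C(3) by (simp add: c_def L0_def)
        have "L0 \<noteq> []" using v(3) nvl C(3) L by auto
        have nlv: "\<not> E (last L0) v"
        proof
          assume "E (last L0) v"
          moreover have "cyc E (c # (W @ L0))" "set (c # (W @ L0)) = S"
            using cyc_swap[of E L0 "[c] @ W"] C(1,2) L by auto
          ultimately show False using F2[of c "W @ L0" v y] v(1) y vy W \<open>L0 \<noteq> []\<close> by auto
        qed
        have "no_insert E v L0" "path E L0" using R_no_insert[OF m2 v(1) C(1,2)] pL(1) L \<open>L0 \<noteq> []\<close>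
          by (auto simp: no_insert_append path_append)
        then have "deg E v (set L0) \<le> length L0"
          using no_insert_deg[of E v L0] nlv by (auto simp: of_bool_def split: if_splits)
        moreover have "deg E v (set L) = narcs E v c + deg E v (set L0)"
          using deg_insert[of "set L0" c E v] dist L by simp
        moreover have "narcs E v c \<le> 1" using nvl by (simp add: narcs_def c_def)
        ultimately have "deg E v (set L) \<le> length L" using L by simp
        then have "deg E v S + deg E u R \<le> length L + 2" using inW outW degu degv by linarith
        then show False using ore_u[OF v(1)] nvu nuv by (simp add: narcs_0_iff)
      qed
    next
      case False
      then have hl: "hd W \<noteq> last W" using dist C(4) by (cases W) auto
      have uR: "deg E u R \<le> 1"
      proof -
        have "{v \<in> R. E v u} = {} \<or> {v \<in> R. E u v} = {}"
        proof (cases "u = hd W")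
          case True
          then have "{v \<in> R. E u v} = {}" using int(1)[OF u(1)] hl by auto
          then show ?thesis ..
        next
          case False
          then have "{v \<in> R. E v u} = {}" using int(2)[OF u(1)] by auto
          then show ?thesis ..
        qed
        then have "card {v \<in> R. E v u} = 0 \<or> card {v \<in> R. E u v} = 0" by (metis card.empty)
        then show ?thesis using inW outW degu by linarith
      qed
      have "v = v'" if "v \<in> R" "E v (hd W)" "v' \<in> R" "E v' (hd W)" for v v'
        using F1a(1)[OF swap xy(1) _ that(1) _ that(3)] that xy(2) C(3,4) by simp
      then obtain p where p: "\<And>v. v \<in> R \<Longrightarrow> E v (hd W) \<Longrightarrow> v = p"
        by (cases "\<exists>v\<in>R. E v (hd W)") blast+
      have "v = v'" if "v \<in> R" "E (last W) v" "v' \<in> R" "E (last W) v'" for v v'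
        using F1b[OF C(1,2) that(1) _ that(3) _ xy(3)] that xy(4) C(3,4) by simp
      then obtain q where q: "\<And>v. v \<in> R \<Longrightarrow> E (last W) v \<Longrightarrow> v = q"
        by (cases "\<exists>v\<in>R. E (last W) v") blast+
      \<comment> \<open>From \<open>R\<close> one enters \<open>W\<close> only at
        \<open>hd W\<close> and only from \<open>p\<close>; one leaves \<open>W\<close> only at
        \<open>last W\<close> and only to \<open>q\<close> (either is arbitrary if there is no such
        arc). A third vertex of \<open>R\<close> is non-adjacent to all of \<open>W\<close>.\<close>
      obtain r where r: "r \<in> R" "r \<noteq> p" "r \<noteq> q"
      proof -
        have "\<not> R \<subseteq> {p, q}"
        proof
          assume "R \<subseteq> {p, q}"
          then have "card R \<le> card {p, q}" by (intro card_mono) auto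
          also have "\<dots> \<le> 2" by (simp add: card_insert_if)
          finally show False using card_R m3 by simp
        qed
        then show thesis using that by blast
      qed
      have rW: "narcs E r z = 0" if "z \<in> set W" for z
        using int[OF that r(1)] p[OF r(1)] q[OF r(1)] r by (auto simp: narcs_0_iff)
      have "deg E r S = deg E r (set L)"
        using deg_Un[of "set L" "set W" E r] finLW C(2) deg_eq_0[of "set W" E r] rW by simp
      then show False
        using ore_u[OF r(1) rW[OF u(1)]] uR no_insert_deg_Suc[OF R_no_insert[OF m2 r(1) C(1,2)] pL(1)] by linarith
    qed
  qed
qed

end

section \<open>Bridges through exactly two outside vertices\<close>

lemma rotate_last_eq:
  assumes "distinct xs" "ys = rotate k xs" "last ys = last xs"
  shows "ys = xs"
proof (cases "xs = [] \<or> k mod length xs = 0")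
  case True
  then show ?thesis using assms(2) by (auto simp: rotate_drop_take)
next
  case False
  define A where "A = take (k mod length xs) xs"
  define B where "B = drop (k mod length xs) xs"
  have xs: "xs = A @ B" "ys = B @ A" using assms(2) by (simp_all add: A_def B_def rotate_drop_take)
  have "A \<noteq> []" using False by (auto simp: A_def)
  moreover have "B \<noteq> []"
  proof -
    have "xs \<noteq> []" using False by auto
    then have "k mod length xs < length xs" by simp
    then show ?thesis by (simp add: B_def)
  qed
  ultimately have "last A = last B" using assms(3) xs by simp
  then have "last A \<in> set A \<inter> set B" using \<open>A \<noteq> []\<close> \<open>B \<noteq> []\<close> last_in_set[of A] last_in_set[of B] by auto
  then show ?thesis using assms(1) xs by auto
qed

lemma rotate_swap: "A @ B = rotate k xs \<Longrightarrow> \<exists>j. B @ A = rotate j xs"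
  by (metis rotate_append rotate_rotate)

lemma cyc_rotate: "cyc E xs \<Longrightarrow> cyc E (rotate k xs)"
  using cyc_swap[of E "take (k mod length xs) xs" "drop (k mod length xs) xs"] by (simp add: rotate_drop_take)

context max_cyc
begin

lemma cyc_length_S: "cyc E xs \<Longrightarrow> set xs = S \<Longrightarrow> length xs = m"
  using cyc_length card_S by metis

text \<open>The three patterns belong to appending \<open>s\<close>, \<open>t\<close> to the open
  cycle, to prefixing them, and to replacing \<open>p\<close> by them. The first two give a bypass,
  the third a cycle of length m + 1, one short of Hamiltonian.\<close>

lemma two_insert_rules:
  assumes n: "card V = m + 2" and st: "R = {s, t}" "s \<noteq> t" "E s t" and xs: "cyc E xs" "set xs = S"
  shows "\<not> (E (last xs) s \<and> E (hd xs) t)" "\<not> (E s (last xs) \<and> E t (hd xs))"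
    "xs = p # ys \<Longrightarrow> \<not> (E (last ys) s \<and> E t (hd ys))"
proof -
  have V: "S \<union> {s, t} = V" "s \<notin> S" "t \<notin> S" using S_sub st by auto
  have ne: "xs \<noteq> []" "path E xs" using xs by (auto simp: cyc_def)
  show "\<not> (E (last xs) s \<and> E (hd xs) t)"
    using no_bypass[of "xs @ [s, t]"] V xs(2) ne st by (auto simp: path_append path_Cons)
  show "\<not> (E s (last xs) \<and> E t (hd xs))"
    using no_bypass[of "s # t # xs"] V xs(2) ne st by (auto simp: path_Cons)
  show "\<not> (E (last ys) s \<and> E t (hd ys))" if "xs = p # ys"
  proof
    assume *: "E (last ys) s \<and> E t (hd ys)"
    have ys: "ys \<noteq> []" "length ys + 1 = m" using cyc_length_S[OF xs] m_ge_2 that by auto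
    then have "path E ys" using ne that by (auto simp: path_Cons)
    then have "cyc E (ys @ [s, t])"
      using * V xs(2) st ys that by (subst cyc_append) (auto simp: path_Cons)
    then show False using no_long'[of "ys @ [s, t]"] ys n by simp
  qed
qed

text \<open>Otherwise \<open>s\<close> alone bridges some gap; take a shortest one. At
  \<open>a = last xs\<close> the count for \<open>s\<close> on \<open>L\<close> loses one:
  \<open>s\<close> does not dominate \<open>a\<close>, and the vertex before \<open>a\<close> does
  not dominate \<open>s\<close>. So \<open>s\<close> has degree at most |L| + 1, and some gap
  vertex, non-adjacent to \<open>s\<close>, violates the degree condition.\<close>

lemma two_no_out:
  assumes n: "card V = m + 2" and st: "R = {s, t}" "s \<noteq> t" "E s t" and xs: "cyc E xs" "set xs = S"
    and br: "E (last xs) s" "E t (hd xs)" and c: "c \<in> S"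
  shows "\<not> E s c"
proof
  assume sc: "E s c"
  have m2: "m + 2 \<le> card V" using n by simp
  have sR: "s \<in> R" "t \<in> R" using st by auto
  have nts: "\<not> E t s"
    using bridged_R(1)[OF m2 bridgedI[OF xs, of "[s, t]"] sR] st br by (auto simp: path_Cons narcs_def)
  define good where "good L W \<longleftrightarrow> (\<exists>k. L @ W = rotate k xs) \<and> L \<noteq> [] \<and> E (last L) s \<and> E s (hd L)" for L W
  have "\<exists>L W. good L W"
  proof -
    obtain A B where AB: "xs = A @ c # B" using split_list[of c xs] xs(2) c by blast
    have "last (c # B) = last xs" using AB by simp
    moreover have "\<exists>k. (c # B) @ A = rotate k xs" using AB rotate_append[of A "c # B"] by metis
    ultimately show ?thesis using br sc by (intro exI[of _ "c # B"] exI[of _ A]) (auto simp: good_def)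
  qed
  then obtain L W where LW: "good L W" "\<And>L' W'. good L' W' \<Longrightarrow> length W \<le> length W'"
    using least_length_snd[of good] by blast
  obtain k where k: "L @ W = rotate k xs" using LW(1) by (auto simp: good_def)
  have L: "L \<noteq> []" "E (last L) s" "E s (hd L)" using LW(1) by (auto simp: good_def)
  have C: "cyc E (L @ W)" "set (L @ W) = S" using cyc_rotate[OF xs(1), of k] xs(2) k by auto
  have W0: "W \<noteq> []" using R_no_insert_ends[OF m2 sR(1) C] L by auto
  have sW: "narcs E s u = 0" if uW: "u \<in> set W" for u
  proof -
    obtain W1 W2 where W: "W = W1 @ u # W2" using split_list[OF uW] by blast
    have "\<not> E u s"
    proof
      assume "E u s"
      then have "good (L @ W1 @ [u]) W2" using k L W by (auto simp: good_def)
      from LW(2)[OF this] show False using W by simp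
    qed
    moreover have "\<not> E s u"
    proof
      assume "E s u"
      moreover have "\<exists>j. (u # W2 @ L) @ W1 = rotate j xs"
        using rotate_swap[of "L @ W1" "u # W2" k xs] k W by simp
      ultimately have "good (u # W2 @ L) W1" using L by (auto simp: good_def)
      from LW(2)[OF this] show False using W by simp
    qed
    ultimately show ?thesis by (simp add: narcs_0_iff)
  qed
  define a where "a = last xs"
  have "xs \<noteq> []" using xs(1) by (auto simp: cyc_def)
  then have "a \<in> S" using xs(2) by (auto simp: a_def)
  then have "a \<in> set L" using sW[of a] br(1) C(2) by (auto simp: narcs_0_iff a_def)
  then obtain A B where AB: "L = A @ a # B" by (meson split_list)
  have nsa: "\<not> E s a" using two_insert_rules(2)[OF n st xs] br(2) by (simp add: a_def)
  then have A0: "A \<noteq> []" using L(3) AB by auto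
  have nAs: "\<not> E (last A) s"
  proof -
    obtain j where j: "(B @ W) @ (A @ [a]) = rotate j xs"
      using rotate_swap[of "A @ [a]" "B @ W" k xs] k AB by auto
    have eq: "(B @ W) @ (A @ [a]) = xs"
      by (rule rotate_last_eq[OF cyc_distinct[OF xs(1)] j]) (simp add: a_def)
    have "hd (B @ W @ A) = hd xs" using W0 by (subst eq[symmetric]) (cases B; simp)
    moreover have "cyc E (a # (B @ W @ A))" "set (a # (B @ W @ A)) = S"
      using cyc_swap[of E A "[a] @ B @ W"] C AB by auto
    moreover have "last (B @ W @ A) = last A" using A0 by simp
    ultimately show ?thesis using two_insert_rules(3)[OF n st, of "a # (B @ W @ A)" a "B @ W @ A"] br(2) by auto
  qed
  have pL: "path E L" using C W0 L by (auto simp: cyc_append)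
  have "deg E s (set L) \<le> length L"
    using no_insert_deg_split[of E s A "a # B"] R_no_insert[OF m2 sR(1) C] pL AB A0 nsa nAs by auto
  moreover have "deg E s S = deg E s (set L)"
  proof -
    have "set L \<inter> set W = {}" using cyc_distinct[OF C(1)] by auto
    then show ?thesis using deg_Un[of "set L" "set W" E s] C(2) deg_eq_0[of "set W" E s] sW by simp
  qed
  moreover have "deg E s R = 1"
    unfolding st(1) using st(2,3) nts by (simp add: deg_insert narcs_def)
  ultimately have degs: "deg E s V \<le> length L + 1" using deg_SR[of s] by simp
  have lenm: "length L + length W = m" using cyc_length_S[OF C] by simp
  have degu: "2 * m + 1 \<le> deg E u S + narcs E u t + length L" if u: "u \<in> set W" for u
  proof -
    have "u \<in> S" using u C(2) by auto
    then have "2 * card V \<le> deg E s V + deg E u V + 2"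
      using ore[of s u] sW[OF u] sR S_sub by auto
    moreover have "deg E u R = narcs E u t"
      unfolding st(1) using st(2) sW[OF u] by (simp add: deg_insert narcs_sym[of E u s])
    ultimately show ?thesis using degs n deg_SR[of u] by linarith
  qed
  have "(\<exists>u\<in>set W. deg E u S + 2 \<le> m + length W) \<or> (\<forall>u\<in>set W. no_insert E u L \<and> deg E u S + 1 \<le> m + length W)"
  proof -
    have "path E [s]" "set [s] \<inter> set (L @ W) = {}" using sR C(2) by (auto simp: path_Cons)
    then show ?thesis using gap_deg[OF C(1) _ L(1) W0, of "[s]"] lenm C(2) L(2,3) m2 by simp
  qed
  then show False
  proof
    assume "\<exists>u\<in>set W. deg E u S + 2 \<le> m + length W"
    then obtain u where "u \<in> set W" "deg E u S + 2 \<le> m + length W" by blast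
    then show False using degu[of u] narcs_le_2[of E u t] lenm by simp
  next
    assume *: "\<forall>u\<in>set W. no_insert E u L \<and> deg E u S + 1 \<le> m + length W"
    have hW: "hd W \<in> set W" using W0 by simp
    have "\<not> E (hd W) t"
      using two_insert_rules(1)[OF n st, of "W @ L"] cyc_swap[OF C(1)] C(2) L W0 by auto
    then have "narcs E (hd W) t \<le> 1" by (simp add: narcs_def)
    then show False using degu[OF hW] * hW lenm by fastforce
  qed
qed

lemma two_no_in:
  assumes n: "card V = m + 2" and st: "R = {s, t}" "s \<noteq> t" "E s t" and xs: "cyc E xs" "set xs = S"
    and br: "E (last xs) s" "E t (hd xs)" and c: "c \<in> S"
  shows "\<not> E c t"
proof -
  interpret c: max_cyc V "E\<inverse>\<inverse>" m S by (rule conv_m)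
  have "xs \<noteq> []" using xs(1) by (auto simp: cyc_def)
  then show ?thesis
    using c.two_no_out[OF n _ _ _ _ _ _ _ c, of t s "rev xs"] st xs br by (auto simp: insert_commute hd_rev last_rev)
qed

text \<open>Arcs between \<open>s\<close> and \<open>S\<close> only enter \<open>s\<close>, those
  between \<open>t\<close> and \<open>S\<close> only leave \<open>t\<close>. A vertex
  \<open>u\<close> of a shortest nonempty gap is compared with \<open>s\<close> or, if
  \<open>u\<close> dominates \<open>s\<close>, with \<open>t\<close>. If \<open>u\<close> is
  adjacent to the other of the two, removing an end of \<open>L\<close> from the cycle shows that a
  possible neighbour is missing, which makes up for the extra arc.\<close>

lemma not_bridged_2:
  assumes n: "card V = m + 2"
  shows "\<not> bridged"
proof
  assume brd: bridged
  have m2: "m + 2 \<le> card V" using n by simp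
  obtain xs P where P: "cyc E xs" "set xs = S" "path E P" "set P = R" "E (last xs) (hd P)" "E (last P) (hd xs)"
    using bridged_path[OF m2 brd] by metis
  have "length P = 2" using path_length[OF P(3)] P(4) card_R n by simp
  then obtain s t where "P = [s, t]" by (auto simp: length_Suc_conv numeral_2_eq_2)
  then have st: "R = {s, t}" "s \<noteq> t" "E s t" and br: "E (last xs) s" "E t (hd xs)"
    using P by (auto simp: path_Cons)
  note xs = P(1,2)
  have sR: "s \<in> R" "t \<in> R" using st by auto
  have nts: "\<not> E t s" using bridged_R(1)[OF m2 brd sR] st by (auto simp: narcs_def)
  note rules = two_insert_rules[OF n st]
  have no: "\<not> E s c" "\<not> E c t" if "c \<in> S" for c
    using two_no_out[OF n st xs br that] two_no_in[OF n st xs br that] by auto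
  have degS: "deg E s V = 1 + card {c \<in> S. E c s}" "deg E t V = 1 + card {c \<in> S. E t c}"
  proof -
    have "{c \<in> S. E s c} = {}" "{c \<in> S. E c t} = {}" using no by auto
    then have "card {c \<in> S. E s c} = 0" "card {c \<in> S. E c t} = 0" by (metis card.empty)+
    moreover have "deg E s R = 1" "deg E t R = 1"
      unfolding st(1) using st(2,3) nts by (simp_all add: deg_insert narcs_def)
    ultimately show "deg E s V = 1 + card {c \<in> S. E c s}" "deg E t V = 1 + card {c \<in> S. E t c}"
      using deg_SR[of s] deg_SR[of t] deg_card[of S E s] deg_card[of S E t] by auto
  qed
  have degR: "deg E u R = narcs E u s + narcs E u t" for u
    unfolding st(1) using st(2) by (simp add: deg_insert)
  define good where "good L W \<longleftrightarrow> cyc E (L @ W) \<and> set (L @ W) = S \<and> L \<noteq> [] \<and> W \<noteq> [] \<and> E (last L) s \<and> E t (hd L)" for L W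
  have xs0: "xs \<noteq> []" using xs(1) by (auto simp: cyc_def)
  show False
  proof (cases "\<exists>L W. good L W")
    case False
    have I: "c = last xs" if "c \<in> S" "E c s" for c
    proof (rule ccontr)
      assume "c \<noteq> last xs"
      then obtain L W where "cyc E (L @ W)" "set (L @ W) = S" "L \<noteq> []" "W \<noteq> []" "hd L = hd xs" "last L = c"
        using cyc_gap_last[of E xs c] xs \<open>c \<in> S\<close> by auto
      then have "good L W" unfolding good_def using br(2) that(2) by auto
      then show False using False by blast
    qed
    define e where "e = hd xs"
    have e: "e \<in> S" "e \<noteq> last xs"
      using xs xs0 irrefl[of e] by (auto simp: e_def cyc_def)
    have "\<not> E e s" using I[OF e(1)] e(2) by auto
    then have es: "narcs E e s = 0" "narcs E e t \<le> 1" using no[OF e(1)] by (auto simp: narcs_def)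
    have "card {c \<in> S. E c s} \<le> 1" using I by (intro card_le_1) blast
    moreover have "deg E e S + 2 \<le> 2 * m" using deg_in_le[of S e] e(1) card_S by simp
    moreover have "2 * card V \<le> deg E e V + deg E s V + 2" using ore[of e s] es(1) e sR S_sub by auto
    ultimately show False using degS(1) n deg_SR[of e] degR[of e] es by linarith
  next
    case True
    then obtain L W where LW: "good L W" "\<And>L' W'. good L' W' \<Longrightarrow> length W \<le> length W'"
      using least_length_snd[of good] by blast
    have C: "cyc E (L @ W)" "set (L @ W) = S" "L \<noteq> []" "W \<noteq> []" "E (last L) s" "E t (hd L)"
      using LW(1) by (auto simp: good_def)
    have swap: "cyc E (W @ L)" "set (W @ L) = S" using cyc_swap[OF C(1)] C(2) by auto
    have lenm: "length L + length W = m" using cyc_length_S[OF C(1,2)] by simp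
    have dist: "distinct (L @ W)" using cyc_distinct[OF C(1)] .
    have int: "E u s \<Longrightarrow> u = last W" "E t u \<Longrightarrow> u = hd W" if uW: "u \<in> set W" for u
    proof -
      obtain W1 W2 where W: "W = W1 @ u # W2" using split_list[OF uW] by blast
      show "u = last W" if "E u s"
      proof (rule ccontr)
        assume "u \<noteq> last W"
        then have "W2 \<noteq> []" using W by auto
        then have "good (L @ W1 @ [u]) W2" using C W that by (auto simp: good_def)
        from LW(2)[OF this] show False using W by simp
      qed
      show "u = hd W" if "E t u"
      proof (rule ccontr)
        assume "u \<noteq> hd W"
        then have "W1 \<noteq> []" using W by auto
        moreover have "cyc E ((u # W2 @ L) @ W1)" using cyc_swap[of E "L @ W1" "u # W2"] C(1) W by simp
        ultimately have "good (u # W2 @ L) W1" using C W that by (auto simp: good_def)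
        from LW(2)[OF this] show False using W by simp
      qed
    qed
    have "(\<exists>u\<in>set W. deg E u S + 2 \<le> m + length W) \<or> (\<forall>u\<in>set W. no_insert E u L \<and> deg E u S + 1 \<le> m + length W)"
    proof -
      have "path E [s, t]" "set [s, t] \<inter> set (L @ W) = {}" using sR C(2) st by (auto simp: path_Cons)
      then show ?thesis using gap_deg[OF C(1) _ C(3,4), of "[s, t]"] lenm C(2,5,6) m2 by simp
    qed
    moreover have hlW: "hd W \<in> set W" "last W \<in> set W" using C(4) by simp_all
    ultimately obtain u where u: "u \<in> set W" "deg E u S + 1 \<le> m + length W"
      by (cases "\<exists>u\<in>set W. deg E u S + 2 \<le> m + length W") (force, blast)
    have uS: "u \<in> S" using u(1) C(2) by auto
    have cardL: "card (set L) = length L" using dist by (simp add: distinct_card)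
    have ins: "card (insert w (set L)) \<le> length L + 1" for w using cardL card_insert_le_m1 by (simp add: card_insert_if)
    have I_sub: "{c \<in> S. E c s} \<subseteq> insert (last W) (set L)" using int(1) C(2) by auto
    have O_sub: "{c \<in> S. E t c} \<subseteq> insert (hd W) (set L)" using int(2) C(2) by auto
    show False
    proof (cases "E u s")
      case False
      then have us: "narcs E u s = 0" using no[OF uS] by (simp add: narcs_def)
      have ore_us: "2 * card V \<le> deg E u V + deg E s V + 2" using ore[of u s] us uS sR S_sub by auto
      show False
      proof (cases "E t u")
        case False
        then have "narcs E u t = 0" using no[OF uS] by (simp add: narcs_def)
        moreover have "card {c \<in> S. E c s} \<le> length L + 1"
          using card_mono[OF _ I_sub] ins[of "last W"] by simp
        ultimately show False using ore_us degS(1) degR[of u] deg_SR[of u] us u(2) lenm n by linarith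
      next
        case True
        then have uh: "u = hd W" using int(2)[OF u(1)] by simp
        have ut: "narcs E u t = 1" using True no[OF uS] by (simp add: narcs_def)
        have "\<exists>c \<in> insert (last W) (set L). \<not> E c s"
        proof (cases "butlast L = []")
          case True
          then obtain a where "L = [a]" using C(3) append_butlast_last_id[of L] by (metis append_Nil)
          then have "\<not> E (last W) s"
            using rules(3)[of "a # W" a W] C \<open>E t u\<close> uh by auto
          then show ?thesis by blast
        next
          case False
          define L0 where "L0 = butlast L" define a where "a = last L"
          have L: "L = L0 @ [a]" using C(3) by (simp add: L0_def a_def)
          have "cyc E (a # (W @ L0))" "set (a # (W @ L0)) = S"
            using cyc_swap[of E L0 "[a] @ W"] C(1,2) L by auto
          then have "\<not> E (last L0) s" using rules(3)[of "a # (W @ L0)" a "W @ L0"] \<open>E t u\<close> uh C(4) False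
            by (auto simp: L0_def)
          moreover have "last L0 \<in> set L"
            using in_set_butlastD[of "last L0" L] last_in_set[of L0] False by (simp add: L0_def)
          ultimately show ?thesis by blast
        qed
        then obtain c where c: "c \<in> insert (last W) (set L)" "\<not> E c s" by blast
        then have "{c \<in> S. E c s} \<subset> insert (last W) (set L)" using I_sub by auto
        then have "card {c \<in> S. E c s} < card (insert (last W) (set L))" by (intro psubset_card_mono) auto
        then show False using ins[of "last W"] ore_us degS(1) degR[of u] deg_SR[of u] us ut u(2) lenm n by linarith
      qed
    next
      case True
      then have ul: "u = last W" using int(1)[OF u(1)] by simp
      have us: "narcs E u s = 1" using True no[OF uS] by (simp add: narcs_def)
      have "u \<noteq> hd W"
      proof
        assume "u = hd W"
        then have "last W \<notin> set (tl W)" using ul dist C(4) by (cases W) auto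
        then have "tl W = []" using last_tl[of W] last_in_set[of "tl W"] by metis
        then have "W = [u]" using C(4) ul by (cases W) auto
        then show False using rules(3)[of "u # L" u L] swap C by auto
      qed
      then have ut: "narcs E u t = 0" using int(2)[OF u(1)] no[OF uS] by (auto simp: narcs_0_iff)
      have "\<exists>c \<in> insert (hd W) (set L). \<not> E t c"
      proof (cases "tl L = []")
        case True
        then obtain a where "L = [a]" using C(3) by (cases L) auto
        then have "\<not> E t (hd W)"
          using rules(3)[of "a # W" a W] C \<open>E u s\<close> ul by auto
        then show ?thesis by blast
      next
        case False
        then obtain a L0 where L: "L = a # L0" "L0 \<noteq> []" using C(3) by (cases L) auto
        then have "\<not> E t (hd L0)" using rules(3)[of "a # (L0 @ W)" a "L0 @ W"] C(1,2,4) \<open>E u s\<close> ul by auto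
        moreover have "hd L0 \<in> set L" using L by simp
        ultimately show ?thesis by blast
      qed
      then obtain c where c: "c \<in> insert (hd W) (set L)" "\<not> E t c" by blast
      then have "{c \<in> S. E t c} \<subset> insert (hd W) (set L)" using O_sub by auto
      then have "card {c \<in> S. E t c} < card (insert (hd W) (set L))" by (intro psubset_card_mono) auto
      moreover have "2 * card V \<le> deg E u V + deg E t V + 2" using ore[of u t] ut uS sR S_sub by auto
      ultimately show False using ins[of "hd W"] degS(2) degR[of u] deg_SR[of u] us ut u(2) lenm n by linarith
    qed
  qed
qed

lemma cut_vertex_exists:
  assumes "m + 2 \<le> card V"
  obtains r x where "r \<in> R" "x \<in> S" "S \<inter> (Rin r \<union> Rout r) \<subseteq> {x}"
proof -
  have "\<not> bridged"
  proof (cases "card V = m + 2")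
    case True
    then show ?thesis by (rule not_bridged_2)
  next
    case False
    then show ?thesis using assms not_bridged_ge3 by simp
  qed
  then show thesis using no_separated_cycle[OF assms] that by blast
qed

end

section \<open>Cycles missing one vertex\<close>

lemma successively_not_both_count:
  assumes "successively (\<lambda>a b. \<not> (P a \<and> P b)) xs" "xs \<noteq> []"
  shows "2 * length (filter P xs) + 1 \<le> length xs + of_bool (P (hd xs)) + of_bool (P (last xs))"
  using assms
proof (induction xs)
  case (Cons x xs)
  show ?case
  proof (cases "xs = []")
    case False
    then have "\<not> (P x \<and> P (hd xs))" using Cons.prems by (simp add: successively_Cons)
    then have "of_bool (P x) + of_bool (P (hd xs)) \<le> (1::nat)" by auto
    moreover have "2 * length (filter P xs) + 1 \<le> length xs + of_bool (P (hd xs)) + of_bool (P (last xs))"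
      using Cons False by (simp add: successively_Cons)
    moreover have "length (filter P (x # xs)) = of_bool (P x) + length (filter P xs)" by simp
    moreover have last: "last (x # xs) = last xs" using False by simp
    ultimately show ?thesis unfolding last list.sel(1) list.size(4) by linarith
  qed simp
qed simp

lemma successively_alternating_eq:
  fixes P Q :: "'a \<Rightarrow> bool"
  assumes "successively (\<lambda>a b. P a \<noteq> P b) xs" "successively (\<lambda>a b. Q a \<noteq> Q b) xs"
    "xs \<noteq> [] \<Longrightarrow> P (hd xs) = Q (hd xs)" "a \<in> set xs"
  shows "P a = Q a"
  using assms
proof (induction xs)
  case (Cons x xs)
  show ?case
  proof (cases "a = x")
    case False
    then have "xs \<noteq> []" using Cons.prems by auto
    then have "P x \<noteq> P (hd xs)" "Q x \<noteq> Q (hd xs)" "P x = Q x" using Cons.prems by (simp_all add: successively_Cons)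
    then have "P (hd xs) = Q (hd xs)" by (cases "P x") auto
    then show ?thesis using Cons False by (auto simp: successively_Cons)
  qed (use Cons.prems in auto)
qed simp

lemma successivelyI:
  assumes "\<And>A B. xs = A @ B \<Longrightarrow> A \<noteq> [] \<Longrightarrow> B \<noteq> [] \<Longrightarrow> P (last A) (hd B)"
  shows "successively P xs"
  using assms
proof (induction xs)
  case (Cons x xs)
  have "P (last A) (hd B)" if "xs = A @ B" "A \<noteq> []" "B \<noteq> []" for A B
    using Cons.prems[of "x # A" B] that by simp
  then have "successively P xs" by (rule Cons.IH)
  then show ?case using Cons.prems[of "[x]" xs] by (cases "xs = []") (auto simp: successively_Cons)
qed simp

text \<open>Rotation turns any consecutive pair into the closing pair of another cycle on the same
  vertices.\<close>

lemma cyc_successively: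
  assumes "cyc E xs" "\<And>ys. cyc E ys \<Longrightarrow> set ys = set xs \<Longrightarrow> P (last ys) (hd ys)"
  shows "successively P xs"
proof (rule successivelyI)
  fix A B assume "xs = A @ B" "A \<noteq> []" "B \<noteq> []"
  then show "P (last A) (hd B)" using assms(2)[of "B @ A"] cyc_swap[of E A B] assms(1) by auto
qed

lemma card_filter: "distinct xs \<Longrightarrow> card {c \<in> set xs. P c} = length (filter P xs)"
  using distinct_card[of "filter P xs"] by simp

lemma insertion_ex:
  assumes L: "path E L" "finite Z" "Z \<noteq> {}" "set L \<inter> Z = {}"
  shows "\<exists>P. path E P \<and> hd P = hd L \<and> last P = last L \<and> set L \<subseteq> set P \<and> set P \<subset> set L \<union> Z \<and>
    ((\<forall>u\<in>Z - set P. no_insert E u P) \<or>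
     (\<exists>z P'. Z - set P = {z} \<and> path E P' \<and> hd P' = hd L \<and> last P' = last L \<and> set P' = set L \<union> Z))"
proof (rule insertion[OF L], goal_cases)
  case (1 P)
  then show ?case by (intro exI[of _ P] conjI)
qed

lemma cyc_hd_ex: "cyc E xs \<Longrightarrow> x \<in> set xs \<Longrightarrow> \<exists>ys. cyc E (x # ys) \<and> set (x # ys) = set xs"
  by (rule cyc_hd_at) blast+

context ore_graph
begin

lemma not_out_both:
  assumes "cyc E xs" "set xs = V - {y}" "y \<in> V"
  shows "\<not> (E y (hd xs) \<and> E y (last xs))"
proof
  assume "E y (hd xs) \<and> E y (last xs)"
  moreover have "xs \<noteq> []" "path E xs" using assms(1) by (auto simp: cyc_def)
  ultimately show False using no_bypass[of "y # xs"] assms by (auto simp: path_Cons)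
qed

lemma not_in_both:
  assumes "cyc E xs" "set xs = V - {y}" "y \<in> V"
  shows "\<not> (E (hd xs) y \<and> E (last xs) y)"
proof
  assume "E (hd xs) y \<and> E (last xs) y"
  moreover have "xs \<noteq> []" "path E xs" using assms(1) by (auto simp: cyc_def)
  ultimately show False using no_bypass[of "xs @ [y]"] assms by (auto simp: path_Cons path_append)
qed

lemma successively_out:
  assumes "cyc E xs" "set xs = V - {y}" "y \<in> V"
  shows "successively (\<lambda>a b. \<not> (E y a \<and> E y b)) xs"
  using cyc_successively[OF assms(1)] not_out_both assms(2,3) by (metis (mono_tags, lifting))

lemma successively_in:
  assumes "cyc E xs" "set xs = V - {y}" "y \<in> V"
  shows "successively (\<lambda>a b. \<not> (E a y \<and> E b y)) xs"
  using cyc_successively[OF assms(1)] not_in_both assms(2,3) by (metis (mono_tags, lifting))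

lemma deg_outside:
  assumes "y \<in> V"
  shows "deg E y V = card {c \<in> V - {y}. E y c} + card {c \<in> V - {y}. E c y}"
  using deg_remove[OF finV assms, of E y] deg_card[of "V - {y}" E y] finV by simp

text \<open>Two consecutive vertices are never both out-neighbours or both in-neighbours of
  \<open>y\<close>, so each kind fills at most half of the \<open>card V - 1\<close> places. The
  versions with \<open>hd\<close> and \<open>last\<close> keep the end terms, from which equality is
  read off.\<close>

lemma half_counts:
  assumes "cyc E xs" "set xs = V - {y}" "y \<in> V"
  shows "2 * card {c \<in> V - {y}. E y c} + 1 \<le> card V"
    "2 * card {c \<in> V - {y}. E c y} + 1 \<le> card V"
    "2 * card {c \<in> V - {y}. E y c} + 2 \<le> card V + of_bool (E y (hd xs)) + of_bool (E y (last xs))"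
    "2 * card {c \<in> V - {y}. E c y} + 2 \<le> card V + of_bool (E (hd xs) y) + of_bool (E (last xs) y)"
proof -
  have "length xs = card (V - {y})" using cyc_length[OF assms(1)] unfolding assms(2) .
  then have xs: "xs \<noteq> []" "distinct xs" "length xs + 1 = card V"
    using assms(1) cyc_distinct[OF assms(1)] card_Suc_Diff1[OF finV assms(3)] by (auto simp: cyc_def)
  have c: "card {c \<in> V - {y}. E y c} = length (filter (E y) xs)"
    "card {c \<in> V - {y}. E c y} = length (filter (\<lambda>c. E c y) xs)"
    using card_filter[OF xs(2), of "E y"] card_filter[OF xs(2), of "\<lambda>c. E c y"] assms(2) by simp_all
  have f: "2 * length (filter (E y) xs) + 1 \<le> length xs + of_bool (E y (hd xs)) + of_bool (E y (last xs))"
    "2 * length (filter (\<lambda>c. E c y) xs) + 1 \<le> length xs + of_bool (E (hd xs) y) + of_bool (E (last xs) y)"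
    using successively_not_both_count[OF successively_out[OF assms] xs(1)]
      successively_not_both_count[OF successively_in[OF assms] xs(1)] .
  show 1: "2 * card {c \<in> V - {y}. E y c} + 2 \<le> card V + of_bool (E y (hd xs)) + of_bool (E y (last xs))"
    using f(1) unfolding c xs(3)[symmetric] by linarith
  show 2: "2 * card {c \<in> V - {y}. E c y} + 2 \<le> card V + of_bool (E (hd xs) y) + of_bool (E (last xs) y)"
    using f(2) unfolding c xs(3)[symmetric] by linarith
  have "of_bool (E y (hd xs)) + of_bool (E y (last xs)) \<le> (1::nat)" "of_bool (E (hd xs) y) + of_bool (E (last xs) y) \<le> (1::nat)"
    using not_out_both[OF assms] not_in_both[OF assms] by auto
  then show "2 * card {c \<in> V - {y}. E y c} + 1 \<le> card V" "2 * card {c \<in> V - {y}. E c y} + 1 \<le> card V"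
    using 1 2 by linarith+
qed

lemma deg_outside_le:
  assumes "cyc E xs" "set xs = V - {y}" "y \<in> V"
  shows "deg E y V + 1 \<le> card V"
  using half_counts(1,2)[OF assms] deg_outside[OF assms(3)] by linarith

lemma alternating:
  assumes "cyc E xs" "set xs = V - {y}" "y \<in> V" "card V \<le> deg E y V + 1"
  shows "E y (last xs) \<longleftrightarrow> \<not> E y (hd xs)" "E (last xs) y \<longleftrightarrow> \<not> E (hd xs) y"
    "2 * card {c \<in> V - {y}. E y c} + 1 = card V"
proof -
  show "2 * card {c \<in> V - {y}. E y c} + 1 = card V"
    using half_counts(1,2)[OF assms(1-3)] deg_outside[OF assms(3)] assms(4) by linarith
  have "2 * card {c \<in> V - {y}. E c y} + 1 = card V"
    using half_counts(1,2)[OF assms(1-3)] deg_outside[OF assms(3)] assms(4) by linarith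
  then have "1 \<le> of_bool (E y (hd xs)) + (of_bool (E y (last xs)) :: nat)"
    "1 \<le> of_bool (E (hd xs) y) + (of_bool (E (last xs) y) :: nat)"
    using half_counts(3,4)[OF assms(1-3)] \<open>2 * card {c \<in> V - {y}. E y c} + 1 = card V\<close> by linarith+
  then show "E y (last xs) \<longleftrightarrow> \<not> E y (hd xs)" "E (last xs) y \<longleftrightarrow> \<not> E (hd xs) y"
    using not_out_both[OF assms(1-3)] not_in_both[OF assms(1-3)] by (auto simp: of_bool_def split: if_splits)
qed

lemma successively_alternating:
  assumes "cyc E xs" "set xs = V - {y}" "y \<in> V" "card V \<le> deg E y V + 1"
  shows "successively (\<lambda>a b. E y a \<noteq> E y b) xs" "successively (\<lambda>a b. E a y \<noteq> E b y) xs"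
  using cyc_successively[OF assms(1), of "\<lambda>a b. E y a \<noteq> E y b"]
    cyc_successively[OF assms(1), of "\<lambda>a b. E a y \<noteq> E b y"] alternating assms(2-4) by (metis (mono_tags, lifting))+

lemma deg_in_count:
  assumes "distinct K" "K \<noteq> []" "successively (\<lambda>a b. \<not> (E a y \<and> E b y)) K" "{c \<in> V - {y}. E c y} = {c \<in> set K. E c y}"
  shows "2 * card {c \<in> V - {y}. E c y} \<le> length K + 1"
proof -
  have "2 * length (filter (\<lambda>c. E c y) K) + 1 \<le> length K + of_bool (E (hd K) y) + of_bool (E (last K) y)"
    using assms(2,3) by (intro successively_not_both_count)
  also have "\<dots> \<le> length K + 2" by simp
  finally show ?thesis unfolding assms(4) card_filter[OF assms(1), of "\<lambda>c. E c y"] by simp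
qed

lemma deg_out_count:
  assumes "distinct K" "K \<noteq> []" "successively (\<lambda>a b. \<not> (E y a \<and> E y b)) K" "{c \<in> V - {y}. E y c} = {c \<in> set K. E y c}"
  shows "2 * card {c \<in> V - {y}. E y c} \<le> length K + 1"
proof -
  have "2 * length (filter (E y) K) + 1 \<le> length K + of_bool (E y (hd K)) + of_bool (E y (last K))"
    using assms(2,3) by (intro successively_not_both_count)
  also have "\<dots> \<le> length K + 2" by simp
  finally show ?thesis unfolding assms(4) card_filter[OF assms(1), of "E y"] by simp
qed

lemma cyc_missing_card:
  assumes "cyc E xs" "set xs = V - {y}" "y \<in> V"
  shows "V = insert y (set xs)" "y \<notin> set xs" "length xs + 1 = card V"
proof -
  show "V = insert y (set xs)" "y \<notin> set xs" using assms by auto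
  have "length xs = card (V - {y})" using cyc_length[OF assms(1)] unfolding assms(2) .
  then show "length xs + 1 = card V" using card_Suc_Diff1[OF finV assms(3)] by simp
qed

text \<open>This is type \<open>D_0\<close> without division: the equation for \<open>card A\<close>
  already makes the order odd.\<close>

definition split_independent :: bool where
  "split_independent \<longleftrightarrow> (\<exists>A. A \<subseteq> V \<and> 2 * card A = card V + 1 \<and> (\<forall>a\<in>A. \<forall>b\<in>A. \<not> E a b) \<and>
     (\<forall>a\<in>A. \<forall>b\<in>V - A. E a b \<and> E b a))"

text \<open>Equality makes the in- and the out-neighbours of \<open>y\<close> alternate, in phase
  since both patterns start with a non-neighbour at \<open>z\<close>. Exchanging \<open>y\<close>
  with a non-neighbour \<open>v\<close> gives a cycle missing \<open>v\<close>; by the degree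
  condition \<open>v\<close> is tight too, and its pattern agrees with that of \<open>y\<close>. So
  all vertices outside \<open>B\<close> have the same neighbourhood \<open>B\<close>.\<close>

lemma split_independentI:
  assumes xs: "cyc E xs" "set xs = V - {y}" "y \<in> V" and d: "card V \<le> deg E y V + 1"
    and z: "z \<in> V" "z \<noteq> y" "narcs E y z = 0"
  shows split_independent
proof -
  define B where "B = {b \<in> V - {y}. E y b}"
  have sym: "E y a \<longleftrightarrow> E a y" if a: "a \<in> V" "a \<noteq> y" for a
  proof -
    obtain zs where zs: "cyc E (z # zs)" "set (z # zs) = set xs" using cyc_hd_ex[OF xs(1), of z] xs(2) z by auto
    have "E y a = (\<lambda>a. E a y) a"
      by (rule successively_alternating_eq[of "E y" "z # zs" "\<lambda>a. E a y"])
        (use successively_alternating[OF zs(1) _ xs(3) d] zs xs(2) z a in \<open>auto simp: narcs_0_iff\<close>)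
    then show ?thesis .
  qed
  have same: "(E v a \<longleftrightarrow> E y a) \<and> (E a v \<longleftrightarrow> E a y)"
    if v: "v \<in> V" "v \<noteq> y" "\<not> E y v" and a: "a \<in> V" "a \<noteq> y" "a \<noteq> v" for v a
  proof -
    have vy: "narcs E y v = 0" using v sym[OF v(1,2)] by (simp add: narcs_0_iff)
    have "v \<in> set xs" using xs(2) v by auto
    from cyc_hd_ex[OF xs(1) this, unfolded xs(2)]
    obtain zs where zs: "cyc E (v # zs)" "set (v # zs) = V - {y}" by blast
    have "a \<in> set (v # zs)" unfolding zs(2) using a by simp
    then have azs: "a \<in> set zs" using a(3) by simp
    then have zs0: "zs \<noteq> []" by auto
    have n: "\<not> E y v" "\<not> E v y" using vy by (auto simp: narcs_0_iff)
    note al = successively_alternating[OF zs(1,2) xs(3) d]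
    have "E y (hd zs)" "E (hd zs) y" using al n zs0 by (auto simp: successively_Cons)
    moreover have "E (last zs) y" "E y (last zs)"
      using alternating(1,2)[OF zs(1,2) xs(3) d] n zs0 by auto
    ultimately have yz: "E y (hd zs)" "E (last zs) y" by blast+
    have "v \<notin> set zs" using cyc_distinct[OF zs(1)] by simp
    then have "set zs = V - {y} - {v}" unfolding zs(2)[symmetric] by simp
    then have sy: "set (y # zs) = V - {v}" using v xs(3) by auto
    have "y \<notin> set zs" using \<open>set zs = _\<close> by simp
    then have cy: "cyc E (y # zs)" using zs(1) zs0 yz by (simp add: cyc_def path_Cons)
    have "card V \<le> deg E v V + 1"
      using ore[of y v] vy v xs(3) deg_outside_le[OF xs(1-3)] by simp
    note av = successively_alternating[OF cy sy v(1) this]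
    have hd': "E v (hd zs)" "E (hd zs) v" using av n zs0 by (auto simp: successively_Cons)
    have "E v a = E y a"
      by (rule successively_alternating_eq[of "E v" zs "E y"])
        (use al av hd' \<open>E y (hd zs)\<close> azs in \<open>auto simp: successively_Cons\<close>)
    moreover have "(\<lambda>a. E a v) a = (\<lambda>a. E a y) a"
      by (rule successively_alternating_eq[of _ zs])
        (use al av hd' \<open>E (hd zs) y\<close> azs in \<open>auto simp: successively_Cons\<close>)
    ultimately show ?thesis by simp
  qed
  have cB: "2 * card B + 1 = card V" using alternating(3)[OF xs d] by (simp add: B_def)
  show ?thesis
    unfolding split_independent_def
  proof (intro exI[of _ "V - B"] conjI ballI)
    show "2 * card (V - B) = card V + 1"
      using cB card_Diff_subset[of B V] finV card_mono[of V B] by (auto simp: B_def)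
    show "\<not> E a b" if a: "a \<in> V - B" and b: "b \<in> V - B" for a b
    proof (cases "a = y \<or> b = y \<or> a = b")
      case True
      then show ?thesis using that sym[of a] by (auto simp: B_def)
    next
      case False
      then show ?thesis using same[of a b] a b by (auto simp: B_def)
    qed
    have ab: "E a b \<and> E b a" if a: "a \<in> V - B" and b: "b \<in> B" for a b
    proof (cases "a = y")
      case True
      then show ?thesis using b sym[of b] by (auto simp: B_def)
    next
      case False
      then show ?thesis using same[of a b] a b sym[of b] by (auto simp: B_def)
    qed
    show "E a b" "E b a" if "a \<in> V - B" "b \<in> V - (V - B)" for a b using ab[of a b] that by auto
  qed auto
qed

text \<open>A vertex missed by a cycle has degree at most card V - 1, and at most card V - 2 if it
  has a non-neighbour and \<open>D_0\<close> is excluded. Two such degrees do not reach 2 * card V -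
  2.\<close>

lemma missed_adjacent:
  assumes "\<not> split_independent" "cyc E xs" "set xs = V - {y}" "y \<in> V" "cyc E zs" "set zs = V - {z}" "z \<in> V"
    and "z \<noteq> y"
  shows "narcs E y z \<noteq> 0"
proof
  assume yz: "narcs E y z = 0"
  have "deg E y V + 2 \<le> card V"
    using split_independentI[OF assms(2-4) _ assms(7,8) yz] assms(1) by fastforce
  moreover have "deg E z V + 2 \<le> card V"
    using split_independentI[OF assms(5-7) _ assms(4) assms(8)[symmetric]] yz assms(1) by (fastforce simp: narcs_sym)
  ultimately show False using ore[of y z] yz assms(4,7,8) by auto
qed

section \<open>Gaps consisting of non-neighbours of the missed vertex\<close>

lemma not_inserted_degree:
  assumes P: "path E P" and V: "V = insert y (set P \<union> W)" "y \<notin> set P \<union> W" "set P \<inter> W = {}"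
    and u: "u \<in> W" "narcs E y u = 0" "no_insert E u P"
  shows "length P + card W + 1 = card V" "2 * card V \<le> deg E y V + (length P + 1) + deg E u W + 2"
proof -
  have fin: "finite W" using V(1) finV finite_subset[of W V] by auto
  show "length P + card W + 1 = card V"
    using card_Un_disjoint[OF _ fin V(3)] card_insert_disjoint[OF _ V(2)] fin V(1) path_length[OF P] by simp
  have "y \<in> V" "u \<in> V" "u \<noteq> y" using V(1,2) u(1) by auto
  then have "2 * card V \<le> deg E y V + deg E u V + 2" using ore[of y u] u(2) by auto
  moreover have "deg E u V = narcs E u y + (deg E u (set P) + deg E u W)"
    using deg_insert[OF _ V(2), of E u] deg_Un[OF _ fin V(3), of E u] fin V(1) by simp
  ultimately show "2 * card V \<le> deg E y V + (length P + 1) + deg E u W + 2"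
    using no_insert_deg_Suc[OF u(3) P] u(2) by (simp add: narcs_sym[of E u y])
qed

text \<open>\<open>Z\<close> is inserted into \<open>L\<close> as far as possible. If all of it
  fits, the resulting path closes with \<open>y\<close> to a cycle missing \<open>p\<close>, whose
  consecutive vertices \<open>last L\<close> and \<open>y\<close> both dominate \<open>p\<close>.
  Otherwise the count is tight, nothing was inserted, and \<open>hd Z\<close> dominates
  \<open>p\<close>, reversing an arc of the Hamiltonian cycle through \<open>L\<close>,
  \<open>y\<close>, \<open>p\<close>, \<open>Z\<close>.\<close>

lemma no_gap_out:
  assumes c: "cyc E (L @ p # Z)" "set (L @ p # Z) = V - {y}" and y: "y \<in> V"
    and LZ: "L \<noteq> []" "Z \<noteq> []" "E (last L) y" "E y (hd L)" "E y p" "\<not> E p y"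
    and Z: "\<And>z. z \<in> set Z \<Longrightarrow> narcs E y z = 0"
  shows False
proof -
  have dist: "distinct (L @ p # Z)" using cyc_distinct[OF c(1)] .
  have yn: "y \<notin> set L" "y \<noteq> p" "y \<notin> set Z" using c(2) by auto
  have len: "length L + 1 + length Z + 1 = card V" using cyc_missing_card(3)[OF c y] by simp
  have pL: "path E L" "E (last L) p" "E p (hd Z)" using c(1) LZ by (auto simp: cyc_append path_Cons)
  \<comment> \<open>Twice the number of out-neighbours is at most |L| + 2, since they lie in
    \<open>L\<close> and \<open>p\<close>; twice the number of in-neighbours is at most |L| + 1.
    Rounding the sum down gives |L| + 1.\<close>
  have degy: "deg E y V \<le> length L + 1"
  proof -
    have V': "V - {y} = insert p (set L \<union> set Z)" unfolding c(2)[symmetric] by auto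
    have no: "\<And>z. z \<in> set Z \<Longrightarrow> \<not> E y z" "\<And>z. z \<in> set Z \<Longrightarrow> \<not> E z y" using Z by (auto simp: narcs_0_iff)
    have "2 * card {c \<in> V - {y}. E y c} \<le> length (L @ [p]) + 1"
    proof (rule deg_out_count)
      show "successively (\<lambda>a b. \<not> (E y a \<and> E y b)) (L @ [p])"
        using successively_out[OF c y] by (auto simp: successively_append_iff)
      show "{c \<in> V - {y}. E y c} = {c \<in> set (L @ [p]). E y c}" unfolding V' using no LZ by auto
    qed (use dist in auto)
    moreover have "2 * card {c \<in> V - {y}. E c y} \<le> length L + 1"
    proof (rule deg_in_count)
      show "successively (\<lambda>a b. \<not> (E a y \<and> E b y)) L"
        using successively_in[OF c y] by (auto simp: successively_append_iff)
      show "{c \<in> V - {y}. E c y} = {c \<in> set L. E c y}" unfolding V' using no LZ by auto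
    qed (use dist LZ in auto)
    ultimately show ?thesis using deg_outside[OF y] by simp
  qed
  obtain P where P: "path E P" "hd P = hd L" "last P = last L" "set L \<subseteq> set P" "set P \<subset> set L \<union> set Z"
    and alt: "(\<forall>u\<in>set Z - set P. no_insert E u P) \<or>
     (\<exists>z P'. set Z - set P = {z} \<and> path E P' \<and> hd P' = hd L \<and> last P' = last L \<and> set P' = set L \<union> set Z)"
  proof -
    have "set Z \<noteq> {}" "set L \<inter> set Z = {}" using LZ(2) dist by auto
    from insertion_ex[OF pL(1) List.finite_set this] show thesis using that by blast
  qed
  from alt show False
  proof
    assume ni: "\<forall>u\<in>set Z - set P. no_insert E u P"
    define Z' where "Z' = set Z - set P"
    have Z'0: "Z' \<noteq> {}" using P(4,5) by (auto simp: Z'_def)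
    have W': "V = insert y (set P \<union> insert p Z')" "y \<notin> set P \<union> insert p Z'" "set P \<inter> insert p Z' = {}" "p \<notin> Z'"
      using P(4,5) c(2) yn dist y by (auto simp: Z'_def)
    have finZ: "finite Z'" by (simp add: Z'_def)
    have cW: "card (insert p Z') = card Z' + 1" using W'(4) finZ by simp
    have key: "card V + card Z' \<le> length L + 2 + deg E u (insert p Z') \<and> deg E u (insert p Z') \<le> 2 * card Z'" if u: "u \<in> Z'" for u
    proof -
      have "u \<in> insert p Z'" "narcs E y u = 0" "no_insert E u P" using Z ni u by (auto simp: Z'_def)
      from not_inserted_degree[OF P(1) W'(1-3) this] deg_in_le[OF _ this(1)] show ?thesis
        using degy cW finZ by simp
    qed
    have "card Z' \<le> length Z" using card_mono[of "set Z" Z'] card_length[of Z] by (auto simp: Z'_def)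
    moreover obtain u where "u \<in> Z'" using Z'0 by auto
    ultimately have "card Z' = length Z" using key[of u] len by linarith
    then have "Z' = set Z" using card_subset_eq[of "set Z" Z'] distinct_card[of Z] dist by (auto simp: Z'_def)
    then have hZ: "hd Z \<in> Z'" using LZ(2) by simp
    have "2 * card Z' \<le> deg E (hd Z) (insert p Z')" using key[OF hZ] len \<open>card Z' = length Z\<close> by linarith
    moreover have "deg E (hd Z) (insert p Z') = deg E (hd Z) (insert p Z' - {hd Z})"
      using deg_remove[of "insert p Z'" "hd Z" E "hd Z"] hZ by (simp add: Z'_def)
    moreover have "card (insert p Z' - {hd Z}) = card Z'"
      using hZ W'(4) by (simp add: Z'_def card_Diff_singleton)
    ultimately have "narcs E (hd Z) p = 2"
      using deg_complete[of "insert p Z' - {hd Z}" E "hd Z" p] hZ W'(4) by (auto simp: Z'_def)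
    then have "E (hd Z) p" by (simp add: narcs_2_iff)
    moreover have "cyc E ((L @ [y, p]) @ Z)"
      using c(1) LZ yn by (auto simp: cyc_append path_append path_Cons)
    ultimately show False using ham_not_rev[of "L @ [y, p]" Z] c(2) y LZ(2) by auto
  next
    assume "\<exists>z P'. set Z - set P = {z} \<and> path E P' \<and> hd P' = hd L \<and> last P' = last L \<and> set P' = set L \<union> set Z"
    then obtain P' where P': "path E P'" "hd P' = hd L" "last P' = last L" "set P' = set L \<union> set Z" by blast
    have "insert y (V - {y}) = V" using y by blast
    then have Veq: "V = insert y (set L \<union> insert p (set Z))" unfolding c(2)[symmetric] by simp
    have "P' \<noteq> []" using P'(1) by auto
    then have "cyc E (y # P')" using P' LZ yn by (auto simp: cyc_def path_Cons)
    moreover have "set (y # P') = V - {p}" unfolding Veq using P'(4) yn dist by auto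
    moreover have "p \<in> V" unfolding Veq by simp
    ultimately show False using not_in_both[of "y # P'" p] LZ(5) pL(2) P'(3) \<open>P' \<noteq> []\<close> by simp
  qed
qed

lemma no_gap_in:
  assumes c: "cyc E (L @ Z @ [q])" "set (L @ Z @ [q]) = V - {y}" and y: "y \<in> V"
    and LZ: "L \<noteq> []" "Z \<noteq> []" "E (last L) y" "E y (hd L)" "E q y" "\<not> E y q"
    and Z: "\<And>z. z \<in> set Z \<Longrightarrow> narcs E y z = 0"
  shows False
proof -
  interpret c: ore_graph V "E\<inverse>\<inverse>" by (rule conv)
  have "cyc E\<inverse>\<inverse> ((q # rev Z) @ rev L)" using c(1) cyc_rev[of "E\<inverse>\<inverse>" "L @ Z @ [q]"] by simp
  then have 1: "cyc E\<inverse>\<inverse> (rev L @ q # rev Z)" by (rule cyc_swap)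
  have 2: "set (rev L @ q # rev Z) = V - {y}" using c(2) by auto
  show False
    by (rule c.no_gap_out[OF 1 2 y]) (use LZ Z in \<open>auto simp: hd_rev last_rev\<close>)
qed

end

lemma deg_le_single:
  assumes "finite A" "X \<subseteq> A" "\<And>x. x \<in> X \<Longrightarrow> narcs E u x \<le> 1" "u \<in> A" "u \<notin> X" "narcs E u u = 0"
  shows "deg E u A + card X + 2 \<le> 2 * card A"
proof -
  have fin: "finite X" "finite (A - {u} - X)" using assms finite_subset by auto
  have A: "A - {u} = X \<union> (A - {u} - X)" using assms by auto
  have "deg E u A = deg E u (A - {u})" using deg_remove[of A u E u] assms by simp
  also have "\<dots> = deg E u X + deg E u (A - {u} - X)"
    by (subst A) (rule deg_Un, use fin in auto)
  also have "\<dots> \<le> card X + 2 * card (A - {u} - X)"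
    using deg_le_card[OF fin(1)] assms(3) deg_le[OF fin(2)] by (intro add_mono) auto
  finally have 1: "deg E u A \<le> card X + 2 * card (A - {u} - X)" .
  have "card (A - {u}) = card X + card (A - {u} - X)"
    by (subst A) (rule card_Un_disjoint, use fin in auto)
  moreover have "card (A - {u}) + 1 = card A" using assms card_Suc_Diff1[of A u] by simp
  ultimately show ?thesis using 1 by linarith
qed

context ore_graph
begin

text \<open>\<open>p\<close> and \<open>q\<close> are non-adjacent and cannot be inserted into
  \<open>P\<close>, so each has degree at most |P| + 2. Since card V = |P| + 3 this is tight. Hence
  \<open>p\<close> dominates \<open>hd P\<close>, the cycle \<open>p\<close>, \<open>P\<close>,
  \<open>y\<close> misses \<open>q\<close>, and the required alternation fails at its ends, as
  neither \<open>p\<close> nor \<open>y\<close> dominates \<open>q\<close>.\<close>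

lemma no_two_ended_path:
  assumes P: "path E P" and V: "V = insert y (insert p (insert q (set P)))"
    and dist: "y \<notin> set P" "p \<notin> set P" "q \<notin> set P" "y \<noteq> p" "y \<noteq> q" "p \<noteq> q"
    and arcs: "E (last P) y" "E y (hd P)" "E (last P) p" "E y p" "E q y" "E q (hd P)" "\<not> E p y" "\<not> E y q"
    and npq: "\<not> E p q"
  shows False
proof -
  have P0: "P \<noteq> []" using P by auto
  have cardV: "card V = length P + 3"
    unfolding V using dist path_length[OF P] by simp
  have nqp: "\<not> E q p"
  proof
    assume "E q p"
    moreover have "path E (q # P @ [y, p])" using P dist arcs P0 by (auto simp: path_Cons path_append)
    ultimately show False using no_bypass[of "q # P @ [y, p]"] unfolding V by auto
  qed
  have "no_insert E p P"
  proof (rule ccontr)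
    assume "\<not> ?thesis"
    then obtain A B where AB: "P = A @ B" "A \<noteq> []" "B \<noteq> []" "E (last A) p" "E p (hd B)" using not_no_insertD by metis
    then have "cyc E ((A @ p # B) @ [y])" using P dist arcs by (subst cyc_append) (auto simp: path_append path_Cons)
    moreover have "set ((A @ p # B) @ [y]) = V - {q}" unfolding V using dist AB by auto
    ultimately show False using not_out_both[of "(A @ p # B) @ [y]" q] arcs AB unfolding V by auto
  qed
  have "no_insert E q P"
  proof (rule ccontr)
    assume "\<not> ?thesis"
    then obtain A B where AB: "P = A @ B" "A \<noteq> []" "B \<noteq> []" "E (last A) q" "E q (hd B)" using not_no_insertD by metis
    then have "cyc E ([y] @ (A @ q # B))" using P dist arcs by (subst cyc_append) (auto simp: path_append path_Cons)
    moreover have "set ([y] @ (A @ q # B)) = V - {p}" unfolding V using dist AB by auto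
    ultimately show False using not_in_both[of "[y] @ (A @ q # B)" p] arcs AB unfolding V by auto
  qed
  have dp: "deg E p V = narcs E p y + deg E p (set P)" and dq: "deg E q V = narcs E q y + deg E q (set P)"
    unfolding V using dist npq nqp by (simp_all add: deg_insert narcs_def)
  have py: "narcs E p y = 1" "narcs E q y = 1" using arcs by (auto simp: narcs_def)
  have le: "deg E p (set P) \<le> length P + 1" "deg E q (set P) \<le> length P + 1"
    using no_insert_deg_Suc[OF \<open>no_insert E p P\<close> P] no_insert_deg_Suc[OF \<open>no_insert E q P\<close> P] .
  have o: "2 * card V \<le> deg E p V + deg E q V + 2"
    using ore[of p q] npq nqp dist by (auto simp: V narcs_0_iff)
  have "length P + 1 \<le> deg E p (set P)" using o dp dq py le cardV by linarith
  then have "E p (hd P)" using no_insert_deg_eqD[OF \<open>no_insert E p P\<close> P] by blast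
  then have c: "cyc E ([p] @ P @ [y])" using P dist arcs P0 by (subst cyc_append) (auto simp: path_append path_Cons)
  moreover have "set ([p] @ P @ [y]) = V - {q}" unfolding V using dist by auto
  moreover have "card V \<le> deg E q V + 1" using o dp dq py le cardV by linarith
  ultimately show False using alternating(2)[of "[p] @ P @ [y]" q] arcs npq unfolding V
    by auto
qed

text \<open>The degree of \<open>y\<close> may now be |L| + 2, one more than for a gap with one
  extra vertex, so more has to be saved at \<open>u\<close>. Both neighbours of \<open>u\<close> on
  the Hamiltonian cycle through \<open>L\<close>, \<open>y\<close>, \<open>p\<close>,
  \<open>Z\<close>, \<open>q\<close> are joined to it by one arc only.\<close>

lemma no_gap_both:
  assumes ns: "\<not> split_independent"
    and c: "cyc E (L @ p # Z @ [q])" "set (L @ p # Z @ [q]) = V - {y}" and y: "y \<in> V"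
    and LZ: "L \<noteq> []" "Z \<noteq> []" "E (last L) y" "E y (hd L)" "E y p" "\<not> E p y" "E q y" "\<not> E y q"
    and Z: "\<And>z. z \<in> set Z \<Longrightarrow> narcs E y z = 0"
  shows False
proof -
  note miss = cyc_missing_card[OF c y]
  have dist: "distinct (L @ p # Z @ [q])" using cyc_distinct[OF c(1)] .
  have Veq: "V = insert y (insert p (insert q (set L \<union> set Z)))" using miss(1) by auto
  have yn: "y \<notin> set L" "y \<noteq> p" "y \<notin> set Z" "y \<noteq> q" using miss(2) by auto
  have pqn: "p \<notin> set L" "p \<notin> set Z" "q \<notin> set L" "q \<notin> set Z" "p \<noteq> q" "set L \<inter> set Z = {}" using dist by auto
  have len: "length L + length Z + 3 = card V" using miss(3) by simp
  have pL: "path E L" "E (last L) p" "E q (hd L)" using c(1) LZ by (auto simp: cyc_append path_Cons path_append)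
  have no: "\<And>z. z \<in> set Z \<Longrightarrow> \<not> E y z" "\<And>z. z \<in> set Z \<Longrightarrow> \<not> E z y" using Z by (auto simp: narcs_0_iff)
  have degy: "deg E y V \<le> length L + 2"
  proof -
    have V': "V - {y} = insert p (insert q (set L \<union> set Z))" unfolding Veq using yn by auto
    have "2 * card {c \<in> V - {y}. E y c} \<le> length (L @ [p]) + 1"
    proof (rule deg_out_count)
      show "successively (\<lambda>a b. \<not> (E y a \<and> E y b)) (L @ [p])"
        using successively_out[OF c y] by (auto simp: successively_append_iff)
      show "{c \<in> V - {y}. E y c} = {c \<in> set (L @ [p]). E y c}" unfolding V' using no LZ by auto
    qed (use dist in auto)
    moreover have "2 * card {c \<in> V - {y}. E c y} \<le> length (q # L) + 1"
    proof (rule deg_in_count)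
      have c': "cyc E ((p # Z) @ (q # L))" using cyc_swap[OF c(1)] by simp
      have "set ((p # Z) @ (q # L)) = V - {y}" unfolding V' by auto
      from successively_in[OF c' this y] show "successively (\<lambda>a b. \<not> (E a y \<and> E b y)) (q # L)"
        by (simp only: successively_append_iff)
      show "{c \<in> V - {y}. E c y} = {c \<in> set (q # L). E c y}" unfolding V' using no LZ by auto
    qed (use dist in auto)
    ultimately show ?thesis using deg_outside[OF y] by simp
  qed
  have "set Z \<noteq> {}" using LZ(2) by simp
  from insertion_ex[OF pL(1) List.finite_set this pqn(6)]
  obtain P where P: "path E P" "hd P = hd L" "last P = last L" "set L \<subseteq> set P" "set P \<subset> set L \<union> set Z"
    and alt: "(\<forall>u\<in>set Z - set P. no_insert E u P) \<or>
     (\<exists>z P'. set Z - set P = {z} \<and> path E P' \<and> hd P' = hd L \<and> last P' = last L \<and> set P' = set L \<union> set Z)"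
    by blast
  have P0: "P \<noteq> []" using P(1) by auto
  from alt show False
  proof
    assume ni: "\<forall>u\<in>set Z - set P. no_insert E u P"
    define Z' where "Z' = set Z - set P"
    define W where "W = insert p (insert q Z')"
    have Z'0: "Z' \<noteq> {}" using P(4,5) by (auto simp: Z'_def)
    have finZ: "finite Z'" "finite W" by (simp_all add: Z'_def W_def)
    have pq: "p \<notin> set P" "q \<notin> set P" "y \<notin> set P" using P(5) pqn yn by auto
    have VW: "V = insert y (set P \<union> W)" "y \<notin> set P \<union> W" "set P \<inter> W = {}"
      using P(4,5) Veq pq yn by (auto simp: Z'_def W_def)
    have cW: "card W = card Z' + 2" using pqn finZ by (simp add: W_def Z'_def)
    obtain u where u: "u \<in> Z'" using Z'0 by auto
    then have uZ: "u \<in> set Z" "u \<notin> set P" "u \<in> W" by (auto simp: Z'_def W_def)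
    obtain Z1 Z2 where Z12: "Z = Z1 @ u # Z2" using uZ by (meson split_list)
    define x where "x = last (p # Z1)"
    define x' where "x' = hd (Z2 @ [q])"
    have ham: "cyc E (L @ [y] @ p # Z @ [q])"
      using c(1) LZ yn by (auto simp: cyc_append path_append path_Cons)
    have hamV: "set (L @ [y] @ p # Z @ [q]) = V" unfolding Veq by auto
    have "\<not> E u x"
      using ham_not_rev[of "L @ [y] @ p # Z1" "u # Z2 @ [q]"] ham hamV Z12 by (auto simp: x_def)
    moreover have "\<not> E x' u"
      using ham_not_rev[of "L @ [y] @ p # Z1 @ [u]" "Z2 @ [q]"] ham hamV Z12 by (auto simp: x'_def)
    ultimately have mx: "narcs E u v \<le> 1" if "v \<in> {x, x'}" for v using that by (auto simp: narcs_def)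
    have xin: "x \<in> insert p (set Z1)" "x' \<in> insert q (set Z2)"
      by (auto simp: x_def x'_def) (cases Z2; simp)
    have "insert p (set Z1) \<inter> insert q (set Z2) = {}" "u \<notin> insert p (set Z1)" "u \<notin> insert q (set Z2)"
      using dist Z12 by auto
    then have xx: "x \<noteq> x'" "x \<noteq> u" "x' \<noteq> u" using xin by auto
    \<comment> \<open>Each of \<open>x\<close> and \<open>x'\<close> saves one unit: if it lies in
      \<open>W\<close>, an arc to \<open>u\<close> is missing there; if not, it was inserted and
      makes \<open>Z'\<close> smaller than \<open>Z\<close>.\<close>
    have sub: "{x, x'} - W \<subseteq> set Z - Z'" using xin Z12 by (auto simp: W_def)
    have "card ({x, x'} - W) \<le> card (set Z - Z')" using sub by (intro card_mono) auto
    also have "\<dots> + card Z' = length Z"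
      using card_Diff_subset[OF finZ(1), of "set Z"] card_mono[of "set Z" Z'] distinct_card[of Z] dist
      by (auto simp: Z'_def)
    finally have c1: "card ({x, x'} - W) + card Z' \<le> length Z" by simp
    have c2: "card ({x, x'} - W) + card ({x, x'} \<inter> W) = 2"
      using card_Int_Diff[of "{x, x'}" W] xx by simp
    have dW: "deg E u W + card ({x, x'} \<inter> W) + 2 \<le> 2 * card W"
      using deg_le_single[OF finZ(2), of "{x, x'} \<inter> W" E u] mx uZ xx by auto
    have "narcs E y u = 0" "no_insert E u P" using Z ni uZ by auto
    from not_inserted_degree[OF P(1) VW uZ(3) this] show False
      using degy c1 c2 dW cW len by linarith
  next
    assume "\<exists>z P'. set Z - set P = {z} \<and> path E P' \<and> hd P' = hd L \<and> last P' = last L \<and> set P' = set L \<union> set Z"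
    then obtain z P' where P': "set Z - set P = {z}" "path E P'" "hd P' = hd L" "last P' = last L" "set P' = set L \<union> set Z"
      by blast
    have z: "z \<in> set Z" "z \<notin> set P" using P'(1) by auto
    \<comment> \<open>With this arc, \<open>P\<close> followed by \<open>y\<close>,
      \<open>p\<close>, \<open>q\<close> would be a cycle missing exactly \<open>z\<close>, a
      non-neighbour of \<open>y\<close>, whereas missed vertices are adjacent.\<close>
    have "\<not> E p q"
    proof
      assume "E p q"
      moreover have pq: "p \<notin> set P" "q \<notin> set P" "y \<notin> set P" using P(5) pqn yn by auto
      ultimately have cz: "cyc E (P @ [y, p, q])"
        using P P0 LZ pL yn pqn by (subst cyc_append) (auto simp: path_Cons)
      have "set P = set L \<union> set Z - {z}" using P(4,5) P'(1) pqn(6) by auto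
      then have sz: "set (P @ [y, p, q]) = V - {z}" unfolding Veq using z yn pqn by auto
      have "z \<in> V" "z \<noteq> y" using z yn unfolding Veq by auto
      then show False using missed_adjacent[OF ns c y cz sz] Z[OF z(1)] by simp
    qed
    then show False
      by (intro no_two_ended_path[OF P'(2), of y p q]) (use P' Veq yn pqn LZ pL in auto)
  qed
qed

text \<open>No cycle may miss just a non-neighbour of \<open>y\<close>, so at least two vertices of
  \<open>Z\<close> remain uninserted. Equality then makes both neighbourhoods of \<open>y\<close> as
  large as possible on \<open>L\<close>: \<open>a\<close> belongs to both, \<open>b\<close> to
  neither, and \<open>y\<close> dominates \<open>hd K\<close>. So the cycle \<open>K\<close>,
  \<open>Z\<close>, \<open>a\<close>, \<open>y\<close> misses the non-neighbour
  \<open>b\<close>.\<close>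

lemma no_gap_zero:
  assumes ns: "\<not> split_independent"
    and c: "cyc E (L @ Z)" "set (L @ Z) = V - {y}" and y: "y \<in> V"
    and LZ: "Z \<noteq> []" "E (last L) y" "E y (hd L)" "L = a # b # K"
    and Z: "\<And>z. z \<in> set Z \<Longrightarrow> narcs E y z = 0"
  shows False
proof -
  note miss = cyc_missing_card[OF c y]
  have dist: "distinct (L @ Z)" using cyc_distinct[OF c(1)] .
  have disj: "set L \<inter> set Z = {}" using dist by auto
  have Veq: "V = insert y (set L \<union> set Z)" using miss(1) by auto
  have yn: "y \<notin> set L" "y \<notin> set Z" using miss(2) by auto
  have len: "length L + length Z + 1 = card V" using miss(3) by simp
  have L0: "L \<noteq> []" using LZ(4) by simp
  have pL: "path E L" using c(1) cyc_append[OF L0 LZ(1), of E] by blast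
  have no: "\<And>z. z \<in> set Z \<Longrightarrow> \<not> E y z" "\<And>z. z \<in> set Z \<Longrightarrow> \<not> E z y" using Z by (auto simp: narcs_0_iff)
  have V': "V - {y} = set L \<union> set Z" unfolding Veq using yn by auto
  have so: "successively (\<lambda>a b. \<not> (E y a \<and> E y b)) L" and si: "successively (\<lambda>a b. \<not> (E a y \<and> E b y)) L"
    using successively_out[OF c y] successively_in[OF c y] by (auto simp: successively_append_iff)
  have eo: "{c \<in> V - {y}. E y c} = {c \<in> set L. E y c}" and ei: "{c \<in> V - {y}. E c y} = {c \<in> set L. E c y}"
    unfolding V' using no by auto
  have "distinct L" using dist by simp
  have ho: "2 * card {c \<in> V - {y}. E y c} \<le> length L + 1" by (rule deg_out_count[OF \<open>distinct L\<close> L0 so eo])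
  have hi: "2 * card {c \<in> V - {y}. E c y} \<le> length L + 1" by (rule deg_in_count[OF \<open>distinct L\<close> L0 si ei])
  have missing: False if "cyc E zs" "set zs = V - {z}" "z \<in> set Z \<or> narcs E y z = 0 \<and> z \<noteq> y \<and> z \<in> V" for zs z
    using missed_adjacent[OF ns c y that(1,2)] that(3) Z[of z] yn Veq by (cases "z = y") auto
  have "set Z \<noteq> {}" using LZ(1) by simp
  from insertion_ex[OF pL(1) List.finite_set this disj]
  obtain P where P: "path E P" "hd P = hd L" "last P = last L" "set L \<subseteq> set P" "set P \<subset> set L \<union> set Z"
    and alt: "(\<forall>u\<in>set Z - set P. no_insert E u P) \<or>
     (\<exists>z P'. set Z - set P = {z} \<and> path E P' \<and> hd P' = hd L \<and> last P' = last L \<and> set P' = set L \<union> set Z)"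
    by blast
  have P0: "P \<noteq> []" using P(1) by auto
  have yP: "y \<notin> set P" using P(5) yn by auto
  have cP: "cyc E (P @ [y])" using P LZ P0 yP by (subst cyc_append) (auto simp: path_Cons)
  from alt show False
  proof
    assume "\<exists>z P'. set Z - set P = {z} \<and> path E P' \<and> hd P' = hd L \<and> last P' = last L \<and> set P' = set L \<union> set Z"
    then obtain z where z: "set Z - set P = {z}" by blast
    then have "set P = set L \<union> set Z - {z}" using P(4,5) disj by auto
    then have "set (P @ [y]) = V - {z}" unfolding Veq using z yn by auto
    then show False using missing[OF cP] z by auto
  next
    assume ni: "\<forall>u\<in>set Z - set P. no_insert E u P"
    define Z' where "Z' = set Z - set P"
    have Z'0: "Z' \<noteq> {}" using P(4,5) by (auto simp: Z'_def)
    have finZ: "finite Z'" by (simp add: Z'_def)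
    have VW: "V = insert y (set P \<union> Z')" "y \<notin> set P \<union> Z'" "set P \<inter> Z' = {}"
      using P(4,5) Veq yP yn by (auto simp: Z'_def)
    obtain u where u: "u \<in> Z'" using Z'0 by auto
    then have uZ: "u \<in> set Z" "u \<notin> set P" by (auto simp: Z'_def)
    have "narcs E y u = 0" "no_insert E u P" using Z ni uZ by auto
    note left = not_inserted_degree[OF P(1) VW u this]
    have "deg E u Z' + 2 \<le> 2 * card Z'" using deg_in_le[OF finZ u] .
    moreover have "card Z' \<le> length Z" using card_mono[of "set Z" Z'] card_length[of Z] by (auto simp: Z'_def)
    ultimately have "length L + 1 \<le> card {c \<in> V - {y}. E y c} + card {c \<in> V - {y}. E c y}"
      using left len deg_outside[OF y] by linarith
    then have eq: "2 * length (filter (E y) L) = length L + 1" "2 * length (filter (\<lambda>c. E c y) L) = length L + 1"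
      using ho hi card_filter[OF \<open>distinct L\<close>, of "E y"] card_filter[OF \<open>distinct L\<close>, of "\<lambda>c. E c y"]
      unfolding eo ei by linarith+
    have ya: "E y a" using LZ by simp
    have ay: "E a y"
    proof (rule ccontr)
      assume n: "\<not> E a y"
      have "2 * length (filter (\<lambda>c. E c y) L) + 1 \<le> length L + of_bool (E (hd L) y) + of_bool (E (last L) y)"
        using si L0 by (intro successively_not_both_count)
      then show False using eq(2) n LZ(4) by (auto simp: of_bool_def split: if_splits)
    qed
    have nb: "\<not> E y b" "\<not> E b y" using so si ya ay LZ(4) by auto
    have K0: "K \<noteq> []" using eq(1) ya nb LZ(4) by auto
    have "E y (hd K)"
    proof (rule ccontr)
      assume n: "\<not> E y (hd K)"
      have "2 * length (filter (E y) K) + 1 \<le> length K + of_bool (E y (hd K)) + of_bool (E y (last K))"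
        using so LZ(4) K0 by (intro successively_not_both_count) (auto simp: successively_Cons)
      then show False using eq(1) ya nb n LZ(4) by (auto simp: of_bool_def split: if_splits)
    qed
    have "cyc E ([b] @ (K @ Z @ [a]))" using cyc_swap[of E "[a]" "b # K @ Z"] c(1) LZ(4) by simp
    then have "path E (K @ Z @ [a])" using K0 by (subst (asm) cyc_append) auto
    then have "cyc E ((K @ Z @ [a]) @ [y])"
      using K0 ay \<open>E y (hd K)\<close> yn LZ(4) by (subst cyc_append) (auto simp: path_Cons)
    moreover have "set ((K @ Z @ [a]) @ [y]) = V - {b}" unfolding Veq LZ(4) using yn dist LZ(4) by auto
    moreover have "narcs E y b = 0" using nb by (simp add: narcs_0_iff)
    moreover have "b \<noteq> y" "b \<in> V" using yn(1) unfolding Veq LZ(4) by auto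
    ultimately show False using missing by blast
  qed
qed

text \<open>If no such gap exists, the neighbours of \<open>y\<close> reduce to two consecutive
  vertices, \<open>c0\<close> before \<open>y\<close> and \<open>c1\<close> after it. Then
  \<open>y\<close> has degree 2, the degree condition joins \<open>z\<close> both ways to everything
  but \<open>y\<close>, and one of these arcs reverses an arc of the Hamiltonian cycle obtained by
  inserting \<open>y\<close>.\<close>

lemma zero_gap_exists:
  assumes xs: "cyc E xs" "set xs = V - {y}" "y \<in> V" and z: "z \<in> V" "z \<noteq> y" "narcs E y z = 0"
  obtains L W z where "cyc E (L @ W)" "set (L @ W) = V - {y}" "L \<noteq> []" "E (last L) y" "E y (hd L)"
    "z \<in> set W" "narcs E y z = 0"
proof (rule ccontr)
  assume "\<not> thesis"
  then have H: "\<And>L W z. cyc E (L @ W) \<Longrightarrow> set (L @ W) = V - {y} \<Longrightarrow> L \<noteq> [] \<Longrightarrow> E (last L) y \<Longrightarrow> E y (hd L) \<Longrightarrow>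
    z \<in> set W \<Longrightarrow> narcs E y z = 0 \<Longrightarrow> False" using that by blast
  have "z \<in> set xs" using xs(2) z by auto
  from cyc_hd_ex[OF xs(1) this, unfolded xs(2)]
  obtain zs where zs: "cyc E (z # zs)" "set (z # zs) = V - {y}" by blast
  note miss = cyc_missing_card[OF zs xs(3)]
  have nz: "\<not> E y z" "\<not> E z y" using z(3) by (auto simp: narcs_0_iff)
  \<comment> \<open>A stretch from an out-neighbour to an in-neighbour would leave \<open>z\<close>
    in its gap. Counted from \<open>z\<close>, all in-neighbours of \<open>y\<close> precede all
    out-neighbours.\<close>
  have H1: False if "zs = A @ K @ B" "K \<noteq> []" "E (last K) y" "E y (hd K)" for A K B
    using H[of K "B @ z # A" z] cyc_swap[of E "z # A" "K @ B"] zs that z(3) by auto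
  have "\<exists>c\<in>set zs. E c y"
  proof -
    have "E\<^sup>*\<^sup>* z y" using strong z xs(3) by blast
    then obtain c where "E c y" using z(2) by (metis rtranclp.cases)
    then show ?thesis using arc[of c y] nz miss(1) by auto
  qed
  then obtain A c0 M where A: "zs = A @ c0 # M" "E c0 y" "\<forall>a\<in>set A. \<not> E a y"
    using split_list_first_prop[of zs "\<lambda>c. E c y"] by blast
  have nA: "\<not> E y a" if "a \<in> set A" for a
  proof
    assume "E y a"
    obtain A1 A2 where "A = A1 @ a # A2" using split_list[OF \<open>a \<in> set A\<close>] by blast
    then show False using H1[of A1 "a # A2 @ [c0]" M] A \<open>E y a\<close> by auto
  qed
  have nc0: "\<not> E y c0" using H1[of A "[c0]" M] A by auto
  have "\<exists>c\<in>set zs. E y c"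
  proof -
    have "E\<^sup>*\<^sup>* y z" using strong z xs(3) by blast
    then obtain c where "E y c" using z(2) by (metis converse_rtranclpE)
    then show ?thesis using arc[of y c] nz miss(1) by auto
  qed
  then have "\<exists>c\<in>set M. E y c" using nA nc0 A by auto
  then obtain M1 c1 B where B: "M = M1 @ c1 # B" "E y c1" "\<forall>b\<in>set B. \<not> E y b"
    using split_list_last_prop[of M "E y"] by blast
  have nB: "\<not> E b y" if b: "b \<in> insert c1 (set B)" for b
  proof
    assume "E b y"
    obtain B1 B2 where "c1 # B = B1 @ b # B2" using split_list[of b "c1 # B"] b by auto
    then have "zs = (A @ c0 # M1) @ (B1 @ [b]) @ B2" "hd (B1 @ [b]) = c1" using A B by (auto, cases B1) auto
    then show False using H1[of "A @ c0 # M1" "B1 @ [b]" B2] B \<open>E b y\<close> by auto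
  qed
  have gap: "narcs E y v \<noteq> 0" if "v \<in> set M1" for v
  proof
    assume v: "narcs E y v = 0"
    have "cyc E ((c1 # B @ z # A @ [c0]) @ M1)" "set ((c1 # B @ z # A @ [c0]) @ M1) = V - {y}"
      using cyc_swap[of E "z # A @ c0 # M1" "c1 # B"] cyc_swap[of E "(c1 # B) @ z # A @ [c0]" M1] zs A B
      by (auto dest: cyc_swap[of E "z # A @ [c0]" "M1 @ c1 # B"])
    then show False using H[of "c1 # B @ z # A @ [c0]" M1 v] A B v that by auto
  qed
  have so: "successively (\<lambda>a b. \<not> (E y a \<and> E y b)) (z # zs)" and si: "successively (\<lambda>a b. \<not> (E a y \<and> E b y)) (z # zs)"
    using successively_out[OF zs xs(3)] successively_in[OF zs xs(3)] .
  have M1: "M1 = []"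
  proof (rule ccontr)
    assume "M1 \<noteq> []"
    then obtain p M2 where M1: "M1 = p # M2" by (cases M1) auto
    have "\<not> E p y" using si A B M1 by (auto simp: successively_append_iff successively_Cons)
    then have yp: "E y p" using gap[of p] M1 by (auto simp: narcs_0_iff)
    show False
    proof (cases M2)
      case Nil
      then show ?thesis using so A B M1 yp by (auto simp: successively_append_iff successively_Cons)
    next
      case (Cons q M3)
      have "\<not> E y q" using so A B M1 Cons yp by (auto simp: successively_append_iff successively_Cons)
      then have "E q y" using gap[of q] M1 Cons by (auto simp: narcs_0_iff)
      then show ?thesis using H1[of "A @ [c0]" "[p, q]" "M3 @ c1 # B"] A B M1 Cons yp by auto
    qed
  qed
  have zs': "zs = A @ c0 # c1 # B" using A B M1 by simp
  have dist: "distinct (z # zs)" using cyc_distinct[OF zs(1)] .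
  have zero: "narcs E y v = 0" if "v \<in> V" "v \<noteq> c0" "v \<noteq> c1" for v
    using that miss(1) zs' nA A(3) nB B(3) nz by (auto simp: narcs_0_iff)
  have c01: "c0 \<in> V" "c1 \<in> V" "c0 \<noteq> c1" "c0 \<noteq> y" "c1 \<noteq> y" "c0 \<noteq> z" "c1 \<noteq> z" using miss(1,2) zs' dist by auto
  have degy: "deg E y V = 2"
  proof -
    have "deg E y V = narcs E y c0 + (narcs E y c1 + deg E y (V - {c0} - {c1}))"
      using deg_remove[of V c0 E y] deg_remove[of "V - {c0}" c1 E y] finV c01 by simp
    moreover have "deg E y (V - {c0} - {c1}) = 0" using zero by (intro deg_eq_0) auto
    moreover have "narcs E y c0 = 1" "narcs E y c1 = 1" using A(2) nc0 B(2) nB[of c1] by (auto simp: narcs_def)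
    ultimately show ?thesis by simp
  qed
  have complete: "narcs E z v = 2" if v: "v \<in> V" "v \<noteq> y" "v \<noteq> z" for v
  proof -
    have "card (V - {y} - {z}) + 2 = card V"
      using card_Suc_Diff1[OF finV xs(3)] card_Suc_Diff1[of "V - {y}" z] finV z by simp
    moreover have "deg E z V = deg E z (V - {y} - {z})"
      using deg_remove[of V y E z] deg_remove[of "V - {y}" z E z] finV z xs(3) by (simp add: narcs_sym[of E z y])
    moreover have "2 * card V \<le> deg E y V + deg E z V + 2" using ore[of y z] z xs(3) by auto
    ultimately show ?thesis using deg_complete[of "V - {y} - {z}" E z v] degy finV v by simp
  qed
  have "cyc E ((c1 # B) @ z # A @ [c0])" using cyc_swap[of E "z # A @ [c0]" "c1 # B"] zs(1) zs' by simp
  then have ham: "cyc E ((y # c1 # B @ [z]) @ (A @ [c0]))"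
    using A(2) B(2) miss(2) zs' by (auto simp: cyc_def path_Cons path_append)
  have hamV: "set ((y # c1 # B @ [z]) @ (A @ [c0])) = V" unfolding miss(1) zs' by auto
  have "hd (A @ [c0]) \<in> set (A @ [c0])" by (rule hd_in_set) simp
  then have "hd (A @ [c0]) \<in> V" "hd (A @ [c0]) \<noteq> y" "hd (A @ [c0]) \<noteq> z"
    using miss(1,2) zs' dist by auto
  then have "E (hd (A @ [c0])) z" using complete by (auto simp: narcs_2_iff)
  then show False using ham_not_rev[OF ham hamV] by simp
qed

text \<open>In a shortest gap that contains a non-neighbour of \<open>y\<close>, no neighbour lies
  between the first and the last non-neighbour. Before them are pure out-neighbours, behind them
  pure in-neighbours, and at most one of each since consecutive vertices cannot be of the same kind.
  The four resulting shapes are excluded by the four gap lemmas.\<close>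

lemma outside_adjacent:
  assumes ns: "\<not> split_independent" and xs: "cyc E xs" "set xs = V - {y}" "y \<in> V"
    and nocut: "\<And>x. \<exists>v. (E y v \<or> E v y) \<and> v \<noteq> x"
    and z: "z \<in> V" "z \<noteq> y"
  shows "narcs E y z \<noteq> 0"
proof
  assume z0: "narcs E y z = 0"
  define good where "good L W \<longleftrightarrow> cyc E (L @ W) \<and> set (L @ W) = V - {y} \<and> L \<noteq> [] \<and> E (last L) y \<and> E y (hd L) \<and>
    (\<exists>z\<in>set W. narcs E y z = 0)" for L W
  obtain L0 W0 z1 where "cyc E (L0 @ W0)" "set (L0 @ W0) = V - {y}" "L0 \<noteq> []" "E (last L0) y" "E y (hd L0)"
    "z1 \<in> set W0" "narcs E y z1 = 0"
    by (rule zero_gap_exists[OF xs z z0])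
  then have "good L0 W0" by (auto simp: good_def)
  then obtain L W where LW: "good L W" "\<And>L' W'. good L' W' \<Longrightarrow> length W \<le> length W'"
    using least_length_snd[of good] by blast
  have C: "cyc E (L @ W)" "set (L @ W) = V - {y}" "L \<noteq> []" "E (last L) y" "E y (hd L)"
    using LW(1) by (auto simp: good_def)
  define mk where "mk = (\<lambda>v. narcs E y v \<noteq> 0)"
  have int: "E u y \<Longrightarrow> v \<in> set W2 \<Longrightarrow> mk v" "E y u \<Longrightarrow> v \<in> set W1 \<Longrightarrow> mk v" if W: "W = W1 @ u # W2" for W1 u W2 v
  proof -
    show "mk v" if "E u y" "v \<in> set W2"
    proof (rule ccontr)
      assume "\<not> mk v"
      then have "good (L @ W1 @ [u]) W2" using C W that by (auto simp: good_def mk_def)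
      from LW(2)[OF this] show False using W by simp
    qed
    show "mk v" if "E y u" "v \<in> set W1"
    proof (rule ccontr)
      assume "\<not> mk v"
      moreover have "cyc E ((u # W2 @ L) @ W1)" using cyc_swap[of E "L @ W1" "u # W2"] C(1) W by simp
      ultimately have "good (u # W2 @ L) W1" using C W that by (auto simp: good_def mk_def)
      from LW(2)[OF this] show False using W by simp
    qed
  qed
  obtain w where "w \<in> set W" "\<not> mk w" using LW(1) by (auto simp: good_def mk_def)
  then obtain F z1 W1 where F: "W = F @ z1 # W1" "\<not> mk z1" "\<forall>f\<in>set F. mk f"
    using split_list_first_prop[of W "\<lambda>v. \<not> mk v"] by blast
  obtain Z' z2 G where G: "z1 # W1 = Z' @ z2 # G" "\<not> mk z2" "\<forall>g\<in>set G. mk g"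
    using split_list_last_prop[of "z1 # W1" "\<lambda>v. \<not> mk v"] F(2) by auto
  define Z where "Z = Z' @ [z2]"
  have W: "W = F @ Z @ G" using F(1) G(1) by (simp add: Z_def)
  have Z0: "Z \<noteq> []" "hd Z = z1" "last Z = z2" using G(1) by (auto simp: Z_def) (cases Z'; auto)
  have so: "successively (\<lambda>a b. \<not> (E y a \<and> E y b)) (L @ W)" and si: "successively (\<lambda>a b. \<not> (E a y \<and> E b y)) (L @ W)"
    using successively_out[OF C(1,2) xs(3)] successively_in[OF C(1,2) xs(3)] .
  have Fi: "\<not> E f y" "E y f" if f: "f \<in> set F" for f
  proof -
    obtain F1 F2 where "F = F1 @ f # F2" using split_list[OF f] by blast
    then show "\<not> E f y" using int(1)[of F1 f "F2 @ z1 # W1" z1] F(1,2) by auto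
    then show "E y f" using F(3) f by (auto simp: mk_def narcs_0_iff)
  qed
  have Gi: "\<not> E y g" "E g y" if g: "g \<in> set G" for g
  proof -
    obtain G1 G2 where "G = G1 @ g # G2" using split_list[OF g] by blast
    then show "\<not> E y g" using int(2)[of "F @ Z @ G1" g G2 z2] W G(2) by (auto simp: Z_def)
    then show "E g y" using G(3) g by (auto simp: mk_def narcs_0_iff)
  qed
  have Zz: "narcs E y v = 0" if v: "v \<in> set Z" for v
  proof (rule ccontr)
    assume nv: "narcs E y v \<noteq> 0"
    obtain Z1 Z2 where Z12: "Z = Z1 @ v # Z2" using split_list[OF v] by blast
    have "v \<noteq> z1" "v \<noteq> z2" using nv F(2) G(2) by (auto simp: mk_def)
    then have "z1 \<in> set Z1" "z2 \<in> set Z2"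
      using Z0(2,3) Z12 hd_in_set[of Z1] last_in_set[of Z2] by (cases Z1; cases Z2; auto)+
    then show False
      using int[of "F @ Z1" v "Z2 @ G"] W Z12 F(2) G(2) nv by (auto simp: narcs_0_iff)
  qed
  have Fc: "F = [] \<or> (\<exists>p. F = [p] \<and> E y p \<and> \<not> E p y)"
  proof (cases F)
    case (Cons p F')
    have "F' = []"
    proof (rule ccontr)
      assume "F' \<noteq> []"
      then have "E y (hd F')" using Fi(2)[of "hd F'"] Cons by auto
      then show False using so W Cons Fi(2)[of p] \<open>F' \<noteq> []\<close> by (auto simp: successively_append_iff successively_Cons)
    qed
    then show ?thesis using Fi[of p] Cons by auto
  qed simp
  have Gc: "G = [] \<or> (\<exists>q. G = [q] \<and> E q y \<and> \<not> E y q)"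
  proof (cases G rule: rev_cases)
    case (snoc G' q)
    have "G' = []"
    proof (rule ccontr)
      assume "G' \<noteq> []"
      then have "E (last G') y" using Gi(2)[of "last G'"] snoc by auto
      then show False using si W snoc Gi(2)[of q] \<open>G' \<noteq> []\<close> by (auto simp: successively_append_iff successively_Cons)
    qed
    then show ?thesis using Gi[of q] snoc by auto
  qed simp
  from Fc Gc show False
  proof (elim disjE exE conjE)
    assume FG: "F = []" "G = []"
    obtain a K where L: "L = a # K" using C(3) by (cases L) auto
    show False
    proof (cases K)
      \<comment> \<open>A one-vertex \<open>L\<close> would contain the only neighbour of
        \<open>y\<close>.\<close>
      case Nil
      obtain v where "E y v \<or> E v y" "v \<noteq> a" using nocut[of a] by blast
      moreover from this have "v \<in> set (L @ W)" unfolding C(2) using arc by auto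
      ultimately show False using Zz[of v] W FG L Nil by (auto simp: narcs_0_iff)
    next
      case (Cons b K')
      show False by (rule no_gap_zero[OF ns _ _ xs(3), of L Z a b K']) (use C W FG L Cons Z0 Zz in auto)
    qed
  next
    fix q assume FG: "F = []" "G = [q]" "E q y" "\<not> E y q"
    show False by (rule no_gap_in[of L Z q y]) (use C W FG Z0 Zz xs(3) in auto)
  next
    fix p assume FG: "F = [p]" "G = []" "E y p" "\<not> E p y"
    show False by (rule no_gap_out[of L p Z y]) (use C W FG Z0 Zz xs(3) in auto)
  next
    fix p q assume FG: "F = [p]" "G = [q]" "E y p" "\<not> E p y" "E q y" "\<not> E y q"
    show False by (rule no_gap_both[OF ns, of L p Z q y]) (use C W FG Z0 Zz xs(3) in auto)
  qed
qed

end

section \<open>The exceptional digraphs, and two degenerate situations\<close>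

context ore_graph
begin

text \<open>This is \<open>D_{p-k,k}\<close> with k = card V - card S; the bounds on
  \<open>card S\<close> are those of k in [1, p-2].\<close>

definition glued_complete :: bool where
  "glued_complete \<longleftrightarrow> (\<exists>S x. S \<subseteq> V \<and> x \<in> S \<and> 2 \<le> card S \<and> card S < card V \<and>
     (\<forall>u\<in>V. \<forall>v\<in>V. E u v \<longleftrightarrow> u \<noteq> v \<and> (u \<in> S \<and> v \<in> S \<or> u \<in> insert x (V - S) \<and> v \<in> insert x (V - S))))"

definition T5_like :: bool where
  "T5_like \<longleftrightarrow> (\<exists>f. inj f \<and> range f = V \<and> (\<forall>u v. E (f u) (f v) \<longleftrightarrow> (u, v) \<in> parcs T5))"

definition C3_like :: bool where
  "C3_like \<longleftrightarrow> (\<exists>f. bij_betw f {0, 1, 2} V \<and>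
     (\<forall>u\<in>{0, 1, 2}. \<forall>v\<in>{0, 1, 2}. E (f u) (f v) \<longleftrightarrow> (u, v) \<in> parcs C3))"

lemma cyc_exists: "\<exists>xs. cyc E xs"
proof -
  have "\<not> card V \<le> 1" using card3 by simp
  then obtain u v where uv: "u \<in> V" "v \<in> V" "u \<noteq> v" using card_le_1[of V] by blast
  then obtain w where w: "E u w" using strong[of u v] by (metis converse_rtranclpE)
  have "restr E V = E" using arc by (auto simp: restr_def fun_eq_iff)
  then have "(restr E V)\<^sup>*\<^sup>* w u" using strong[of w u] w arc[OF w] by simp
  then obtain P where "path E P" "hd P = w" "last P = u"
    using restr_path[of E V w u] arc[OF w] by blast
  then show ?thesis using w by (auto simp: cyc_def)
qed

text \<open>A chord would shorten a Hamiltonian cycle, so all degrees are 2. From order 4 on, two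
  vertices at distance two on the cycle are non-adjacent with degree sum 4, less than 2p -
  2.\<close>

lemma no_short_cycle:
  assumes all: "\<And>xs. cyc E xs \<Longrightarrow> length xs = card V"
  shows C3_like
proof -
  obtain xs where xs: "cyc E xs" using cyc_exists by blast
  have setV: "set ys = V" if "cyc E ys" for ys
    using card_subset_eq[OF finV cyc_subset[OF that]] cyc_length[OF that] all[OF that] by simp
  have next_v: "b = hd zs" if c: "cyc E (a # zs)" and "E a b" for a b zs
  proof (rule ccontr)
    assume ne: "b \<noteq> hd zs"
    have "b \<in> set (a # zs)" using setV[OF c] arc[OF \<open>E a b\<close>] by auto
    then have "b \<in> set zs" using \<open>E a b\<close> by auto
    then obtain K M where K: "zs = K @ b # M" using split_list by metis
    then have "K \<noteq> []" using ne by auto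
    have "cyc E (a # b # M)" using c K \<open>E a b\<close> \<open>K \<noteq> []\<close> by (auto simp: cyc_def path_Cons path_append split: if_splits)
    then show False using all[OF c] all[of "a # b # M"] K \<open>K \<noteq> []\<close> by (cases K) auto
  qed
  have prev_v: "b = last zs" if c: "cyc E (a # zs)" and "E b a" for a b zs
  proof (rule ccontr)
    assume ne: "b \<noteq> last zs"
    have "b \<in> set (a # zs)" using setV[OF c] arc[OF \<open>E b a\<close>] by auto
    then have "b \<in> set zs" using \<open>E b a\<close> by auto
    then obtain K M where K: "zs = K @ b # M" using split_list by metis
    then have M: "M \<noteq> []" using ne by auto
    have "cyc E (b # M @ a # K)" using cyc_swap[of E "a # K" "b # M"] c K by simp
    then have "a = hd M" using next_v[of b "M @ a # K" a] \<open>E b a\<close> M by simp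
    then show False using cyc_distinct[OF c] K M by auto
  qed
  have deg2: "deg E a V \<le> 2" if c: "cyc E (a # zs)" for a zs
  proof -
    have "card {v \<in> V. E a v} \<le> 1" "card {v \<in> V. E v a} \<le> 1"
      by (rule card_le_1, use next_v[OF c] in blast, rule card_le_1, use prev_v[OF c] in blast)
    then show ?thesis using deg_card[OF finV, of E a] by linarith
  qed
  have len: "length xs = card V" using all[OF xs] .
  then have "3 \<le> length xs" using card3 by simp
  then obtain a b c rest where abc: "xs = a # b # c # rest"
    by (auto simp: numeral_3_eq_3 Suc_le_length_iff)
  have cs: "cyc E (a # b # c # rest)" "cyc E (b # c # rest @ [a])" "cyc E (c # rest @ [a, b])"
    using xs abc cyc_swap[of E "[a]" "b # c # rest"] cyc_swap[of E "[a, b]" "c # rest"] by auto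
  have dist: "distinct xs" using cyc_distinct[OF xs] .
  have rest: "rest = []"
  proof (rule ccontr)
    assume "rest \<noteq> []"
    have "\<not> E a c" using next_v[OF cs(1), of c] dist abc by auto
    moreover have "\<not> E c a" using next_v[OF cs(3), of a] dist abc \<open>rest \<noteq> []\<close> by auto
    ultimately have ac: "narcs E a c = 0" by (simp add: narcs_0_iff)
    have "a \<in> V" "c \<in> V" "a \<noteq> c" using setV[OF xs] abc dist by auto
    then have "2 * card V \<le> deg E a V + deg E c V + 2" using ore ac by blast
    then show False using deg2[OF cs(1)] deg2[OF cs(3)] len abc \<open>rest \<noteq> []\<close> by (cases rest) auto
  qed
  have E: "E a b" "E b c" "E c a" "\<not> E b a" "\<not> E c b" "\<not> E a c"
    using cs(1) next_v[OF cs(1), of c] next_v[OF cs(2), of a] next_v[OF cs(3), of b] dist abc rest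
    by (auto simp: cyc_def path_Cons)
  define f where "f i = (if i = 0 then a else if i = 1 then b else c)" for i :: nat
  have V: "V = {a, b, c}" using setV[OF xs] abc rest by auto
  have d: "a \<noteq> b" "b \<noteq> c" "a \<noteq> c" using dist abc by auto
  have "bij_betw f {0, 1, 2} V" unfolding bij_betw_def V using d by (auto simp: f_def inj_on_def)
  moreover have "\<forall>u\<in>{0, 1, 2}. \<forall>v\<in>{0, 1, 2}. E (f u) (f v) \<longleftrightarrow> (u, v) \<in> parcs C3"
    using E by (auto simp: f_def C3_def)
  ultimately show ?thesis unfolding C3_like_def by blast
qed

text \<open>With m = card V - 1 the set \<open>V - {y}\<close> counts as a longest cycle whatever
  the other cycles are, and the analysis of a single attachment vertex gives
  \<open>D_{p-1,1}\<close>.\<close>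

lemma glued_complete_missing:
  assumes xs: "cyc E xs" "set xs = V - {y}" "y \<in> V" and x: "\<And>v. E y v \<or> E v y \<Longrightarrow> v = x"
  shows glued_complete
proof -
  have cS: "card (V - {y}) + 1 = card V" using card_Suc_Diff1[OF finV xs(3)] by simp
  interpret l: longest_cycle V E "card V - 1"
  proof
    show "card V - 1 < card V" using card3 by simp
    show "length zs \<le> card V - 1 \<or> length zs = card V" if "cyc E zs" for zs
      using cyc_length[OF that] card_mono[OF finV cyc_subset[OF that]] by auto
  qed
  interpret mc: max_cyc V E "card V - 1" "V - {y}"
    using xs cS by unfold_locales auto
  have yR: "y \<in> V - (V - {y})" using xs(3) by simp
  obtain s where s: "s \<in> V - {y}" "s \<in> outreach E (V - (V - {y})) y"
    by (rule mc.Rout_nonempty[OF yR])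
  then have "s = x" using x[of s] by (auto simp: outreach_def)
  then have xS: "x \<in> V - {y}" using s by simp
  have "(V - {y}) \<inter> (inreach E (V - (V - {y})) y \<union> outreach E (V - (V - {y})) y) \<subseteq> {x}"
    using x by (auto simp: outreach_def inreach_def)
  note cut = mc.cut_vertex[OF yR xS this]
  show ?thesis
    unfolding glued_complete_def
  proof (intro exI conjI ballI)
    show "V - {y} \<subseteq> V" "x \<in> V - {y}" "2 \<le> card (V - {y})" "card (V - {y}) < card V"
      using xS cS card3 by auto
  qed (rule cut)
qed

end

section \<open>Alternating neighbourhoods\<close>

text \<open>Both properties are asked of every vertex missed by a cycle: contradictions arise from
  applying them to the vertices that modified cycles miss.\<close>

locale alternating_graph = ore_graph +
  fixes y :: 'a and xs0 :: "'a list"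
  assumes y_in: "y \<in> V" and xs0: "cyc E xs0" "set xs0 = V - {y}"
    and alt: "cyc E zs \<Longrightarrow> set zs = V - {v} \<Longrightarrow> v \<in> V \<Longrightarrow> E v (last zs) \<longleftrightarrow> \<not> E v (hd zs)"
    and one: "cyc E zs \<Longrightarrow> set zs = V - {v} \<Longrightarrow> v \<in> V \<Longrightarrow> w \<in> V \<Longrightarrow> w \<noteq> v \<Longrightarrow> E v w \<longleftrightarrow> \<not> E w v"
begin

abbreviation "S \<equiv> V - {y}"

lemma oneS: "w \<in> S \<Longrightarrow> E y w \<longleftrightarrow> \<not> E w y"
  using one[OF xs0 y_in] by auto

lemma altS: "cyc E zs \<Longrightarrow> set zs = S \<Longrightarrow> E y (last zs) \<longleftrightarrow> \<not> E y (hd zs)"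
  using alt y_in by blast

lemma ham_insert:
  assumes "cyc E zs" "set zs = S" "E y (hd zs)"
  shows "cyc E (y # zs)"
proof -
  have "zs \<noteq> []" using assms(1) by (auto simp: cyc_def)
  then have "last zs \<in> S" using assms(2) last_in_set by metis
  then have "E (last zs) y" using altS[OF assms(1,2)] oneS[of "last zs"] assms(3) by blast
  moreover have "y \<notin> set zs" using assms(2) by blast
  ultimately show ?thesis using assms \<open>zs \<noteq> []\<close> by (simp add: cyc_def path_Cons)
qed

lemma insert_set: "set zs = S \<Longrightarrow> insert y (set zs) = V"
  using y_in by blast

text \<open>By alternation \<open>y\<close> fits between the first and second vertex or between the
  second and third. Either way the closing arc stays on a Hamiltonian cycle.\<close>

lemma no_reverse:
  assumes zs: "cyc E zs" "set zs = S" and l: "3 \<le> length zs"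
  shows "\<not> E (hd zs) (last zs)"
proof -
  obtain b b' c rest where z: "zs = b # b' # c # rest"
    using l by (auto simp: numeral_3_eq_3 Suc_le_length_iff)
  have r1: "cyc E (b' # c # rest @ [b])" "set (b' # c # rest @ [b]) = S"
    using cyc_swap[of E "[b]" "b' # c # rest"] zs z by auto
  have r2: "cyc E (c # rest @ [b, b'])" "set (c # rest @ [b, b']) = S"
    using cyc_swap[of E "[b, b']" "c # rest"] zs z by auto
  show ?thesis
  proof (cases "E y b")
    case False
    then have "E y b'" using altS[OF r1] by simp
    then have "cyc E (y # b' # c # rest @ [b])" using ham_insert[OF r1] by simp
    then show ?thesis using ham_not_rev[of "y # b' # c # rest" "[b]"] insert_set[OF r1(2)] z by auto
  next
    case True
    then have "\<not> E y b'" using altS[OF r1] by simp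
    then have "E y c" using altS[OF r2] by simp
    then have "cyc E (y # c # rest @ [b, b'])" using ham_insert[OF r2] by simp
    then show ?thesis using ham_not_rev[of "y # c # rest" "[b, b']"] insert_set[OF r2(2)] z by auto
  qed
qed

text \<open>A parity argument. After skipping \<open>v\<close>, the vertex \<open>y\<close> fits
  into the cycle before \<open>hd pre\<close> and also before \<open>e\<close>. On both cycles the
  out-neighbours of \<open>v\<close> alternate. With \<open>y\<close> between \<open>f\<close> and
  \<open>hd pre\<close> these two agree; with \<open>y\<close> elsewhere they are consecutive and
  differ.\<close>

lemma no_chord_gen:
  assumes c: "cyc E (pre @ v # suf @ [e, f])" "set (pre @ v # suf @ [e, f]) = S"
    and ne: "pre \<noteq> []" "suf \<noteq> []" and y: "E y (hd pre)"
  shows "\<not> E (last pre) (hd suf)"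
proof
  assume ch: "E (last pre) (hd suf)"
  have inS: "f \<in> S" "e \<in> S" "last suf \<in> S" "v \<in> V" using ne unfolding c(2)[symmetric] by auto (metis c(2) DiffE UnCI list.set_intros(1) set_append)
  have nf: "\<not> E y f" using altS[OF c] y ne by simp
  then have fy: "E f y" using oneS[OF inS(1)] by simp
  have r1: "cyc E (f # pre @ v # suf @ [e])" "set (f # pre @ v # suf @ [e]) = S"
    using cyc_swap[of E "pre @ v # suf @ [e]" "[f]"] c by auto
  have ye: "E y e" using altS[OF r1] nf by simp
  have r2: "cyc E (e # f # pre @ v # suf)" "set (e # f # pre @ v # suf) = S"
    using cyc_swap[of E "pre @ v # suf" "[e, f]"] c by auto
  have "\<not> E y (last suf)" using altS[OF r2] ye ne by simp
  then have sy: "E (last suf) y" using oneS[OF inS(3)] by simp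
  have yn: "y \<notin> set (pre @ v # suf @ [e, f])" unfolding c(2) by simp
  have dist: "distinct (pre @ v # suf @ [e, f])" using cyc_distinct[OF c(1)] .
  have Veq: "V = insert y (set (pre @ v # suf @ [e, f]))" unfolding c(2) using y_in by blast
  have c1: "cyc E (y # (pre @ suf @ [e, f]))"
    using c(1) ne ch y fy yn by (auto simp: cyc_def path_append path_Cons)
  have c1': "cyc E ((pre @ suf @ [e, f]) @ [y])" using cyc_swap[of E "[y]" "pre @ suf @ [e, f]"] c1 by simp
  have c2: "cyc E (pre @ suf @ [y, e, f])"
    using c(1) ne ch sy ye yn by (auto simp: cyc_def path_append path_Cons)
  have s1: "set (y # (pre @ suf @ [e, f])) = V - {v}" "set ((pre @ suf @ [e, f]) @ [y]) = V - {v}"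
    "set (pre @ suf @ [y, e, f]) = V - {v}" unfolding Veq using dist yn by auto
  have "E v f \<longleftrightarrow> \<not> E v y" using alt[OF c1 s1(1) inS(4)] by simp
  moreover have "E v y \<longleftrightarrow> \<not> E v (hd pre)" using alt[OF c1' s1(2) inS(4)] ne by simp
  moreover have "E v f \<longleftrightarrow> \<not> E v (hd pre)" using alt[OF c2 s1(3) inS(4)] ne by simp
  ultimately show False by blast
qed

text \<open>If \<open>y\<close> does not dominate \<open>a\<close>, it dominates the vertex before
  \<open>a\<close>, and the list is rotated by one. Three vertices in \<open>rest\<close> leave
  enough room in both cases.\<close>

lemma no_chord:
  assumes c: "cyc E (a # v # b # rest)" "set (a # v # b # rest) = S" and l: "3 \<le> length rest"
  shows "\<not> E a b"
proof -
  obtain r d e f where r: "rest = r @ [d, e, f]"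
  proof -
    have "length (drop (length rest - 3) rest) = 3" using l by simp
    then have "\<exists>d e f. drop (length rest - 3) rest = [d, e, f]"
      by (auto simp: numeral_3_eq_3 length_Suc_conv simp del: length_drop)
    then show thesis using that append_take_drop_id[of "length rest - 3" rest] by metis
  qed
  show ?thesis
  proof (cases "E y a")
    case True
    then show ?thesis using no_chord_gen[of "[a]" v "b # r @ [d]" e f] c r by simp
  next
    case False
    then have "E y f" using altS[OF c] r by simp
    moreover have "cyc E (f # a # v # b # r @ [d, e])" "set (f # a # v # b # r @ [d, e]) = S"
      using cyc_swap[of E "a # v # b # r @ [d, e]" "[f]"] c r by auto
    ultimately show ?thesis using no_chord_gen[of "[f, a]" v "b # r" d e] by simp
  qed
qed

text \<open>Both cycle neighbours of \<open>c\<close> stand in the same relation to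
  \<open>y\<close>. Moving \<open>c\<close> into \<open>Q\<close> gives a Hamiltonian path of
  \<open>S\<close> between these two, and \<open>y\<close> added at its end or front completes a
  bypass.\<close>

lemma no_insertS:
  assumes c: "cyc E (c # Q)" "set (c # Q) = S" and Q0: "Q \<noteq> []"
  shows "no_insert E c Q"
proof (rule ccontr)
  assume "\<not> ?thesis"
  then obtain A B where AB: "Q = A @ B" "A \<noteq> []" "B \<noteq> []" "E (last A) c" "E c (hd B)" using not_no_insertD by metis
  have Q: "cyc E (Q @ [c])" "set (Q @ [c]) = S" using cyc_swap[of E "[c]" Q] c by auto
  have yn: "y \<notin> set (c # Q)" unfolding c(2) by simp
  have pth: "path E (A @ c # B)" using c(1) AB by (auto simp: cyc_def path_Cons path_append)
  have VV: "insert y (set (A @ c # B)) = V" using insert_set[OF c(2)] AB by auto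
  have hl: "hd Q \<in> S" "last Q \<in> S" using Q0 unfolding c(2)[symmetric] by auto
  show False
  proof (cases "E y c")
    case True
    then have "E (last Q) y" "E (hd Q) y"
      using altS[OF c] altS[OF Q] Q0 oneS[OF hl(1)] oneS[OF hl(2)] by auto
    then have "path E ((A @ c # B) @ [y])" "E (hd ((A @ c # B) @ [y])) y"
      using pth AB yn by (auto simp: path_append path_Cons)
    then show False using no_bypass[of "(A @ c # B) @ [y]"] VV by auto
  next
    case False
    then have "E y (last Q)" "E y (hd Q)" using altS[OF c] altS[OF Q] Q0 by auto
    then have "path E (y # A @ c # B)" "E y (last (y # A @ c # B))"
      using pth AB yn by (auto simp: path_append path_Cons)
    then show False using no_bypass[of "y # A @ c # B"] VV by auto
  qed
qed

text \<open>Each \<open>c\<close> has at most one arc to \<open>y\<close> and to either cycle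
  neighbour. It cannot be inserted into the remaining stretch \<open>M\<close>, and the chords at
  both ends of \<open>M\<close> are missing, so it has at most |M| - 1 arcs to \<open>M\<close>. So
  \<open>c\<close> has a non-neighbour and degree at most card V - 2, which two non-adjacent
  vertices cannot both have. Length 6 is the least that the chord argument allows.\<close>

lemma cycle_lt_6: "length xs0 < 6"
proof (rule ccontr)
  assume "\<not> ?thesis"
  then have l6: "6 \<le> length xs0" by simp
  have len: "length xs0 + 1 = card V" using cyc_missing_card(3)[OF xs0 y_in] .
  have degS: "deg E c V + 2 \<le> card V \<and> (\<exists>z\<in>S. z \<noteq> c \<and> narcs E c z = 0)" if c: "c \<in> S" for c
  proof -
    obtain Q where Q: "cyc E (c # Q)" "set (c # Q) = S" using cyc_hd_ex[OF xs0(1), of c] c xs0(2) by auto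
    have lQ: "length (c # Q) = length xs0" using cyc_length[OF Q(1)] cyc_length[OF xs0(1)] xs0(2) unfolding Q(2) by simp
    obtain p M q where pq: "Q = p # M @ [q]"
    proof -
      obtain p Q' where "Q = p # Q'" using lQ l6 by (cases Q) auto
      moreover obtain M q where "Q' = M @ [q]" using lQ l6 calculation by (cases Q' rule: rev_cases) auto
      ultimately show thesis using that by simp
    qed
    have lM: "3 \<le> length M" "length M + 4 = card V" using lQ l6 len pq by auto
    obtain h M1 where h: "M = h # M1" using lM by (cases M) auto
    obtain M2 t where t: "M = M2 @ [t]" using lM by (cases M rule: rev_cases) auto
    have yn: "y \<notin> set (c # Q)" unfolding Q(2) by simp
    have dist: "distinct (c # Q)" using cyc_distinct[OF Q(1)] .
    have Q1: "cyc E (Q @ [c])" "set (Q @ [c]) = S" using cyc_swap[of E "[c]" Q] Q by auto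
    have "\<not> E c q" using no_reverse[OF Q] lQ l6 pq by simp
    moreover have "\<not> E p c" using no_reverse[OF Q1] lQ l6 pq by simp
    moreover have ch: "\<not> E c h" using no_chord[of c p h "M1 @ [q]"] Q pq h lM by simp
    have "cyc E ([t, q] @ (c # p # M2))" using cyc_swap[of E "c # p # M2" "[t, q]"] Q(1) pq t by simp
    moreover have "set ([t, q] @ (c # p # M2)) = S" unfolding Q(2)[symmetric] pq t by auto
    ultimately have th: "\<not> E t c" using no_chord[of t q c "p # M2"] lM t by simp
    have pM: "path E M" using Q(1) pq lM by (auto simp: cyc_def path_Cons path_append split: if_splits)
    have "no_insert E c Q" using no_insertS[OF Q] pq by simp
    then have "no_insert E c M" using pq by (auto simp: no_insert_Cons no_insert_append)
    then have dM: "deg E c (set M) + 1 \<le> length M"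
    proof -
      have "hd M = h" "last M = t" using h by simp (simp add: t)
      then show ?thesis using no_insert_deg[of E c M] \<open>no_insert E c M\<close> pM th ch by simp
    qed
    have "\<exists>z\<in>set M. narcs E c z = 0"
    proof (rule ccontr)
      assume "\<not> ?thesis"
      then have "\<And>z. z \<in> set M \<Longrightarrow> 1 \<le> narcs E c z" by (simp add: Suc_le_eq)
      then have "(\<Sum>z\<in>set M. 1) \<le> deg E c (set M)" unfolding deg_def by (rule sum_mono)
      then show False using dM path_length[OF pM] by simp
    qed
    then obtain z where z: "z \<in> set M" "narcs E c z = 0" by blast
    have "z \<in> S" "z \<noteq> c" using z dist unfolding Q(2)[symmetric] pq by auto
    moreover have "deg E c V + 2 \<le> card V"
    proof -
      have V: "V = insert y (insert c (insert p (insert q (set M))))"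
        using insert_set[OF Q(2)] pq by auto
      have "deg E c V = narcs E c y + (narcs E c p + (narcs E c q + deg E c (set M)))"
        unfolding V using yn dist pq by (simp add: deg_insert)
      moreover have "narcs E c y \<le> 1" using oneS[OF c] by (auto simp: narcs_def)
      moreover have "narcs E c p \<le> 1" "narcs E c q \<le> 1" using \<open>\<not> E c q\<close> \<open>\<not> E p c\<close> by (auto simp: narcs_def)
      ultimately show ?thesis using dM lM by linarith
    qed
    ultimately show ?thesis using z by blast
  qed
  obtain c where c: "c \<in> S" using l6 xs0(2) by (cases xs0) auto
  then obtain z where z: "z \<in> S" "z \<noteq> c" "narcs E c z = 0" using degS by blast
  then have "2 * card V \<le> deg E c V + deg E z V + 2" using ore[of c z] c by auto
  then show False using degS[OF c] degS[OF z(1)] by linarith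
qed

text \<open>\<open>a\<close> and \<open>c\<close> are adjacent, for otherwise each has degree at
  most 3 while the sum must be 8. After a rotation \<open>a\<close> dominates \<open>c\<close>. The
  cycle \<open>d, y, a, c\<close> misses \<open>b\<close>, which forces \<open>d\<close> to dominate
  \<open>b\<close> and not conversely; an arc from \<open>c\<close> to \<open>a\<close> would give a
  cycle missing \<open>d\<close> that contradicts this.\<close>

lemma T5_like_if_4: "length xs0 = 4 \<Longrightarrow> T5_like"
proof -
  assume l4: "length xs0 = 4"
  have rot: "\<exists>ys. cyc E ys \<and> set ys = S \<and> length ys = 4 \<and> E y (hd ys)"
  proof (cases "E y (hd xs0)")
    case False
    then have "E y (last xs0)" using altS[OF xs0] by simp
    obtain zs l where "xs0 = zs @ [l]" using l4 by (cases xs0 rule: rev_cases) auto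
    then show ?thesis using cyc_swap[of E zs "[l]"] xs0 l4 \<open>E y (last xs0)\<close> by (intro exI[of _ "l # zs"]) auto
  qed (use xs0 l4 in auto)
  have main: T5_like if c: "cyc E [a, b, c, d]" "set [a, b, c, d] = S" and ya: "E y a" and ac: "E a c" for a b c d
  proof -
    have dist: "distinct [a, b, c, d]" using cyc_distinct[OF c(1)] .
    have yn: "y \<notin> set [a, b, c, d]" unfolding c(2) by simp
    have V: "V = {y, a, b, c, d}" using insert_set[OF c(2)] by auto
    have cs: "cyc E [b, c, d, a]" "cyc E [c, d, a, b]" "cyc E [d, a, b, c]"
      using cyc_swap[of E "[a]" "[b, c, d]"] cyc_swap[of E "[a, b]" "[c, d]"] cyc_swap[of E "[a, b, c]" "[d]"] c(1) by auto
    have ss: "set [b, c, d, a] = S" "set [c, d, a, b] = S" "set [d, a, b, c] = S" using c(2) by auto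
    have lab: "\<not> E y b" "E y c" "\<not> E y d" using altS[OF c] altS[OF cs(1) ss(1)] altS[OF cs(2) ss(2)] ya by auto
    have inS: "a \<in> S" "b \<in> S" "c \<in> S" "d \<in> S" unfolding c(2)[symmetric] by auto
    have lab': "E b y" "E d y" "\<not> E a y" "\<not> E c y" using lab ya oneS[OF inS(1)] oneS[OF inS(2)] oneS[OF inS(3)] oneS[OF inS(4)] by auto
    have arcs: "E a b" "E b c" "E c d" "E d a" using c(1) by (auto simp: cyc_def path_Cons)
    have rev: "\<not> E a d" "\<not> E b a" "\<not> E c b" "\<not> E d c"
      using no_reverse[OF c] no_reverse[OF cs(1) ss(1)] no_reverse[OF cs(2) ss(2)] no_reverse[OF cs(3) ss(3)] by auto
    have c1: "cyc E [d, y, a, c]" using arcs lab' ya ac dist yn by (auto simp: cyc_def path_Cons)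
    have s1: "set [d, y, a, c] = V - {b}" unfolding V using dist yn by auto
    have "\<not> E b d" using alt[OF c1 s1] arcs inS by auto
    then have db: "E d b" using one[OF c1 s1, of d] inS dist by auto
    have nca: "\<not> E c a"
    proof
      assume "E c a"
      then have c2: "cyc E [b, y, c, a]" using arcs lab lab' dist yn by (auto simp: cyc_def path_Cons)
      have s2: "set [b, y, c, a] = V - {d}" unfolding V using dist yn by auto
      have "\<not> E d b" using alt[OF c2 s2] arcs inS by auto
      then show False using db by simp
    qed
    \<comment> \<open>The labels are shifted by one, since in \<open>T5\<close> the vertices that
      dominate \<open>Y\<close> are \<open>Z1\<close> and \<open>Z3\<close>, here \<open>d\<close>
      and \<open>b\<close>.\<close>
    define f where "f = case_T5_vertex d a b c y"
    have f: "f Z1 = d" "f Z2 = a" "f Z3 = b" "f Z4 = c" "f Y = y" by (simp_all add: f_def)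
    have "inj f"
    proof (rule injI)
      fix u v assume "f u = f v"
      then show "u = v" using dist yn by (cases u; cases v) (auto simp: f)
    qed
    moreover have "range f = V"
    proof -
      have "(UNIV :: T5_vertex set) = {Z1, Z2, Z3, Z4, Y}" using T5_vertex.exhaust by blast
      then have "range f = f ` {Z1, Z2, Z3, Z4, Y}" by simp
      then show ?thesis unfolding V by (auto simp: f)
    qed
    moreover have "E (f u) (f v) \<longleftrightarrow> (u, v) \<in> parcs T5" for u v
      using arcs rev lab lab' ya ac nca db \<open>\<not> E b d\<close> by (cases u; cases v) (simp_all add: f T5_def)
    ultimately show ?thesis unfolding T5_like_def by blast
  qed
  obtain ys where ys: "cyc E ys" "set ys = S" "length ys = 4" "E y (hd ys)" using rot by blast
  obtain a b c d where abcd: "ys = [a, b, c, d]" using ys(3) by (auto simp: numeral_eq_Suc length_Suc_conv)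
  have dist: "distinct [a, b, c, d]" using cyc_distinct[OF ys(1)] abcd by simp
  have yn: "y \<notin> set [a, b, c, d]" using cyc_missing_card(2)[OF ys(1,2) y_in] abcd by simp
  have V: "V = {y, a, b, c, d}" using insert_set[OF ys(2)] abcd by auto
  have c1: "cyc E [b, c, d, a]" "set [b, c, d, a] = S" using cyc_swap[of E "[a]" "[b, c, d]"] ys abcd by auto
  have c2: "cyc E [c, d, a, b]" "set [c, d, a, b] = S" using cyc_swap[of E "[a, b]" "[c, d]"] ys abcd by auto
  have c3: "cyc E [d, a, b, c]" "set [d, a, b, c] = S" using cyc_swap[of E "[a, b, c]" "[d]"] ys abcd by auto
  have yc: "E y c" using altS[OF c1] altS[OF c2] ys(4) abcd by auto
  have "narcs E a c \<noteq> 0"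
  proof
    assume ac: "narcs E a c = 0"
    have inS: "a \<in> S" "c \<in> S" unfolding ys(2)[symmetric] abcd by auto
    have "\<not> E b a" "\<not> E a d" "\<not> E c b" "\<not> E d c"
      using no_reverse[OF ys(1,2)] no_reverse[OF c1] no_reverse[OF c2] no_reverse[OF c3] abcd by auto
    then have le: "narcs E a b \<le> 1" "narcs E a d \<le> 1" "narcs E c b \<le> 1" "narcs E c d \<le> 1"
      "narcs E a y \<le> 1" "narcs E c y \<le> 1" using oneS[OF inS(1)] oneS[OF inS(2)] by (auto simp: narcs_def)
    have "deg E a V = narcs E a y + (narcs E a b + narcs E a d)" "deg E c V = narcs E c y + (narcs E c b + narcs E c d)"
      unfolding V using dist yn ac by (simp_all add: deg_insert narcs_sym[of E c a])
    moreover have "2 * card V \<le> deg E a V + deg E c V + 2" using ore[of a c] ac inS dist by auto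
    moreover have "card V = 5" unfolding V using dist yn by simp
    ultimately show False using le by linarith
  qed
  then have "E a c \<or> E c a" by (auto simp: narcs_0_iff)
  then show T5_like using main[of a b c d] main[of c d a b] ys abcd c2 yc by auto
qed

lemma cycle_ne_2: "length xs0 \<noteq> 2"
proof
  assume l2: "length xs0 = 2"
  then obtain a b where ab: "xs0 = [a, b]" by (auto simp: numeral_2_eq_2 length_Suc_conv)
  have E: "E a b" "E b a" using xs0(1) ab by (auto simp: cyc_def path_Cons)
  have yn: "y \<noteq> a" "y \<noteq> b" "a \<noteq> b" using cyc_missing_card(2)[OF xs0 y_in] ab cyc_distinct[OF xs0(1)] by auto
  have V: "V = {y, a, b}" using insert_set[OF xs0(2)] ab by auto
  have "E y b \<longleftrightarrow> \<not> E y a" using altS[OF xs0] ab by simp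
  moreover have "E y a \<longleftrightarrow> \<not> E a y" "E y b \<longleftrightarrow> \<not> E b y" using oneS[of a] oneS[of b] V yn by auto
  ultimately show False
    using no_bypass[of "[b, y, a]"] no_bypass[of "[a, y, b]"] E yn V by (auto simp: path_Cons)
qed

end

section \<open>Combining the cases\<close>

context ore_graph
begin

text \<open>A missed vertex is adjacent to all others, and degree at most card V - 1 leaves exactly
  one arc to each. Its out-neighbours fill half of the cycle, so the length is even, and 4 is the
  only value left.\<close>

lemma alternating_case:
  assumes xs: "cyc E xs" "set xs = V - {y}" "y \<in> V" and ns: "\<not> split_independent" and ng: "\<not> glued_complete"
  shows T5_like
proof -
  have adj: "narcs E v w \<noteq> 0" if zs: "cyc E zs" "set zs = V - {v}" "v \<in> V" and w: "w \<in> V" "w \<noteq> v" for v w zs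
  proof (rule outside_adjacent[OF ns zs _ w])
    show "\<exists>u. (E v u \<or> E u v) \<and> u \<noteq> x" for x using glued_complete_missing[OF zs, of x] ng by blast
  qed
  have tight: "card V \<le> deg E v V + 1" "\<And>w. w \<in> V \<Longrightarrow> w \<noteq> v \<Longrightarrow> narcs E v w = 1"
    if zs: "cyc E zs" "set zs = V - {v}" "v \<in> V" for v zs
  proof -
    have ge: "1 \<le> narcs E v w" if "w \<in> V - {v}" for w using adj[OF zs, of w] that by (simp add: Suc_le_eq)
    have c: "card (V - {v}) + 1 = card V" using card_Suc_Diff1[OF finV zs(3)] by simp
    have d: "deg E v V = deg E v (V - {v})" using deg_remove[OF finV zs(3), of E v] by simp
    have "(\<Sum>w\<in>V - {v}. 1) \<le> deg E v (V - {v})" unfolding deg_def using ge by (rule sum_mono)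
    then show "card V \<le> deg E v V + 1" using c d by simp
    show "narcs E v w = 1" if w: "w \<in> V" "w \<noteq> v" for w
    proof (rule ccontr)
      assume "narcs E v w \<noteq> 1"
      then have "2 \<le> narcs E v w" using ge[of w] w by simp
      moreover have "(\<Sum>w\<in>V - {v} - {w}. 1) \<le> deg E v (V - {v} - {w})" unfolding deg_def using ge by (intro sum_mono) auto
      moreover have "card (V - {v} - {w}) + 1 = card (V - {v})" using card_Suc_Diff1[of "V - {v}" w] finV w by simp
      ultimately have "card V < deg E v V + 1" using deg_remove[of "V - {v}" w E v] finV w c d by simp
      then show False using deg_outside_le[OF zs] by simp
    qed
  qed
  interpret a: alternating_graph V E y xs
  proof
    show "E v (last zs) \<longleftrightarrow> \<not> E v (hd zs)" if "cyc E zs" "set zs = V - {v}" "v \<in> V" for zs v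
      using alternating(1)[OF that tight(1)[OF that]] .
    show "E v w \<longleftrightarrow> \<not> E w v" if "cyc E zs" "set zs = V - {v}" "v \<in> V" "w \<in> V" "w \<noteq> v" for zs v w
      using tight(2)[OF that] by (auto simp: narcs_def of_bool_def split: if_splits)
  qed (use xs in auto)
  have "2 * card {c \<in> V - {y}. E y c} + 1 = card V" using alternating(3)[OF xs tight(1)[OF xs]] .
  moreover have "length xs + 1 = card V" using cyc_missing_card(3)[OF xs] .
  ultimately have "even (length xs)" by (metis add_right_cancel dvd_triv_left)
  moreover have "length xs < 6" "length xs \<noteq> 2" "2 \<le> length xs"
    using a.cycle_lt_6 a.cycle_ne_2 cyc_length_ge[OF xs(1)] .
  ultimately have "length xs = 4" by presburger
  then show ?thesis by (rule a.T5_like_if_4)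
qed

lemma no_bypass_cases: "split_independent \<or> glued_complete \<or> T5_like \<or> C3_like"
proof (cases "\<exists>xs. cyc E xs \<and> length xs \<noteq> card V")
  case False
  then show ?thesis using no_short_cycle by blast
next
  case True
  define Q where "Q xs \<longleftrightarrow> cyc E xs \<and> length xs \<noteq> card V" for xs
  have le: "length xs \<le> card V" if "cyc E xs" for xs
    using cyc_length[OF that] card_mono[OF finV cyc_subset[OF that]] by simp
  obtain xs where xs: "Q xs" "\<And>zs. Q zs \<Longrightarrow> length zs \<le> length xs"
    using True ex_has_greatest_nat[of Q _ length "card V + 1"] le unfolding Q_def by (metis less_Suc_eq_le Suc_eq_plus1)
  interpret l: longest_cycle V E "length xs"
  proof
    show "length xs < card V" using xs(1) le[of xs] by (simp add: Q_def)
    show "length zs \<le> length xs \<or> length zs = card V" if "cyc E zs" for zs using xs(2)[of zs] that by (auto simp: Q_def)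
  qed
  interpret mc: max_cyc V E "length xs" "set xs"
    using xs(1) cyc_length[of E xs] by unfold_locales (auto simp: Q_def)
  show ?thesis
  proof (cases "length xs + 2 \<le> card V")
    case True
    obtain r x where r: "r \<in> V - set xs" "x \<in> set xs"
      "set xs \<inter> (inreach E (V - set xs) r \<union> outreach E (V - set xs) r) \<subseteq> {x}"
      by (rule mc.cut_vertex_exists[OF True])
    have glued_complete
      unfolding glued_complete_def
    proof (intro exI conjI ballI)
      show "set xs \<subseteq> V" "x \<in> set xs" "2 \<le> card (set xs)" "card (set xs) < card V"
        using mc.S_sub r mc.m_ge_2 mc.card_S l.m_less by auto
    qed (rule mc.cut_vertex[OF r])
    then show ?thesis by blast
  next
    case False
    then have "card (V - set xs) = 1" using mc.card_R l.m_less by simp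
    then obtain y where y: "V - set xs = {y}" by (auto simp: card_1_singleton_iff)
    then have "set xs = V - {y}" "y \<in> V" using mc.S_sub by auto
    then show ?thesis using alternating_case[of xs y] xs(1) by (auto simp: Q_def)
  qed
qed

end

section \<open>Translation to digraphs\<close>

lemma digraph_iso_refl:
  assumes "digraph G"
  shows "digraph_iso G G"
proof -
  interpret digraph G by (rule assms)
  define f where "f = \<lparr>iso_verts = id, iso_arcs = id, iso_head = head G, iso_tail = tail G\<rparr>"
  have "digraph_isomorphism f" unfolding digraph_isomorphism_def f_def using wf_digraph by auto
  moreover have "G = app_iso f G" by (simp add: f_def app_iso_def)
  ultimately show ?thesis unfolding digraph_iso_def by blast
qed

text \<open>Arcs of \<open>G\<close> may be of any type, those of \<open>H\<close> are pairs. As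
  \<open>G\<close> has no parallel arcs, sending each arc to the pair of images of its ends is
  injective, so a bijection of the vertices suffices.\<close>

lemma digraph_iso_projI:
  fixes G :: "('a, 'b) pre_digraph" and H :: "('c, 'c \<times> 'c) pre_digraph"
  assumes G: "digraph G" and H: "tail H = fst" "head H = snd" "arcs H \<subseteq> verts H \<times> verts H"
    and f: "bij_betw f (verts H) (verts G)"
    and arcs: "\<And>a b. a \<in> verts H \<Longrightarrow> b \<in> verts H \<Longrightarrow> (a, b) \<in> arcs H \<longleftrightarrow> f a \<rightarrow>\<^bsub>G\<^esub> f b"
  shows "digraph_iso G H"
proof -
  interpret digraph G by (rule G)
  define h where "h = inv_into (verts H) f"
  have h: "bij_betw h (verts G) (verts H)" using bij_betw_inv_into[OF f] by (simp add: h_def)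
  have fh: "f (h v) = v" if "v \<in> verts G" for v using that f by (simp add: h_def bij_betw_inv_into_right)
  have hf: "h (f a) = a" if "a \<in> verts H" for a using that f by (simp add: h_def bij_betw_inv_into_left)
  have hin: "h v \<in> verts H" if "v \<in> verts G" for v using that h by (auto simp: bij_betw_def)
  define F where "F = \<lparr>iso_verts = h, iso_arcs = (\<lambda>e. (h (tail G e), h (head G e))),
    iso_head = (snd :: 'c \<times> 'c \<Rightarrow> 'c), iso_tail = (fst :: 'c \<times> 'c \<Rightarrow> 'c)\<rparr>"
  have inj: "inj_on h (verts G)" using h by (auto simp: bij_betw_def)
  have "inj_on (\<lambda>e. (h (tail G e), h (head G e))) (arcs G)"
  proof (rule inj_onI)
    fix e e' assume e: "e \<in> arcs G" "e' \<in> arcs G"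
      and "(h (tail G e), h (head G e)) = (h (tail G e'), h (head G e'))"
    then have "arc_to_ends G e = arc_to_ends G e'" using inj by (auto simp: arc_to_ends_def inj_on_eq_iff)
    then show "e = e'" using no_multi_arcs e by blast
  qed
  then have "digraph_isomorphism F"
    using inj wf_digraph by (auto simp: digraph_isomorphism_def F_def)
  moreover have "H = app_iso F G"
  proof -
    have "arcs H = (\<lambda>e. (h (tail G e), h (head G e))) ` arcs G" (is "_ = ?R")
    proof
      show "arcs H \<subseteq> ?R"
      proof
        fix ab assume ab: "ab \<in> arcs H"
        obtain a b where [simp]: "ab = (a, b)" by fastforce
        have V: "a \<in> verts H" "b \<in> verts H" using ab H(3) by auto
        then have "f a \<rightarrow>\<^bsub>G\<^esub> f b" using arcs ab by simp
        then obtain e where "e \<in> arcs G" "tail G e = f a" "head G e = f b"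
          by (auto simp: arcs_ends_def arc_to_ends_def)
        then show "ab \<in> ?R" using hf V by force
      qed
      show "?R \<subseteq> arcs H"
      proof
        fix ab assume "ab \<in> ?R"
        then obtain e where e: "e \<in> arcs G" "ab = (h (tail G e), h (head G e))" by auto
        then have "tail G e \<rightarrow>\<^bsub>G\<^esub> head G e" by (auto simp: arcs_ends_def arc_to_ends_def)
        then show "ab \<in> arcs H" using arcs[OF hin hin, of "tail G e" "head G e"] e fh by simp
      qed
    qed
    moreover have "verts H = h ` verts G" using h by (simp add: bij_betw_def)
    ultimately show ?thesis using H(1,2) by (simp add: app_iso_def F_def)
  qed
  ultimately show ?thesis unfolding digraph_iso_def by blast
qed

lemma successively_vwalk_arcs: "successively P xs \<longleftrightarrow> (\<forall>(a, b)\<in>set (vwalk_arcs xs). P a b)"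
  by (induction xs rule: vwalk_arcs.induct) auto

context digraph
begin

abbreviation dom :: "'a \<Rightarrow> 'a \<Rightarrow> bool" where
  "dom u v \<equiv> u \<rightarrow>\<^bsub>G\<^esub> v"

lemma card_out_arcs: "out_degree G x = card {v \<in> verts G. x \<rightarrow>\<^bsub>G\<^esub> v}"
proof -
  have "inj_on (head G) (out_arcs G x)"
    by (rule inj_onI) (auto simp: out_arcs_def arc_to_ends_def intro: no_multi_arcs)
  moreover have "head G ` out_arcs G x = {v \<in> verts G. x \<rightarrow>\<^bsub>G\<^esub> v}"
    by (force simp: out_arcs_def arcs_ends_def arc_to_ends_def)
  ultimately show ?thesis unfolding out_degree_def by (metis card_image)
qed

lemma card_in_arcs: "in_degree G x = card {v \<in> verts G. v \<rightarrow>\<^bsub>G\<^esub> x}"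
proof -
  have "inj_on (tail G) (in_arcs G x)"
    by (rule inj_onI) (auto simp: in_arcs_def arc_to_ends_def intro: no_multi_arcs)
  moreover have "tail G ` in_arcs G x = {v \<in> verts G. v \<rightarrow>\<^bsub>G\<^esub> x}"
    by (force simp: in_arcs_def arcs_ends_def arc_to_ends_def)
  ultimately show ?thesis unfolding in_degree_def by (metis card_image)
qed

lemma total_degree_deg: "total_degree G x = deg dom x (verts G)"
  unfolding total_degree_def card_out_arcs card_in_arcs by (rule deg_card[symmetric]) simp

lemma hamiltonian_bypassI:
  assumes xs: "path dom xs" "set xs = verts G" and b: "hd xs \<rightarrow>\<^bsub>G\<^esub> last xs"
  shows "\<exists>H. hamiltonian_bypass H G"
proof -
  define A where "A = insert (hd xs, last xs) (set (vwalk_arcs xs))"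
  have A: "A \<subseteq> arcs_ends G"
    using xs(1) b by (auto simp: A_def path_def successively_vwalk_arcs)
  define H where "H = \<lparr>verts = verts G, arcs = {e \<in> arcs G. arc_to_ends G e \<in> A}, tail = tail G, head = head G\<rparr>"
  have "wf_digraph H" by unfold_locales (auto simp: H_def)
  then have "subgraph H G" using wf_digraph by (auto simp: subgraph_def compatible_def H_def)
  moreover have "arcs_ends H = A"
    using A by (auto simp: arcs_ends_def arc_to_ends_def H_def)
  moreover have "hamiltonian_path xs G"
    using xs A by (auto simp: hamiltonian_path_def vpath_def vwalk_def path_def A_def)
  ultimately have "hamiltonian_bypass H G"
    unfolding hamiltonian_bypass_def using xs(2) by (intro conjI exI[of _ xs]) (auto simp: A_def H_def)
  then show ?thesis by blast
qed

lemma ore_graphI: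
  assumes sc: "strongly_connected G" and c3: "3 \<le> card (verts G)"
    and ore: "\<forall>x\<in>verts G. \<forall>y\<in>verts G. x \<noteq> y \<and> \<not> adjacent G x y \<longrightarrow>
           total_degree G x + total_degree G y \<ge> 2 * card (verts G) - 2"
    and nb: "\<nexists>H. hamiltonian_bypass H G"
  shows "ore_graph (verts G) dom"
proof
  show "u \<in> verts G \<and> v \<in> verts G \<and> u \<noteq> v" if "u \<rightarrow>\<^bsub>G\<^esub> v" for u v
    using that no_loops by (auto simp: arcs_ends_def arc_to_ends_def)
  show "dom\<^sup>*\<^sup>* u v" if "u \<in> verts G" "v \<in> verts G" for u v
  proof -
    have "u \<rightarrow>\<^sup>*\<^bsub>G\<^esub> v" using sc that by (auto simp: strongly_connected_def)
    then show ?thesis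
      by (induction rule: reachable_induct) (auto intro: rtranclp.rtrancl_into_rtrancl)
  qed
  show "2 * card (verts G) \<le> deg dom u (verts G) + deg dom v (verts G) + 2"
    if "u \<in> verts G" "v \<in> verts G" "u \<noteq> v" "narcs dom u v = 0" for u v
  proof -
    have "\<not> adjacent G u v" using that(4) by (auto simp: adjacent_def narcs_0_iff)
    then have "2 * card (verts G) - 2 \<le> total_degree G u + total_degree G v" using ore that by blast
    then show ?thesis unfolding total_degree_deg by linarith
  qed
  show "\<not> hd xs \<rightarrow>\<^bsub>G\<^esub> last xs" if "path dom xs" "set xs = verts G" for xs
    using hamiltonian_bypassI[OF that] nb by blast
qed (use c3 in auto)

end

theorem theorem1p18:
  fixes G :: "('a, 'b) pre_digraph" and p :: nat
  assumes "digraph G"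
    and "strongly_connected G"
    and "card (verts G) = p"
    and "p \<ge> 3"
    and "\<forall>x\<in>verts G. \<forall>y\<in>verts G. x \<noteq> y \<and> \<not> adjacent G x y \<longrightarrow>
           total_degree G x + total_degree G y \<ge> 2 * p - 2"
  shows "(\<exists>H. hamiltonian_bypass H G) \<or>
         (\<exists>H :: ('a, 'b) pre_digraph. type_D0 H \<and> digraph_iso G H) \<or>
         (\<exists>k\<in>{1..p - 2}. digraph_iso G (D_graph (p - k) k)) \<or>
         digraph_iso G (with_proj T5) \<or>
         digraph_iso G (with_proj C3)"
proof (cases "\<exists>H. hamiltonian_bypass H G")
  case False
  interpret digraph G by (rule assms(1))
  interpret o: ore_graph "verts G" dom
    using ore_graphI[OF assms(2)] assms(3-5) False by auto
  consider "o.split_independent" | "o.glued_complete" | "o.T5_like" | "o.C3_like"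
    using o.no_bypass_cases by blast
  then show ?thesis
  proof cases
    case 1
    then obtain A where A: "A \<subseteq> verts G" "2 * card A = p + 1" "\<forall>a\<in>A. \<forall>b\<in>A. \<not> dom a b"
      "\<forall>a\<in>A. \<forall>b\<in>verts G - A. dom a b \<and> dom b a"
      unfolding o.split_independent_def using assms(3) by blast
    have "odd p" using A(2) by presburger
    moreover have "card (verts G - A) = p - card A"
      using A(1) assms(3) card_Diff_subset[OF finite_subset[OF A(1) finite_verts] A(1)] by simp
    ultimately have c: "odd (card (verts G))" "card A = (card (verts G) + 1) div 2"
      "card (verts G - A) = (card (verts G) - 1) div 2" using A(2) assms(3) by simp_all
    have "\<forall>a\<in>A. \<forall>a'\<in>A. \<not> adjacent G a a'" using A(3) by (auto simp: adjacent_def)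
    moreover have "verts G = A \<union> (verts G - A)" "A \<inter> (verts G - A) = {}" using A(1) by auto
    ultimately have "type_D0 G"
      unfolding type_D0_def using c assms(1,3,4) A(4) by blast
    then show ?thesis using digraph_iso_refl[OF assms(1)] by blast
  next
    case 2
    then obtain S x where S: "S \<subseteq> verts G" "x \<in> S" "2 \<le> card S" "card S < p"
      "\<forall>u\<in>verts G. \<forall>v\<in>verts G. dom u v \<longleftrightarrow>
        u \<noteq> v \<and> (u \<in> S \<and> v \<in> S \<or> u \<in> insert x (verts G - S) \<and> v \<in> insert x (verts G - S))"
      unfolding o.glued_complete_def using assms(3) by blast
    define m where "m = card S"
    define k where "k = p - m"
    have mk: "2 \<le> m" "1 \<le> k" "m + k = p" "p - k = m" using S(3,4) by (auto simp: m_def k_def)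
    have fin: "finite S" using S(1) finite_subset by auto
    have cards: "card (S - {x}) = m - 1" "card (verts G - S) = k"
      using S(1,2) fin assms(3) by (simp_all add: m_def k_def card_Diff_subset)
    obtain f1 where f1: "bij_betw f1 (S - {x}) {0..<m - 1}"
      using ex_bij_betw_finite_nat[of "S - {x}"] fin cards by auto
    obtain f2 where f2: "bij_betw f2 (verts G - S) {0..<k}"
      using ex_bij_betw_finite_nat[of "verts G - S"] cards by auto
    \<comment> \<open>\<open>x\<close> becomes \<open>m - 1\<close>, the vertex shared by the two
      complete parts of \<open>D_graph m k\<close>; the rest of \<open>S\<close> takes the smaller
      numbers and the complement those from \<open>m\<close> on.\<close>
    define h where "h u = (if u = x then m - 1 else if u \<in> S then f1 u else m + f2 u)" for u
    have h1: "h u < m - 1" if "u \<in> S" "u \<noteq> x" for u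
      using f1 that by (auto simp: h_def bij_betw_def)
    have h2: "m \<le> h u" "h u < m + k" if "u \<in> verts G" "u \<notin> S" for u
      using f2 that S(2) by (auto simp: h_def bij_betw_def)
    have hx: "h x = m - 1" by (simp add: h_def)
    have b1: "bij_betw h (S - {x}) {0..<m - 1}"
      using f1 by (rule bij_betw_cong[THEN iffD1, rotated]) (simp add: h_def)
    have b2: "bij_betw h {x} {m - 1}" using hx by (auto simp: bij_betw_def)
    have b3: "bij_betw h (verts G - S) {m..<m + k}"
    proof -
      have "bij_betw (\<lambda>i. m + i) {0..<k} {m..<m + k}" by (auto simp: bij_betw_def image_add_atLeastLessThan)
      from bij_betw_trans[OF f2 this] show ?thesis
        by (rule bij_betw_cong[THEN iffD1, rotated]) (use S(2) in \<open>auto simp: h_def\<close>)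
    qed
    have "bij_betw h ((S - {x}) \<union> {x} \<union> (verts G - S)) ({0..<m - 1} \<union> {m - 1} \<union> {m..<m + k})"
      by (intro bij_betw_combine b1 b2 b3) (use mk in auto)
    moreover have "(S - {x}) \<union> {x} \<union> (verts G - S) = verts G" using S(1,2) by auto
    moreover have "{0..<m - 1} \<union> {m - 1} \<union> {m..<m + k} = {0..<m + k}" using mk by auto
    ultimately have h: "bij_betw h (verts G) {0..<m + k}" by simp
    define f where "f = inv_into (verts G) h"
    have f: "bij_betw f {0..<m + k} (verts G)" using bij_betw_inv_into[OF h] by (simp add: f_def)
    have hf: "h (f a) = a" if "a < m + k" for a using that h by (simp add: f_def bij_betw_inv_into_right)
    have fV: "f a \<in> verts G" if "a < m + k" for a using that f by (auto simp: bij_betw_def)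
    have inS: "f a \<in> S \<longleftrightarrow> a < m" "f a \<in> insert x (verts G - S) \<longleftrightarrow> m - 1 \<le> a" if a: "a < m + k" for a
      using h1[of "f a"] h2[of "f a"] hx hf[OF a] fV[OF a] mk S(2) by (cases "f a = x"; cases "f a \<in> S"; auto)+
    have feq: "f a = f b \<longleftrightarrow> a = b" if "a < m + k" "b < m + k" for a b
      using that hf by metis
    have vD: "verts (D_graph m k) = {0..<m + k}"
      using mk by (auto simp: D_graph_def Digraph_Component.union_def complete_symmetric_on_def)
    have aD: "arcs (D_graph m k) = {(a, b). a \<noteq> b \<and> (a \<in> {0..<m} \<and> b \<in> {0..<m} \<or> a \<in> {m - 1..<m + k} \<and> b \<in> {m - 1..<m + k})}"
      by (auto simp: D_graph_def Digraph_Component.union_def complete_symmetric_on_def)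
    have "digraph_iso G (D_graph m k)"
    proof (rule digraph_iso_projI[OF assms(1)])
      show "tail (D_graph m k) = fst" "head (D_graph m k) = snd"
        by (simp_all add: D_graph_def Digraph_Component.union_def)
      show "arcs (D_graph m k) \<subseteq> verts (D_graph m k) \<times> verts (D_graph m k)" unfolding vD aD by auto
      show "bij_betw f (verts (D_graph m k)) (verts G)" unfolding vD by (rule f)
      show "(a, b) \<in> arcs (D_graph m k) \<longleftrightarrow> dom (f a) (f b)"
        if "a \<in> verts (D_graph m k)" "b \<in> verts (D_graph m k)" for a b
      proof -
        have ab: "a < m + k" "b < m + k" using that unfolding vD by auto
        show ?thesis
          using S(5) fV[OF ab(1)] fV[OF ab(2)] inS[OF ab(1)] inS[OF ab(2)] feq[OF ab] ab unfolding aD by auto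
      qed
    qed
    then show ?thesis using mk by (intro disjI2 disjI1 bexI[of _ k]) auto
  next
    case 3
    then obtain f where f: "inj f" "range f = verts G" "\<forall>u v. dom (f u) (f v) \<longleftrightarrow> (u, v) \<in> parcs T5"
      unfolding o.T5_like_def by blast
    have U: "pverts T5 = UNIV" using T5_vertex.exhaust by (auto simp: T5_def)
    have "digraph_iso G (with_proj T5)"
      by (rule digraph_iso_projI[OF assms(1), where f = f]) (use f U in \<open>auto simp: bij_betw_def\<close>)
    then show ?thesis by blast
  next
    case 4
    then obtain f where f: "bij_betw f {0, 1, 2} (verts G)"
      "\<forall>u\<in>{0, 1, 2}. \<forall>v\<in>{0, 1, 2}. dom (f u) (f v) \<longleftrightarrow> (u, v) \<in> parcs C3"
      unfolding o.C3_like_def by blast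
    have U: "verts (with_proj C3) = {0, 1, 2}" by (simp add: C3_def)
    have "digraph_iso G (with_proj C3)"
    proof (rule digraph_iso_projI[OF assms(1)])
      show "arcs (with_proj C3) \<subseteq> verts (with_proj C3) \<times> verts (with_proj C3)" by (auto simp: C3_def)
      show "bij_betw f (verts (with_proj C3)) (verts G)" unfolding U by (rule f(1))
      show "(a, b) \<in> arcs (with_proj C3) \<longleftrightarrow> dom (f a) (f b)"
        if "a \<in> verts (with_proj C3)" "b \<in> verts (with_proj C3)" for a b
      proof -
        have "a \<in> {0, 1, 2}" "b \<in> {0, 1, 2}" using that unfolding U .
        from f(2)[rule_format, OF this] show ?thesis by (simp only: with_proj_simps)
      qed
    qed simp_all
    then show ?thesis by blast
  qed
qed blast

end
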